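(* Let $I$ be a compact arc and $f\colon I\to I$ a homeomorphism. Then $f$ admits a kinematic expansive suspension if and only if the set of periodic points of $f$ has finitely many connected components and the period function (assigning to each periodic point of $f$ its least period) is continuous on the set of periodic points (i.e., in the orientation reversing case, the fixed point is not accumulated by points of period 2).
   Context: Given a homeomorphism $f\colon l\to l$ of a compact metric space and a continuous return time function $T\colon l\to\mathbb{R}^+=(0,\infty)$, the suspension of $f$ with return time $T$ is the flow on the quotient of $\{(x,t):x\in l,\ 0\le t\le T(x)\}$ by $(x,T(x))\sim(f(x),0)$ that moves points along the second coordinate at unit speed. A homeomorphism admits a kinematic expansive suspension if for some such $T$ its suspension is kinematic expansive. A continuous flow $\phi$ on a compact metric space is kinematic expansive if for all $\epsilon>0$ there exists $\delta>0$ such that if $\operatorname{dist}(\phi_t(x),\phi_t(y))<\delta$ for all $t\in\mathbb{R}$ then there exists $s\in\mathbb{R}$ with $|s|<\epsilon$ and $y=\phi_s(x)$ (this does not depend on the metric inducing the topology). Fixed points are periodic points of period 1. *)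

theory Defs
  imports "HOL-Analysis.Analysis"
begin

definition quotient_topology :: "'a topology \<Rightarrow> ('a \<times> 'a) set \<Rightarrow> 'a set topology" where
  "quotient_topology X r = topology (\<lambda>U. U \<subseteq> topspace X // r \<and> openin X (\<Union>U))"

lemma openin_quotient_topology:
  assumes "equiv (topspace X) r"
  shows "openin (quotient_topology X r) U \<longleftrightarrow> U \<subseteq> topspace X // r \<and> openin X (\<Union>U)"
proof -
  have "istopology (\<lambda>U. U \<subseteq> topspace X // r \<and> openin X (\<Union>U))"
    unfolding istopology_def
  proof (intro conjI allI impI)
    fix S T
    assume S: "S \<subseteq> topspace X // r \<and> openin X (\<Union>S)"
      and T: "T \<subseteq> topspace X // r \<and> openin X (\<Union>T)"
    have "\<Union>(S \<inter> T) = \<Union>S \<inter> \<Union>T"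
    proof
      show "\<Union>S \<inter> \<Union>T \<subseteq> \<Union>(S \<inter> T)"
      proof
        fix x assume "x \<in> \<Union>S \<inter> \<Union>T"
        then obtain A B where "A \<in> S" "x \<in> A" "B \<in> T" "x \<in> B" by blast
        moreover from this have "A = B"
          using quotient_disj[OF assms, of A B] S T by blast
        ultimately show "x \<in> \<Union>(S \<inter> T)" by blast
      qed
    qed blast
    then show "openin X (\<Union>(S \<inter> T))" using S T by (simp only: openin_Int)
    show "S \<inter> T \<subseteq> topspace X // r" using S by blast
  next
    fix K
    assume K: "\<forall>S\<in>K. S \<subseteq> topspace X // r \<and> openin X (\<Union>S)"
    then show "\<Union>K \<subseteq> topspace X // r" by blast
    have "\<Union>(\<Union>K) = (\<Union>S\<in>K. \<Union>S)" by blast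
    then show "openin X (\<Union>(\<Union>K))" using K by (simp only:) (rule openin_Union, blast)
  qed
  then show ?thesis by (simp add: quotient_topology_def)
qed

definition continuous_flow :: "'a topology \<Rightarrow> (real \<Rightarrow> 'a \<Rightarrow> 'a) \<Rightarrow> bool" where
  "continuous_flow X \<phi> \<longleftrightarrow>
     continuous_map (prod_topology euclideanreal X) X (\<lambda>(t, x). \<phi> t x) \<and>
     (\<forall>x\<in>topspace X. \<phi> 0 x = x) \<and>
     (\<forall>s t. \<forall>x\<in>topspace X. \<phi> (s + t) x = \<phi> s (\<phi> t x))"

definition kinematic_expansive ::
    "'a set \<Rightarrow> ('a \<Rightarrow> 'a \<Rightarrow> real) \<Rightarrow> (real \<Rightarrow> 'a \<Rightarrow> 'a) \<Rightarrow> bool" where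
  "kinematic_expansive M d \<phi> \<longleftrightarrow>
     Metric_space M d \<and>
     compact_space (Metric_space.mtopology M d) \<and>
     continuous_flow (Metric_space.mtopology M d) \<phi> \<and>
     (\<forall>\<epsilon>>0. \<exists>\<delta>>0. \<forall>x\<in>M. \<forall>y\<in>M.
        (\<forall>t. d (\<phi> t x) (\<phi> t y) < \<delta>) \<longrightarrow> (\<exists>s. \<bar>s\<bar> < \<epsilon> \<and> y = \<phi> s x))"

definition suspension_domain :: "'a set \<Rightarrow> ('a \<Rightarrow> real) \<Rightarrow> ('a \<times> real) set" where
  "suspension_domain l T = {(x, t). x \<in> l \<and> 0 \<le> t \<and> t \<le> T x}"

definition suspension_rel ::
    "'a set \<Rightarrow> ('a \<Rightarrow> 'a) \<Rightarrow> ('a \<Rightarrow> real) \<Rightarrow> (('a \<times> real) \<times> ('a \<times> real)) set" where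
  "suspension_rel l f T =
     {(p, q). p \<in> suspension_domain l T \<and> q \<in> suspension_domain l T \<and>
        equivclp (\<lambda>p q. \<exists>x\<in>l. p = (x, T x) \<and> q = (f x, 0)) p q}"

lemma equiv_suspension_rel: "equiv (suspension_domain l T) (suspension_rel l f T)"
  unfolding suspension_rel_def
  by (intro equivI refl_onI symI transI) (auto intro: equivclp_sym equivclp_trans)

definition suspension_topology ::
    "('a::topological_space) set \<Rightarrow> ('a \<Rightarrow> 'a) \<Rightarrow> ('a \<Rightarrow> real) \<Rightarrow> ('a \<times> real) set topology" where
  "suspension_topology l f T =
     quotient_topology (top_of_set (suspension_domain l T)) (suspension_rel l f T)"

text \<open>For continuous, strictly positive \<open>T\<close> on a compact \<open>l\<close>, the conditions below determine
  the flow uniquely: \<open>T\<close> is bounded away from \<open>0\<close>, so unit-speed motion inside the fibres,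
  concatenated by the flow law, fixes the motion for all times.\<close>

definition suspension_flow ::
    "('a::topological_space) set \<Rightarrow> ('a \<Rightarrow> 'a) \<Rightarrow> ('a \<Rightarrow> real) \<Rightarrow>
     (real \<Rightarrow> ('a \<times> real) set \<Rightarrow> ('a \<times> real) set) \<Rightarrow> bool" where
  "suspension_flow l f T \<phi> \<longleftrightarrow>
     continuous_flow (suspension_topology l f T) \<phi> \<and>
     (\<forall>x\<in>l. \<forall>t s. 0 \<le> t \<and> 0 \<le> s \<and> t + s \<le> T x \<longrightarrow>
        \<phi> s (suspension_rel l f T `` {(x, t)}) = suspension_rel l f T `` {(x, t + s)})"

text \<open>Kinematic expansivity of a flow on a compact space does not depend on the metric inducing
  the topology, so some compatible metric on the quotient is as good as any.\<close>

definition admits_kinematic_expansive_suspension ::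
    "('a::topological_space) set \<Rightarrow> ('a \<Rightarrow> 'a) \<Rightarrow> bool" where
  "admits_kinematic_expansive_suspension l f \<longleftrightarrow>
     (\<exists>T \<phi> M d. continuous_on l T \<and> (\<forall>x\<in>l. 0 < T x) \<and>
        suspension_flow l f T \<phi> \<and>
        Metric_space M d \<and> Metric_space.mtopology M d = suspension_topology l f T \<and>
        kinematic_expansive M d \<phi>)"

definition periodic_points :: "'a set \<Rightarrow> ('a \<Rightarrow> 'a) \<Rightarrow> 'a set" where
  "periodic_points l f = {x \<in> l. \<exists>n\<ge>1. (f ^^ n) x = x}"

definition least_period :: "('a \<Rightarrow> 'a) \<Rightarrow> 'a \<Rightarrow> nat" where
  "least_period f x = (LEAST n. n \<ge> 1 \<and> (f ^^ n) x = x)"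

end

theory Submission
  imports Defs "HOL-Real_Asymp.Real_Asymp"
begin

text \<open>In both orientations the periodic points are the fixed points of the increasing map \<open>f ^^ 2\<close>.

  Let \<open>p\<close> satisfy \<open>(f ^^ m) p = p\<close>, and let \<open>\<tau>\<close> be the period of its orbit under the suspension flow,
  run through \<open>m\<close> times. If the orbit of \<open>x\<close> under \<open>f ^^ m\<close> stays close to \<open>p\<close>, then \<open>\<phi> \<tau> z\<close> stays
  close to \<open>z\<close> along the whole orbit of the point \<open>z\<close> over \<open>x\<close>, and expansivity forces \<open>(f ^^ m) x = x\<close>.
  With \<open>m = 2\<close> this excludes small gaps in the set of periodic points, hence infinitely many
  components; with \<open>m = 1\<close> it excludes points of period 2 near the fixed point.

  Conversely, a suspension with return time \<open>T\<close> is kinematic expansive as soon as two points of the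
  interval coincide whenever their orbits stay close and the differences of their Birkhoff sums of \<open>T\<close>
  are bounded in both time directions. For an increasing map one takes \<open>T\<close> strictly decreasing on
  the fixed points, so that orbits with different limits drift apart, and adds to it a bump in
  each of the finitely many gaps. Along the orbit of a point \<open>z\<close> of a fundamental domain
  of the gap, the Birkhoff sums of the bump grow like \<open>\<psi>1 z * sqrt n + \<psi>2 z * ln n\<close>, where
  \<open>(\<psi>1, \<psi>2)\<close> is injective on the fundamental domain.\<close>

section \<open>Suspensions\<close>

text \<open>Bounded drift detects only sums that diverge, while a continuous bump vanishing at the
  ends of its gap has values tending to 0 along every orbit. This is why slowly growing sums with
  increments tending to 0 are used. A gap modulo the map is a circle, and no continuous real
  function is injective on a circle, so one coefficient would not suffice; a pair of functions can
  be injective. The rates sqrt n and ln n serve because a combination of them is bounded only if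
  both coefficients vanish. The strictly decreasing part of the roof does not interfere: inside a
  fundamental domain two orbits interleave, and its sums along them differ by at most the length of
  the gap. Drift changes by a bounded amount along an orbit and so identifies only the orbit; that
  the orbits also stay closer than the least displacement over the fundamental domain identifies the
  point. The suspension is an abstract quotient, so a metric for it has to be produced too; this is
  done by an explicit embedding.\<close>

lemma topspace_quotient_topology:
  assumes "equiv (topspace X) r"
  shows "topspace (quotient_topology X r) = topspace X // r"
proof -
  have "openin (quotient_topology X r) (topspace X // r)"
    by (simp add: openin_quotient_topology[OF assms] Union_quotient[OF assms])
  moreover have "topspace (quotient_topology X r) \<subseteq> topspace X // r"
    using openin_topspace[of "quotient_topology X r"] by (simp only: openin_quotient_topology[OF assms])
  ultimately show ?thesis
    by (intro equalityI openin_subset)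
qed

locale suspension =
  fixes l :: "'a::metric_space set" and f g :: "'a \<Rightarrow> 'a" and T :: "'a \<Rightarrow> real"
  assumes compact_l: "compact l"
    and homeo: "homeomorphism l l f g"
    and cont_T: "continuous_on l T"
    and T_pos: "\<And>x. x \<in> l \<Longrightarrow> 0 < T x"
begin

lemma f_in [simp]: "x \<in> l \<Longrightarrow> f x \<in> l" and g_in [simp]: "x \<in> l \<Longrightarrow> g x \<in> l"
  and gf [simp]: "x \<in> l \<Longrightarrow> g (f x) = x" and fg [simp]: "x \<in> l \<Longrightarrow> f (g x) = x"
  and cont_f: "continuous_on l f" and cont_g: "continuous_on l g"
  using homeo by (auto simp: homeomorphism_def)

lemma fpow_in [simp]: "x \<in> l \<Longrightarrow> (f ^^ n) x \<in> l"
  by (induction n) auto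

lemma gpow_in [simp]: "x \<in> l \<Longrightarrow> (g ^^ n) x \<in> l"
  by (induction n) auto

lemma gpow_fpow [simp]: "x \<in> l \<Longrightarrow> (g ^^ n) ((f ^^ n) x) = x"
  by (induction n arbitrary: x) (auto simp: funpow_swap1)

lemma fpow_gpow [simp]: "x \<in> l \<Longrightarrow> (f ^^ n) ((g ^^ n) x) = x"
  by (induction n arbitrary: x) (auto simp: funpow_swap1)

section \<open>Birkhoff sums and the orbit relation on \<open>l \<times> UNIV\<close>\<close>

definition D where "D = suspension_domain l T"

definition R where "R = suspension_rel l f T"

definition S :: "nat \<Rightarrow> 'a \<Rightarrow> real" where "S n x = (\<Sum>i<n. T ((f ^^ i) x))"

text \<open>The suspension is also the quotient of all of \<open>l \<times> UNIV\<close> by the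
  powers of \<open>shift\<close>, where (x, s) stands for the point reached from (x, 0) after time
  s. In this form s may be any real, and the flow is addition in the second coordinate.\<close>

definition shift :: "'a \<times> real \<Rightarrow> 'a \<times> real" where "shift p = (f (fst p), snd p - T (fst p))"

text \<open>Forward powers on both sides express the orbit relation without an inverse of
  \<open>shift\<close>; being powers of one map they commute, which gives transitivity.\<close>

definition orb where "orb p q \<longleftrightarrow> (\<exists>m n. (shift ^^ m) p = (shift ^^ n) q)"

text \<open>Cutting the orbit down to \<open>D\<close> yields literally the classes of the given
  quotient, while \<open>p\<close> itself may lie outside \<open>D\<close>.\<close>

definition cls :: "'a \<times> real \<Rightarrow> ('a \<times> real) set" where "cls p = {q \<in> D. orb p q}"

lemma D_iff: "(x, t) \<in> D \<longleftrightarrow> x \<in> l \<and> 0 \<le> t \<and> t \<le> T x"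
  by (auto simp: D_def suspension_domain_def)

lemma S_0 [simp]: "S 0 x = 0" and S_Suc: "S (Suc n) x = S n x + T ((f ^^ n) x)"
  by (auto simp: S_def)

lemma S_Suc': "S (Suc n) x = T x + S n (f x)"
  by (simp only: S_def sum.lessThan_Suc_shift funpow_Suc_right o_def) simp

lemma S_add: "S (m + n) x = S m x + S n ((f ^^ m) x)"
  by (induction n) (simp_all add: S_Suc funpow_add add.commute[of m])

lemma shift_pow: "(shift ^^ n) (x, s) = ((f ^^ n) x, s - S n x)"
  by (induction n) (auto simp: shift_def S_Suc)

lemma S_nonneg: "x \<in> l \<Longrightarrow> 0 \<le> S n x"
  unfolding S_def by (intro sum_nonneg less_imp_le T_pos fpow_in)

lemma S_pos: "x \<in> l \<Longrightarrow> 0 < n \<Longrightarrow> 0 < S n x"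
  unfolding S_def by (intro sum_pos T_pos fpow_in) auto

lemma T_bounds:
  assumes "l \<noteq> {}"
  obtains a b where "0 < a" "\<And>x. x \<in> l \<Longrightarrow> a \<le> T x" "\<And>x. x \<in> l \<Longrightarrow> T x \<le> b"
proof -
  obtain u where "u \<in> l" "\<And>x. x \<in> l \<Longrightarrow> T u \<le> T x"
    using continuous_attains_inf[OF compact_l assms cont_T] by blast
  moreover obtain v where "v \<in> l" "\<And>x. x \<in> l \<Longrightarrow> T x \<le> T v"
    using continuous_attains_sup[OF compact_l assms cont_T] by blast
  ultimately show thesis using T_pos that by blast
qed

lemma orb_refl [simp]: "orb p p"
  by (auto simp: orb_def)

lemma orb_sym: "orb p q \<Longrightarrow> orb q p"
  unfolding orb_def by metis

lemma orb_trans: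
  assumes "orb p q" "orb q r"
  shows "orb p r"
proof -
  obtain m n m' n' where "(shift ^^ m) p = (shift ^^ n) q" "(shift ^^ m') q = (shift ^^ n') r"
    using assms unfolding orb_def by blast
  then have "(shift ^^ (m' + m)) p = (shift ^^ m') ((shift ^^ n) q)"
    by (simp add: funpow_add)
  also have "\<dots> = (shift ^^ n) ((shift ^^ m') q)"
    by (simp add: funpow_add[symmetric, THEN fun_cong, unfolded o_def] add.commute)
  also have "\<dots> = (shift ^^ (n + n')) r"
    using \<open>(shift ^^ m') q = (shift ^^ n') r\<close> by (simp add: funpow_add)
  finally show ?thesis unfolding orb_def by blast
qed

lemma orb_shift: "orb p ((shift ^^ n) p)"
  unfolding orb_def by (intro exI[of _ n] exI[of _ 0]) simp

lemma orb_fpow: "orb (x, s) ((f ^^ n) x, s - S n x)"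
  using orb_shift[of "(x, s)" n] by (simp add: shift_pow)

lemma orb_add:
  assumes "orb (x, s) (y, r)"
  shows "orb (x, s + t) (y, r + t)"
proof -
  obtain m n where "(f ^^ m) x = (f ^^ n) y" "s - S m x = r - S n y"
    using assms by (auto simp: orb_def shift_pow)
  then have "(shift ^^ m) (x, s + t) = (shift ^^ n) (y, r + t)"
    by (simp add: shift_pow)
  then show ?thesis unfolding orb_def by blast
qed

text \<open>As \<open>f\<close> is injective on \<open>l\<close>, the smaller of the two powers
  cancels, so one of the points is a forward image of the other.\<close>

lemma orb_iff_shift:
  assumes "x \<in> l" "y \<in> l"
  shows "orb (x, s) (y, r) \<longleftrightarrow>
    (\<exists>n. (y, r) = ((f ^^ n) x, s - S n x) \<or> (x, s) = ((f ^^ n) y, r - S n y))"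
proof
  have *: "\<exists>k. (y, r) = ((f ^^ k) x, s - S k x)"
    if "(f ^^ m) x = (f ^^ n) y" "s - S m x = r - S n y" "n \<le> m" "x \<in> l" "y \<in> l" for x y s r m n
  proof
    have m: "m = (m - n) + n" using that by simp
    have "(f ^^ n) ((f ^^ (m - n)) x) = (f ^^ n) y"
      using that(1) m funpow_add[of n "m - n" f] by (simp add: add.commute o_def)
    then have y: "(f ^^ (m - n)) x = y"
      using that(4,5) by (metis fpow_in gpow_fpow)
    have "S m x = S (m - n) x + S n y"
      using S_add[of "m - n" n x] m y by simp
    then show "(y, r) = ((f ^^ (m - n)) x, s - S (m - n) x)" using y that by auto
  qed
  assume "orb (x, s) (y, r)"
  then obtain m n where mn: "(f ^^ m) x = (f ^^ n) y" "s - S m x = r - S n y"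
    by (auto simp: orb_def shift_pow)
  show "\<exists>n. (y, r) = ((f ^^ n) x, s - S n x) \<or> (x, s) = ((f ^^ n) y, r - S n y)"
  proof (cases "n \<le> m")
    case True
    then show ?thesis using *[OF mn _ assms] by blast
  next
    case False
    then show ?thesis using *[OF mn(1)[symmetric] mn(2)[symmetric] _ assms(2,1)] by force
  qed
next
  assume "\<exists>n. (y, r) = ((f ^^ n) x, s - S n x) \<or> (x, s) = ((f ^^ n) y, r - S n y)"
  then show "orb (x, s) (y, r)"
    by (metis orb_fpow orb_sym)
qed

text \<open>A complete invariant of \<open>orb\<close> on \<open>D\<close>: of two glued points it
  picks the one at the bottom of a fibre.\<close>

definition nf where "nf p = (if snd p = T (fst p) then (f (fst p), 0) else p)"

lemma nf_orb: "orb p (nf p)"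
  using orb_fpow[of "fst p" "snd p" 1] by (auto simp: nf_def S_def)

lemma nf_in:
  assumes "p \<in> D" shows "nf p \<in> D" "snd (nf p) < T (fst (nf p))"
proof -
  obtain x t where p: "p = (x, t)" by fastforce
  then have "0 < T (f x)" using assms T_pos by (auto simp: D_iff)
  then show "nf p \<in> D" "snd (nf p) < T (fst (nf p))"
    using assms p by (auto simp: nf_def D_iff)
qed

text \<open>A point (x, s) of \<open>D\<close> has s at most T x, and Birkhoff sums of length at
  least 2 exceed T x. So two points of \<open>D\<close> in one orbit are equal or glued
  directly.\<close>

lemma orb_imp_nf_eq:
  assumes "p \<in> D" "q \<in> D" "orb p q"
  shows "nf p = nf q"
proof -
  have *: "nf (x, s) = nf ((f ^^ n) x, s - S n x)"
    if "(x, s) \<in> D" "((f ^^ n) x, s - S n x) \<in> D" for x s n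
  proof (cases n)
    case (Suc k)
    have x: "x \<in> l" "s \<le> T x" "S n x \<le> s" using that by (auto simp: D_iff)
    have "k = 0"
      using x S_pos[of "f x" k] unfolding Suc S_Suc' by force
    then have "s = T x" using x Suc by (simp add: S_def)
    then show ?thesis using Suc \<open>k = 0\<close> x T_pos[of "f x"] by (auto simp: nf_def S_def)
  qed simp
  obtain x s y r where pq: "p = (x, s)" "q = (y, r)" by fastforce
  then show ?thesis
    using assms orb_iff_shift[of x y s r] *[of x s] *[of y r] by (auto simp: D_iff)
qed

text \<open>Connects the given closure of the gluing with \<open>orb\<close>. One gluing step is one
  \<open>shift\<close>; conversely every point is glued to its normal form, and normal forms agree
  on orbits.\<close>

lemma R_iff: "(p, q) \<in> R \<longleftrightarrow> p \<in> D \<and> q \<in> D \<and> orb p q"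
proof -
  define E where "E = (\<lambda>p q. \<exists>x\<in>l. p = (x, T x) \<and> q = (f x, 0::real))"
  have *: "orb p q" if "equivclp E p q" for p q
    using that
  proof (induction rule: equivclp_induct)
    case (step q r)
    have "orb q r"
      using step(2) orb_fpow[of "fst q" "snd q" 1] orb_fpow[of "fst r" "snd r" 1] orb_sym
      by (auto simp: E_def S_def)
    then show ?case using step orb_trans by blast
  qed simp
  have n: "equivclp E p (nf p)" if "p \<in> D" for p
    using that by (cases p) (auto simp: nf_def E_def D_iff intro!: r_into_equivclp)
  have "equivclp E p q" if "p \<in> D" "q \<in> D" "orb p q" for p q
    using n[OF that(1)] n[OF that(2)] orb_imp_nf_eq[OF that]
    by (metis equivclp_sym equivclp_trans)
  then show ?thesis
    using * unfolding R_def suspension_rel_def E_def[symmetric] D_def by blast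
qed

lemma R_Image: "p \<in> D \<Longrightarrow> R `` {p} = cls p"
  by (auto simp: R_iff cls_def)

lemma equiv_R: "equiv D R"
  unfolding R_def D_def by (rule equiv_suspension_rel)

lemma cls_eq: "orb p q \<Longrightarrow> cls p = cls q"
  unfolding cls_def using orb_sym orb_trans by blast

text \<open>\<open>T\<close> has a positive lower bound \<open>a\<close>, so every
  \<open>shift\<close> lowers the time s by at least \<open>a\<close>; the induction is on n with s
  < n * a. A negative s is first made nonnegative by going back n fibres.\<close>

lemma exists_rep:
  assumes "x \<in> l"
  shows "\<exists>y t. (y, t) \<in> D \<and> t < T y \<and> orb (x, s) (y, t)"
proof -
  have "l \<noteq> {}" using assms by blast
  then obtain a where a: "0 < a" "\<And>x. x \<in> l \<Longrightarrow> a \<le> T x" using T_bounds by metis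
  have nonneg: "\<exists>y t. (y, t) \<in> D \<and> t < T y \<and> orb (x, s) (y, t)" if "0 \<le> s" "s < real n * a" "x \<in> l" for n x s
    using that
  proof (induction n arbitrary: x s)
    case (Suc n)
    show ?case
    proof (cases "s < T x")
      case True
      then show ?thesis using Suc.prems by (metis D_iff less_imp_le orb_refl)
    next
      case False
      have o: "orb (x, s) (f x, s - T x)" using orb_fpow[of x s 1] by (simp add: S_def)
      have "\<exists>y t. (y, t) \<in> D \<and> t < T y \<and> orb (f x, s - T x) (y, t)"
        using False Suc.prems a(2)[of x] by (intro Suc.IH) (auto simp: algebra_simps)
      then show ?thesis using orb_trans[OF o] by blast
    qed
  qed auto
  have nonneg': "\<exists>y t. (y, t) \<in> D \<and> t < T y \<and> orb (x, s) (y, t)" if "0 \<le> s" "x \<in> l" for x s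
    using nonneg[OF that(1) _ that(2)] reals_Archimedean3[OF a(1)] by blast
  obtain n where n: "- s < real n * a" using reals_Archimedean3[OF a(1)] by blast
  let ?y = "(g ^^ n) x"
  have y: "?y \<in> l" using assms by simp
  have "real n * a \<le> S n ?y"
    using sum_mono[of "{..<n}" "\<lambda>i. a" "\<lambda>i. T ((f ^^ i) ?y)"] a(2) y by (auto simp: S_def)
  then have "0 \<le> s + S n ?y" using n by simp
  from nonneg'[OF this y] show ?thesis
    using orb_fpow[of ?y "s + S n ?y" n] fpow_gpow[OF assms] by (metis add_diff_cancel_right' orb_sym orb_trans)
qed

lemma cls_rep:
  assumes "x \<in> l"
  obtains y t where "(y, t) \<in> D" "t < T y" "orb (x, s) (y, t)" "cls (x, s) = cls (y, t)"
  using exists_rep[OF assms] cls_eq by metis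

lemma cls_in_quotient: "x \<in> l \<Longrightarrow> cls (x, s) \<in> D // R"
  by (metis cls_rep R_Image quotientI)

lemma quotient_cases:
  assumes "C \<in> D // R"
  obtains x t where "(x, t) \<in> D" "C = cls (x, t)"
  using assms by (auto elim!: quotientE simp: R_Image)

lemma orb_if_cls_eq:
  assumes "cls (x, s) = cls (y, r)" "x \<in> l"
  shows "orb (x, s) (y, r)"
proof -
  obtain z t where "(z, t) \<in> D" "orb (x, s) (z, t)"
    using exists_rep[OF assms(2)] by blast
  moreover from this have "(z, t) \<in> cls (y, r)"
    using assms(1) by (auto simp: cls_def)
  then have "orb (y, r) (z, t)" by (simp add: cls_def)
  ultimately show ?thesis using orb_sym orb_trans by blast
qed

lemma cls_add:
  assumes "cls (x, s) = cls (y, r)" "x \<in> l"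
  shows "cls (x, s + t) = cls (y, r + t)"
  using assms cls_eq orb_add orb_if_cls_eq by blast

lemma cls_fpow: "cls ((f ^^ n) x, s) = cls (x, s + S n x)"
  using orb_fpow[of x "s + S n x" n] cls_eq
  by (metis add_diff_cancel_right')

text \<open>Two representatives of a class differ in time by a Birkhoff sum, and a nonempty one is
  at least some value of \<open>T\<close>. Below all return times only the empty sum is
  left.\<close>

lemma cls_near_zero:
  assumes "cls (x, s) = cls (y, r)" "x \<in> l" "y \<in> l"
    and "\<And>z. z \<in> l \<Longrightarrow> \<bar>s - r\<bar> < T z"
  shows "x = y" "s = r"
proof -
  have S: "n = 0" if "z \<in> l" "S n z = \<bar>s - r\<bar>" for n z
  proof (cases n)
    case (Suc k)
    then show ?thesis using that assms(4)[of z] S_nonneg[of "f z" k] by (auto simp: S_Suc')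
  qed simp
  have "orb (x, s) (y, r)" using orb_if_cls_eq assms by blast
  then obtain n where n: "(y, r) = ((f ^^ n) x, s - S n x) \<or> (x, s) = ((f ^^ n) y, r - S n y)"
    using orb_iff_shift assms by blast
  then have "n = 0"
    using S[of x n] S[of y n] S_nonneg[of x n] S_nonneg[of y n] assms(2,3) by auto
  then show "x = y" "s = r" using n by auto
qed

section \<open>The quotient topology and the motion along a suspension flow\<close>

abbreviation X where "X \<equiv> suspension_topology l f T"

lemma equiv_R': "equiv (topspace (top_of_set D)) R"
  using equiv_R by simp

lemma X_def': "X = quotient_topology (top_of_set D) R"
  by (simp add: suspension_topology_def D_def R_def)

lemma topspace_X [simp]: "topspace X = D // R"
  unfolding X_def' by (subst topspace_quotient_topology[OF equiv_R']) simp

lemma Union_cls: "U \<subseteq> D // R \<Longrightarrow> \<Union>U = {p \<in> D. cls p \<in> U}"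
proof (intro set_eqI iffI)
  fix p assume U: "U \<subseteq> D // R" and "p \<in> \<Union>U"
  then obtain C where C: "C \<in> U" "p \<in> C" by blast
  then obtain q where q: "C = cls q" using U quotient_cases by (metis subsetD)
  then have "p \<in> D" "orb q p" using C by (auto simp: cls_def)
  then show "p \<in> {p \<in> D. cls p \<in> U}" using C q cls_eq by auto
next
  fix p assume "p \<in> {p \<in> D. cls p \<in> U}"
  then show "p \<in> \<Union>U" by (auto simp: cls_def intro!: bexI[of _ "cls p"])
qed

lemma openin_X: "openin X U \<longleftrightarrow> U \<subseteq> D // R \<and> openin (top_of_set D) {p \<in> D. cls p \<in> U}"
  unfolding X_def' openin_quotient_topology[OF equiv_R'] using Union_cls by auto

lemma cls_in_X: "p \<in> D \<Longrightarrow> cls p \<in> D // R"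
  by (cases p) (auto simp: D_iff intro: cls_in_quotient)

lemma continuous_map_cls: "continuous_map (top_of_set D) X cls"
  unfolding continuous_map_def using openin_X cls_in_X by auto

text \<open>\<open>suspension_flow\<close> prescribes the motion only inside a fibre. A step of
  length at most the lower bound \<open>a\<close> of \<open>T\<close> crosses at most one gluing and
  is computed directly; longer times are sums of such steps, and negative times follow by
  inverting.\<close>

lemma suspension_flow_cls:
  assumes flow: "suspension_flow l f T \<phi>" and "x \<in> l"
  shows "\<phi> s (cls (x, s0)) = cls (x, s0 + s)"
proof -
  have zero: "\<And>C. C \<in> D // R \<Longrightarrow> \<phi> 0 C = C"
    and add: "\<And>s t C. C \<in> D // R \<Longrightarrow> \<phi> (s + t) C = \<phi> s (\<phi> t C)"
    using flow by (auto simp: suspension_flow_def continuous_flow_def)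
  have fib: "\<phi> s (cls (x, t)) = cls (x, t + s)" if "x \<in> l" "0 \<le> t" "0 \<le> s" "t + s \<le> T x" for x s t
  proof -
    have "\<phi> s (R `` {(x, t)}) = R `` {(x, t + s)}"
      using flow that unfolding suspension_flow_def R_def[symmetric] by blast
    then show ?thesis using that R_Image[of "(x, t)"] R_Image[of "(x, t + s)"] by (simp add: D_iff)
  qed
  have "l \<noteq> {}" using assms by blast
  then obtain a where a: "0 < a" "\<And>x. x \<in> l \<Longrightarrow> a \<le> T x" using T_bounds by metis
  have step: "\<phi> s (cls (x, s0)) = cls (x, s0 + s)" if "x \<in> l" "0 \<le> s" "s \<le> a" for x s0 s
  proof -
    obtain y t where y: "(y, t) \<in> D" "t < T y" "cls (x, s0) = cls (y, t)"
      using cls_rep[OF \<open>x \<in> l\<close>] by metis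
    have "\<phi> s (cls (y, t)) = cls (y, t + s)"
    proof (cases "t + s \<le> T y")
      case True
      then show ?thesis using fib y that by (auto simp: D_iff)
    next
      case False
      let ?s = "t + s - T y"
      have top: "cls (y, T y + r) = cls (f y, r)" for r
        using cls_fpow[of 1 y r] by (simp add: S_def add.commute)
      have "\<phi> s (cls (y, t)) = \<phi> ?s (\<phi> (T y - t) (cls (y, t)))"
        using add[OF cls_in_X[OF y(1)], of ?s "T y - t"] by simp
      also have "\<dots> = \<phi> ?s (cls (f y, 0))"
        using fib[of y t "T y - t"] y top[of 0] by (auto simp: D_iff)
      also have "\<dots> = cls (f y, ?s)"
        using fib[of "f y" 0 ?s] False y that a(2)[of "f y"] by (auto simp: D_iff)
      also have "\<dots> = cls (y, t + s)"
        using top[of ?s] by simp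
      finally show ?thesis .
    qed
    then show ?thesis using y cls_add[OF y(3) that(1)] by simp
  qed
  have pos_n: "\<phi> s (cls (x, s0)) = cls (x, s0 + s)" if "0 \<le> s" "s \<le> real n * a" for n s s0
    using that
  proof (induction n arbitrary: s s0)
    case 0
    then show ?case using zero cls_in_quotient[OF \<open>x \<in> l\<close>] by auto
  next
    case (Suc n)
    show ?case
    proof (cases "s \<le> a")
      case True
      then show ?thesis using step Suc.prems \<open>x \<in> l\<close> by blast
    next
      case False
      have "\<phi> s (cls (x, s0)) = \<phi> (s - a) (\<phi> a (cls (x, s0)))"
        using add[OF cls_in_quotient[OF \<open>x \<in> l\<close>], of "s - a" a] by simp
      also have "\<dots> = \<phi> (s - a) (cls (x, s0 + a))"
        using step[of x a s0] a(1) \<open>x \<in> l\<close> by simp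
      also have "\<dots> = cls (x, s0 + a + (s - a))"
        using False Suc.prems by (intro Suc.IH) (auto simp: algebra_simps)
      finally show ?thesis by simp
    qed
  qed
  have pos: "\<phi> s (cls (x, s0)) = cls (x, s0 + s)" if "0 \<le> s" for s s0
  proof -
    obtain n where "s < real n * a" using reals_Archimedean3[OF a(1)] by blast
    then show ?thesis using pos_n[of s n] that by simp
  qed
  show ?thesis
  proof (cases "0 \<le> s")
    case False
    have "\<phi> s (cls (x, s0)) = \<phi> s (\<phi> (- s) (cls (x, s0 + s)))"
      using pos[of "- s" "s0 + s"] False by simp
    also have "\<dots> = cls (x, s0 + s)"
      using add[OF cls_in_quotient[OF \<open>x \<in> l\<close>], of s "- s"] zero cls_in_quotient[OF \<open>x \<in> l\<close>] by simp
    finally show ?thesis .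
  qed (use pos in blast)
qed

section \<open>Periodic orbits under kinematic expansivity\<close>

lemma continuous_on_S: "continuous_on l (S n)"
proof (induction n)
  case (Suc n)
  have "continuous_on l (f ^^ n)"
  proof (induction n)
    case (Suc n)
    then show ?case
      using continuous_on_compose2[OF cont_f Suc] fpow_in by (simp add: image_subset_iff o_def)
  qed simp
  then have "continuous_on l (\<lambda>x. T ((f ^^ n) x))"
    using continuous_on_compose2[OF cont_T] by fastforce
  then show ?case using Suc by (auto simp: S_Suc intro!: continuous_intros)
qed simp

text \<open>If the orbit of \<open>x\<close> never leaves a small neighbourhood of a periodic orbit of period \<open>\<tau>\<close>,
  the points \<open>z\<close> and \<open>\<phi> \<tau> z\<close> over \<open>x\<close> stay close for all times, so kinematic expansivity makes the
  orbit of \<open>x\<close> periodic with a period close to \<open>\<tau>\<close>.\<close>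

lemma kinematic_expansive_imp_trapped_periodic:
  assumes flow: "suspension_flow l f T \<phi>"
    and M: "Metric_space M d" "Metric_space.mtopology M d = X"
    and ke: "kinematic_expansive M d \<phi>"
    and p: "p \<in> l" "(f ^^ m) p = p" and "0 < m"
  shows "\<exists>\<eta>>0. \<forall>x\<in>l. (\<forall>k. dist ((f ^^ (m * k)) x) p < \<eta> \<and> dist ((g ^^ (m * k)) x) p < \<eta>)
    \<longrightarrow> (f ^^ m) x = x"
proof -
  interpret M: Metric_space M d by fact
  have M_eq: "M = D // R" using M(2) M.topspace_mtopology topspace_X by metis
  obtain a b where a: "0 < a" "\<And>x. x \<in> l \<Longrightarrow> a \<le> T x" and b: "\<And>x. x \<in> l \<Longrightarrow> T x \<le> b"
    using T_bounds p(1) by (metis empty_iff)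
  then have "0 < b" using p(1) by fastforce
  define \<tau> where "\<tau> = S m p"
  \<comment> \<open>Every point of the orbit will be written over a base point y near p at a time s'
    + S j y with s' \<le> b and j \<le> m. \<open>K\<close> bounds these times, so that uniform
    continuity on a compact set applies.\<close>
  define K where "K = real (m + 1) * b"
  \<comment> \<open>Half of \<open>a\<close> is spent here on the time shift, the other half below
    on the change of \<open>S m\<close>; together they stay below every return time.\<close>
  obtain \<delta> where \<delta>: "0 < \<delta>" "\<And>x y. x \<in> M \<Longrightarrow> y \<in> M \<Longrightarrow> (\<forall>t. d (\<phi> t x) (\<phi> t y) < \<delta>) \<Longrightarrow>
      (\<exists>s. \<bar>s\<bar> < a / 2 \<and> y = \<phi> s x)"
    using ke a(1) unfolding kinematic_expansive_def by (metis half_gt_zero)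
  \<comment> \<open>The distance by which time \<tau> displaces a point; it vanishes on the orbit of
    \<open>p\<close>, where \<tau> is a period.\<close>
  define \<psi> where "\<psi> = (\<lambda>(y, s). d (cls (y, s)) (cls (y, s + \<tau>)))"
  have cont_flow: "continuous_map (prod_topology euclideanreal X) X (\<lambda>(t, x). \<phi> t x)"
    using flow by (auto simp: suspension_flow_def continuous_flow_def)
  have cls_cont: "continuous_map (top_of_set (l \<times> {0..K})) X (\<lambda>(y, s). cls (y, s + r))" for r
  proof -
    have "continuous_map (top_of_set (l \<times> {0..K})) (top_of_set D) (\<lambda>p. (fst p, 0))"
      using T_pos by (auto simp: D_iff less_imp_le intro!: continuous_intros)
    from continuous_map_compose[OF this continuous_map_cls]
    have "continuous_map (top_of_set (l \<times> {0..K})) X (\<lambda>p. cls (fst p, 0))"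
      by (simp add: o_def)
    moreover have "continuous_map (top_of_set (l \<times> {0..K})) euclideanreal (\<lambda>p. snd p + r)"
      by (auto intro!: continuous_intros)
    ultimately have "continuous_map (top_of_set (l \<times> {0..K})) (prod_topology euclideanreal X)
        (\<lambda>p. (snd p + r, cls (fst p, 0)))"
      by (simp add: continuous_map_pairedI)
    from continuous_map_compose[OF this cont_flow]
    show ?thesis
      by (rule continuous_map_eq) (auto simp: suspension_flow_cls[OF flow])
  qed
  have "continuous_map (top_of_set (l \<times> {0..K})) euclideanreal
      (\<lambda>p. d (cls (fst p, snd p + 0)) (cls (fst p, snd p + \<tau>)))"
  proof -
    have X: "mtopology_of (metric (M, d)) = X" by (simp add: mtopology_of_def M(2))
    show ?thesis
      using continuous_map_mdist[of _ "metric (M, d)", unfolded X, OF cls_cont[of 0] cls_cont[of \<tau>]]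
      unfolding case_prod_beta M.mdist_metric .
  qed
  then have "continuous_on (l \<times> {0..K}) \<psi>"
    by (simp add: \<psi>_def case_prod_beta)
  then have "uniformly_continuous_on (l \<times> {0..K}) \<psi>"
    by (intro compact_uniformly_continuous compact_Times compact_l compact_Icc)
  then obtain \<eta>1 where \<eta>1: "0 < \<eta>1" "\<And>q q'. q \<in> l \<times> {0..K} \<Longrightarrow> q' \<in> l \<times> {0..K} \<Longrightarrow>
      dist q' q < \<eta>1 \<Longrightarrow> dist (\<psi> q') (\<psi> q) < \<delta>"
    using \<delta>(1) unfolding uniformly_continuous_on_def by metis
  obtain \<eta>2 where \<eta>2: "0 < \<eta>2" "\<And>y. y \<in> l \<Longrightarrow> dist y p < \<eta>2 \<Longrightarrow> dist (S m y) (S m p) < a / 2"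
    using continuous_on_S[of m] p(1) a(1) unfolding continuous_on_iff by (metis half_gt_zero)
  have \<psi>0: "\<psi> (p, s) = 0" if "0 \<le> s" for s
  proof -
    have "cls (p, s + \<tau>) = cls (p, s)" using cls_fpow[of m p s] p(2) by (simp add: \<tau>_def)
    then show ?thesis using p(1) M_eq cls_in_quotient by (auto simp: \<psi>_def)
  qed
  have "(f ^^ m) x = x"
    if "x \<in> l" and near: "\<And>k. dist ((f ^^ (m * k)) x) p < min \<eta>1 \<eta>2 \<and> dist ((g ^^ (m * k)) x) p < min \<eta>1 \<eta>2" for x
  proof -
    have close: "d (cls (x, t)) (cls (x, t + \<tau>)) < \<delta>" for t
    proof -
      obtain z s' where z: "(z, s') \<in> D" "orb (x, t) (z, s')" using exists_rep[OF \<open>x \<in> l\<close>] by blast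
      have zl: "z \<in> l" using z(1) by (simp add: D_iff)
      obtain n where n: "z = (f ^^ n) x \<or> x = (f ^^ n) z"
        using z(2) orb_iff_shift[OF \<open>x \<in> l\<close> zl] by auto
      \<comment> \<open>Only the iterates of \<open>x\<close> whose index is a multiple of
        \<open>m\<close> are known to lie near \<open>p\<close>; one goes back at most
        \<open>m\<close> fibres to reach one of them.\<close>
      obtain j y where y: "y \<in> l" "j \<le> m" "z = (f ^^ j) y" "dist y p < \<eta>1"
      proof (cases "z = (f ^^ n) x")
        case True
        have "z = (f ^^ (n mod m)) ((f ^^ (m * (n div m))) x)"
          using True by (metis comp_apply funpow_add mod_mult_div_eq)
        then show thesis
          using that[of "(f ^^ (m * (n div m))) x" "n mod m"] near \<open>x \<in> l\<close> \<open>0 < m\<close> by (simp add: less_imp_le)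
      next
        case False
        \<comment> \<open>Backward indices are rounded away from 0. If \<open>m\<close> divides n
          this gives j = m, which the bound j \<le> m allows.\<close>
        define j where "j = m - n mod m"
        have "n mod m < m" using \<open>0 < m\<close> by simp
        then have j: "m * (n div m + 1) = n + j" "j \<le> m"
          using mult_div_mod_eq[of m n] unfolding j_def distrib_left by linarith+
        have "z = (g ^^ n) x" using False n zl by auto
        moreover have "(f ^^ j) ((g ^^ j) ((g ^^ n) x)) = (g ^^ n) x"
          using \<open>x \<in> l\<close> by simp
        ultimately have "z = (f ^^ j) ((g ^^ (m * (n div m + 1))) x)"
          unfolding j(1) by (metis add.commute comp_apply funpow_add)
        then show thesis
          using that[of "(g ^^ (m * (n div m + 1))) x" j] j(2) near[of "n div m + 1"] \<open>x \<in> l\<close> by simp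
      qed
      define s where "s = s' + S j y"
      have "S j y \<le> real j * b"
        using sum_mono[of "{..<j}" "\<lambda>i. T ((f ^^ i) y)" "\<lambda>_. b"] b y(1) by (auto simp: S_def)
      also have "\<dots> \<le> real m * b" using y(2) \<open>0 < b\<close> by simp
      finally have s: "0 \<le> s" "s \<le> K"
        using z(1) b[OF zl] S_nonneg[OF y(1), of j] by (auto simp: s_def K_def D_iff algebra_simps)
      have eq: "cls (x, t) = cls (y, s)"
        using cls_eq[OF z(2)] cls_fpow[of j y s'] y(3) by (simp add: s_def)
      have "dist (\<psi> (y, s)) (\<psi> (p, s)) < \<delta>"
        using \<eta>1(2)[of "(p, s)" "(y, s)"] y s p(1) by (simp add: dist_Pair_Pair)
      then have "d (cls (y, s)) (cls (y, s + \<tau>)) < \<delta>"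
        using \<psi>0[OF s(1)] by (simp add: \<psi>_def dist_real_def)
      then show ?thesis using eq cls_add[OF eq \<open>x \<in> l\<close>] by simp
    qed
    have "\<forall>t. d (\<phi> t (cls (x, 0))) (\<phi> t (cls (x, \<tau>))) < \<delta>"
      using close by (simp add: suspension_flow_cls[OF flow \<open>x \<in> l\<close>] add.commute)
    then obtain s where s: "\<bar>s\<bar> < a / 2" "cls (x, \<tau>) = \<phi> s (cls (x, 0))"
      using \<delta>(2) M_eq cls_in_quotient[OF \<open>x \<in> l\<close>] by metis
    then have "cls (x, \<tau>) = cls (x, s)"
      by (simp add: suspension_flow_cls[OF flow \<open>x \<in> l\<close>])
    from cls_add[OF this \<open>x \<in> l\<close>, of "- s"]
    have "cls ((f ^^ m) x, \<tau> - s - S m x) = cls (x, 0)"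
      using cls_fpow[of m x "\<tau> - s - S m x"] by simp
    moreover have "dist (S m x) \<tau> < a / 2"
      using \<eta>2(2)[OF \<open>x \<in> l\<close>] near[of 0] by (simp add: \<tau>_def)
    then have "\<bar>\<tau> - s - S m x - 0\<bar> < a"
      using s(1) unfolding dist_real_def by linarith
    ultimately show ?thesis
      using cls_near_zero(1)[of "(f ^^ m) x" "\<tau> - s - S m x" x 0] a(2) \<open>x \<in> l\<close> fpow_in by fastforce
  qed
  then show ?thesis
    using \<eta>1(1) \<eta>2(1) by (intro exI[of _ "min \<eta>1 \<eta>2"]) auto
qed

end

section \<open>A metric on the suspension\<close>

text \<open>For an arc, \<open>h\<close> is a chart to the unit interval. The coordinates of
  \<open>emb\<close> interpolate its values, and closeness of base points is measured by it.\<close>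

locale embedded_suspension = suspension +
  fixes h :: "'a \<Rightarrow> real"
  assumes cont_h: "continuous_on l h" and inj_h: "inj_on h l"
begin

definition \<theta> :: "'a \<times> real \<Rightarrow> real" where "\<theta> p = snd p / T (fst p)"

text \<open>An embedding of the suspension into a Euclidean space. The first coordinate is the phase in
  the fibre, the second one separates the base points inside the fibres, and the third one does so at the
  two ends, where \<open>(x, T x)\<close> and \<open>(f x, 0)\<close> are given the same value.\<close>

definition emb :: "'a \<times> real \<Rightarrow> complex \<times> real \<times> real" where
  "emb p = (cis (2 * pi * \<theta> p), \<theta> p * (1 - \<theta> p) * h (fst p),
     max 0 (1/2 - \<theta> p) * h (fst p) + max 0 (\<theta> p - 1/2) * h (f (fst p)))"

text \<open>The choice of a representative is harmless because \<open>emb\<close> is constant on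
  classes, see \<open>emb_eq_iff\<close>.\<close>

definition emb_cls :: "('a \<times> real) set \<Rightarrow> complex \<times> real \<times> real" where
  "emb_cls C = emb (SOME p. p \<in> C)"

definition d where "d C C' = dist (emb_cls C) (emb_cls C')"

definition flow :: "real \<Rightarrow> ('a \<times> real) set \<Rightarrow> ('a \<times> real) set" where
  "flow t C = (let p = SOME p. p \<in> C in cls (fst p, snd p + t))"

lemma \<theta>_bounds:
  assumes "p \<in> D" shows "0 \<le> \<theta> p" "\<theta> p \<le> 1" "snd p < T (fst p) \<Longrightarrow> \<theta> p < 1"
proof -
  obtain x s where p: "p = (x, s)" by fastforce
  then have "0 < T x" "0 \<le> s" "s \<le> T x" using assms T_pos by (auto simp: D_iff)
  then show "0 \<le> \<theta> p" "\<theta> p \<le> 1" "snd p < T (fst p) \<Longrightarrow> \<theta> p < 1"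
    using p by (auto simp: \<theta>_def)
qed

text \<open>At phase 1 over x the coordinates are 1, 0 and h (f x) / 2, the same as at phase 0 over
  f x.\<close>

lemma emb_nf: "p \<in> D \<Longrightarrow> emb (nf p) = emb p"
proof -
  assume "p \<in> D"
  then have "0 < T (fst p)" using T_pos by (cases p) (auto simp: D_iff)
  then show ?thesis by (auto simp: nf_def emb_def \<theta>_def)
qed

text \<open>For normal forms both phases are below 1, so the point of the circle determines the
  phase. Then \<open>h\<close> of the base point is read off the third coordinate at phase 0, and
  otherwise off the second, whose factor is not 0.\<close>

lemma emb_eq_imp:
  assumes pq: "p \<in> D" "q \<in> D" "emb p = emb q"
  shows "nf p = nf q"
proof -
  have *: "p = q" if p: "p \<in> D" "snd p < T (fst p)" and q: "q \<in> D" "snd q < T (fst q)" and e: "emb p = emb q" for p q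
  proof -
    have T: "0 < T (fst p)" "0 < T (fst q)" and l: "fst p \<in> l" "fst q \<in> l"
      using p q T_pos by (cases p; cases q; auto simp: D_iff)+
    have c: "cis (2 * pi * \<theta> p) = cis (2 * pi * \<theta> q)" using e by (simp add: emb_def)
    then obtain n :: int where "2 * pi * \<theta> p = 2 * pi * \<theta> q + 2 * pi * of_int n"
      using sin_cos_eq_iff[of "2 * pi * \<theta> p" "2 * pi * \<theta> q"] by (auto simp: cis.ctr complex_eq_iff)
    then have "2 * pi * (\<theta> p - \<theta> q - of_int n) = 0" by (simp add: algebra_simps)
    then have n: "\<theta> p - \<theta> q = of_int n" by simp
    then have "\<bar>real_of_int n\<bar> < 1"
      using \<theta>_bounds[OF p(1)] \<theta>_bounds[OF q(1)] p q by linarith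
    then have "n = 0" by linarith
    then have \<theta>: "\<theta> p = \<theta> q" using n by simp
    have "h (fst p) = h (fst q)"
    proof (cases "\<theta> p = 0")
      case True
      then show ?thesis using e \<theta> by (simp add: emb_def)
    next
      case False
      then have "\<theta> p * (1 - \<theta> p) \<noteq> 0" using \<theta>_bounds(3)[OF p] by simp
      then show ?thesis using e \<theta> by (simp add: emb_def)
    qed
    then have "fst p = fst q" using inj_h l by (auto simp: inj_on_def)
    moreover from this have "snd p = snd q" using \<theta> T by (simp add: \<theta>_def)
    ultimately show ?thesis by (simp add: prod_eq_iff)
  qed
  show ?thesis
    using pq emb_nf by (intro * nf_in) auto
qed

lemma emb_eq_iff: "p \<in> D \<Longrightarrow> q \<in> D \<Longrightarrow> emb p = emb q \<longleftrightarrow> cls p = cls q"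
proof
  assume "p \<in> D" "q \<in> D" "emb p = emb q"
  then have "nf p = nf q" by (rule emb_eq_imp)
  then show "cls p = cls q" using cls_eq[OF nf_orb, of p] cls_eq[OF nf_orb, of q] by simp
next
  assume pq: "p \<in> D" "q \<in> D" "cls p = cls q"
  then have "q \<in> cls p" by (simp add: cls_def)
  then have "orb p q" by (simp add: cls_def)
  then show "emb p = emb q"
    using orb_imp_nf_eq pq(1,2) emb_nf by metis
qed

lemma some_in_cls:
  assumes "x \<in> l" shows "(SOME p. p \<in> cls (x, s)) \<in> cls (x, s)"
proof -
  obtain y t where "(y, t) \<in> D" "orb (x, s) (y, t)" using exists_rep[OF assms] by blast
  then have "(y, t) \<in> cls (x, s)" by (simp add: cls_def)
  then show ?thesis by (rule someI)
qed

lemma emb_cls: "p \<in> D \<Longrightarrow> emb_cls (cls p) = emb p"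
proof -
  assume p: "p \<in> D"
  then have "(SOME q. q \<in> cls p) \<in> cls p"
    by (cases p) (use some_in_cls in \<open>auto simp: D_iff\<close>)
  then have "(SOME q. q \<in> cls p) \<in> D" "orb p (SOME q. q \<in> cls p)"
    unfolding cls_def by blast+
  from this(1) cls_eq[OF this(2)]
  have "(SOME q. q \<in> cls p) \<in> D" "cls (SOME q. q \<in> cls p) = cls p"
    by auto
  then show ?thesis using emb_eq_iff p by (simp add: emb_cls_def)
qed

lemma flow_cls:
  assumes "x \<in> l" shows "flow t (cls (x, s)) = cls (x, s + t)"
proof -
  obtain y r where yr: "(SOME p. p \<in> cls (x, s)) = (y, r)" by fastforce
  then have "orb (x, s) (y, r)" using some_in_cls[OF assms, of s] by (auto simp: cls_def)
  then show ?thesis unfolding flow_def yr using cls_eq orb_add by fastforce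
qed

sublocale M: Metric_space "D // R" d
proof
  fix C C' assume "C \<in> D // R" "C' \<in> D // R"
  then obtain p q where "p \<in> D" "C = cls p" "q \<in> D" "C' = cls q" using quotient_cases by metis
  then show "d C C' = 0 \<longleftrightarrow> C = C'" by (simp add: d_def emb_cls emb_eq_iff)
qed (auto simp: d_def dist_commute dist_triangle)

section \<open>The metric induces the quotient topology, and the flow is continuous\<close>

lemma continuous_on_\<theta>: "continuous_on (l \<times> UNIV) \<theta>"
proof -
  have "T (fst p) \<noteq> 0" if "p \<in> l \<times> UNIV" for p :: "'a \<times> real"
    using that T_pos[of "fst p"] by auto
  then show ?thesis
    unfolding \<theta>_def by (intro continuous_intros continuous_on_compose2[OF cont_T]) auto
qed

lemma continuous_on_emb: "continuous_on (l \<times> UNIV) emb"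
proof -
  have hf: "continuous_on l (\<lambda>x. h (f x))"
    by (rule continuous_on_compose2[OF cont_h cont_f]) auto
  show ?thesis
    unfolding emb_def
    by (intro continuous_intros continuous_on_\<theta> continuous_on_compose2[OF cont_h]
        continuous_on_compose2[OF hf]) auto
qed

lemma D_subset: "D \<subseteq> l \<times> UNIV"
  by (auto simp: D_iff)

lemma compact_D: "compact D"
proof -
  have "compact ((\<lambda>p. (fst p, snd p * T (fst p))) ` (l \<times> {0..1}))"
    by (intro compact_continuous_image continuous_intros continuous_on_compose2[OF cont_T]
        compact_Times compact_l compact_Icc) auto
  also have "(\<lambda>p. (fst p, snd p * T (fst p))) ` (l \<times> {0..1}) = D"
  proof (intro equalityI subsetI)
    fix p assume "p \<in> D"
    then have "fst p \<in> l" "T (fst p) > 0" "0 \<le> \<theta> p" "\<theta> p \<le> 1"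
      using \<theta>_bounds T_pos D_subset by auto
    then show "p \<in> (\<lambda>p. (fst p, snd p * T (fst p))) ` (l \<times> {0..1})"
      by (intro image_eqI[of _ _ "(fst p, \<theta> p)"]) (auto simp: \<theta>_def)
  next
    fix p assume "p \<in> (\<lambda>p. (fst p, snd p * T (fst p))) ` (l \<times> {0..1})"
    then show "p \<in> D" using T_pos by (auto simp: D_iff mult_left_le_one_le less_imp_le)
  qed
  finally show ?thesis .
qed

text \<open>A continuous injection of a compact quotient into a Hausdorff space is an embedding.
  Concretely, if U is open in the quotient, the part of \<open>D\<close> outside U is compact, so
  its image under \<open>emb\<close> is closed, and it misses the images of all points of U.\<close>

lemma mtopology_eq: "M.mtopology = X"
proof (rule topology_eq[THEN iffD2], intro allI iffI)
  fix U assume U: "openin M.mtopology U"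
  then have UM: "U \<subseteq> D // R" by (simp add: M.openin_mtopology)
  show "openin X U"
    unfolding openin_X openin_euclidean_subtopology_iff
  proof (intro conjI ballI UM)
    fix p assume "p \<in> {p \<in> D. cls p \<in> U}"
    then have p: "p \<in> D" "cls p \<in> U" by auto
    then obtain r where r: "0 < r" "M.mball (cls p) r \<subseteq> U" using U by (auto simp: M.openin_mtopology)
    then obtain \<delta> where \<delta>: "0 < \<delta>" "\<And>q. q \<in> D \<Longrightarrow> dist q p < \<delta> \<Longrightarrow> dist (emb q) (emb p) < r"
      using continuous_on_subset[OF continuous_on_emb D_subset] p unfolding continuous_on_iff by metis
    have "cls q \<in> U" if "q \<in> D" "dist q p < \<delta>" for q
    proof -
      have "cls q \<in> M.mball (cls p) r"
        using \<delta>(2)[OF that] cls_in_X[OF p(1)] cls_in_X[OF that(1)]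
        by (simp add: d_def emb_cls p that dist_commute)
      then show ?thesis using r(2) by blast
    qed
    then show "\<exists>e>0. \<forall>x'\<in>D. dist x' p < e \<longrightarrow> x' \<in> {p \<in> D. cls p \<in> U}"
      using \<delta>(1) by blast
  qed auto
next
  fix U assume "openin X U"
  then have U: "U \<subseteq> D // R" "openin (top_of_set D) {p \<in> D. cls p \<in> U}" by (auto simp: openin_X)
  define K where "K = D - {p \<in> D. cls p \<in> U}"
  have "closedin (top_of_set D) K"
    unfolding K_def using U(2) by (intro closedin_diff) auto
  then have "compact K" using compact_D by (rule closedin_compact[rotated])
  then have "compact (emb ` K)"
    using continuous_on_subset[OF continuous_on_emb, of K] D_subset
    by (intro compact_continuous_image) (auto simp: K_def)
  then have cl: "closed (emb ` K)" by (rule compact_imp_closed)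
  show "openin M.mtopology U"
    unfolding M.openin_mtopology
  proof (intro conjI allI impI U(1))
    fix C assume "C \<in> U"
    then obtain p where p: "p \<in> D" "C = cls p" using U(1) quotient_cases by (metis subsetD)
    have "emb p \<notin> emb ` K"
    proof
      assume "emb p \<in> emb ` K"
      then obtain q where "q \<in> D" "cls q \<notin> U" "emb p = emb q" by (auto simp: K_def)
      then show False using p \<open>C \<in> U\<close> emb_eq_iff by metis
    qed
    then obtain r where r: "0 < r" "ball (emb p) r \<subseteq> - emb ` K"
      using cl open_contains_ball[of "- emb ` K"] by (metis ComplI open_Compl)
    have "C' \<in> U" if "C' \<in> M.mball C r" for C'
    proof -
      have "C' \<in> D // R" using that by simp
      then obtain q where q: "q \<in> D" "C' = cls q" using quotient_cases by metis
      then have "emb q \<in> ball (emb p) r" using that p by (simp add: d_def emb_cls)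
      then show ?thesis using r q by (auto simp: K_def)
    qed
    then show "\<exists>r>0. M.mball C r \<subseteq> U" using r(1) by blast
  qed
qed

lemma cls_image_D: "cls ` D = D // R"
  using cls_in_X by (auto elim!: quotient_cases)

lemma compact_space_X: "compact_space X"
proof -
  have "compactin X (cls ` D)"
    using compact_D by (intro image_compactin[OF _ continuous_map_cls]) (simp add: compactin_subtopology)
  then show ?thesis by (simp add: compact_space_def cls_image_D)
qed

text \<open>Near a point of \<open>D\<close> below the top of its fibre, the suspension is covered by the domain and
  its image under the inverse of \<open>shift\<close>; the other points of \<open>l \<times> UNIV\<close> are moved there by
  a power of \<open>shift\<close>.\<close>

lemma continuous_on_emb_cls: "continuous_on (l \<times> UNIV) (\<lambda>p. emb_cls (cls p))"
proof -
  define E where "E = (\<lambda>p. emb_cls (cls p))"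
  have E_D: "E p = emb p" if "p \<in> D" for p using that by (simp add: E_def emb_cls)
  have E_shift: "E ((f ^^ n) x, s - S n x) = E (x, s)" for n x s
    using cls_fpow[of n x "s - S n x"] by (simp add: E_def)
  define low where "low = (\<lambda>p::'a \<times> real. (g (fst p), snd p + T (g (fst p))))"
  \<comment> \<open>The fibres continued below the base: this is the image of \<open>D\<close> under
    \<open>shift\<close>, and \<open>low\<close> is the inverse on it.\<close>
  define D' where "D' = (\<lambda>q. (f (fst q), snd q - T (fst q))) ` D"
  have Tg: "continuous_on l (\<lambda>x. T (g x))"
    by (rule continuous_on_compose2[OF cont_T cont_g]) auto
  have D'_iff: "(x, s) \<in> D' \<longleftrightarrow> x \<in> l \<and> - T (g x) \<le> s \<and> s \<le> 0" for x s
  proof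
    assume "x \<in> l \<and> - T (g x) \<le> s \<and> s \<le> 0"
    then show "(x, s) \<in> D'"
      unfolding D'_def by (intro image_eqI[of _ _ "(g x, s + T (g x))"]) (auto simp: D_iff)
  qed (auto simp: D'_def D_iff)
  have compact_D': "compact D'"
    unfolding D'_def using D_subset
    by (intro compact_continuous_image compact_D continuous_intros
        continuous_on_compose2[OF cont_T] continuous_on_compose2[OF cont_f]) auto
  have "continuous_on D' (\<lambda>p. emb (low p))"
    unfolding low_def
    by (intro continuous_on_compose2[OF continuous_on_emb] continuous_intros
        continuous_on_compose2[OF Tg] continuous_on_compose2[OF cont_g]) (auto simp: D'_iff)
  moreover have "emb (low p) = E p" if "p \<in> D'" for p
  proof -
    obtain x s where p: "p = (x, s)" by fastforce
    then have "x \<in> l" "low p \<in> D" using that by (auto simp: D'_iff D_iff low_def)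
    then show ?thesis
      using E_shift[of 1 "g x" "s + T (g x)"] E_D[of "low p"] by (simp add: p low_def S_def)
  qed
  ultimately have cont_D': "continuous_on D' E" by (simp cong: continuous_on_cong)
  have cont_D: "continuous_on D E"
    using continuous_on_subset[OF continuous_on_emb D_subset] by (simp add: E_D cong: continuous_on_cong)
  have cont_Un: "continuous_on (D \<union> D') E"
    using cont_D cont_D' by (intro continuous_on_closed_Un compact_imp_closed compact_D compact_D')
  \<comment> \<open>Relatively open in \<open>l \<times> UNIV\<close> and covered by the closed sets
    \<open>D\<close> and \<open>D'\<close>, so continuity on it is continuity within the whole
    space. Every orbit meets \<open>W\<close>, since \<open>exists_rep\<close> gives a time strictly
    below the top of a fibre.\<close>
  define W where "W = {p \<in> l \<times> UNIV. - T (g (fst p)) < snd p \<and> snd p < T (fst p)}"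
  have "openin (top_of_set (l \<times> UNIV)) ((l \<times> UNIV) \<inter> (\<lambda>p. snd p + T (g (fst p))) -` {0<..})"
    by (intro continuous_openin_preimage_gen continuous_intros continuous_on_compose2[OF Tg]) auto
  moreover have "openin (top_of_set (l \<times> UNIV)) ((l \<times> UNIV) \<inter> (\<lambda>p. T (fst p) - snd p) -` {0<..})"
    by (intro continuous_openin_preimage_gen continuous_intros continuous_on_compose2[OF cont_T]) auto
  ultimately have "openin (top_of_set (l \<times> UNIV)) (((l \<times> UNIV) \<inter> (\<lambda>p. snd p + T (g (fst p))) -` {0<..}) \<inter>
      ((l \<times> UNIV) \<inter> (\<lambda>p. T (fst p) - snd p) -` {0<..}))"
    by (rule openin_Int)
  moreover have "((l \<times> UNIV) \<inter> (\<lambda>p. snd p + T (g (fst p))) -` {0<..}) \<inter>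
      ((l \<times> UNIV) \<inter> (\<lambda>p. T (fst p) - snd p) -` {0<..}) = W"
    by (auto simp: W_def)
  ultimately have open_W: "openin (top_of_set (l \<times> UNIV)) W" by simp
  have "W \<subseteq> D \<union> D'" by (auto simp: W_def D_iff D'_iff)
  then have cont_W: "continuous_on W E" using cont_Un continuous_on_subset by blast
  have at_W: "continuous (at p within l \<times> UNIV) E" if "p \<in> W" for p
  proof -
    obtain O' where O': "open O'" "W = (l \<times> UNIV) \<inter> O'"
      using open_W by (auto simp: openin_open)
    then have "at p within l \<times> UNIV = at p within W"
      using that by (intro at_within_nhd[of p O']) auto
    then show ?thesis using cont_W that by (simp add: continuous_on_eq_continuous_within)
  qed
  have "continuous (at (x, s) within l \<times> UNIV) E" if "x \<in> l" for x s
  proof -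
    have comp: "continuous (at (x, s) within l \<times> UNIV) E"
      if k: "continuous_on (l \<times> UNIV) k" "k ` (l \<times> UNIV) \<subseteq> l \<times> UNIV" "k (x, s) \<in> W"
        "\<And>p. p \<in> l \<times> UNIV \<Longrightarrow> E (k p) = E p" for k
    proof -
      have "continuous (at (x, s) within l \<times> UNIV) (E \<circ> k)"
        using k \<open>x \<in> l\<close> at_W[OF k(3)]
        by (intro continuous_within_compose) (auto simp: continuous_on_eq_continuous_within intro: continuous_within_subset)
      then show ?thesis
        using k(4) \<open>x \<in> l\<close> by (rule_tac continuous_transform_within[of _ _ "E \<circ> k" 1]) auto
    qed
    obtain y t where y: "(y, t) \<in> D" "t < T y" "orb (x, s) (y, t)" using exists_rep[OF \<open>x \<in> l\<close>] by blast
    have yl: "y \<in> l" using y by (simp add: D_iff)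
    then have W: "(y, t) \<in> W" using y T_pos[of "g y"] by (force simp: W_def D_iff)
    have cont_pow: "continuous_on l (k ^^ n)" if "continuous_on l k" "k ` l \<subseteq> l" for k and n
    proof (induction n)
      case (Suc n)
      have "(k ^^ n) ` l \<subseteq> l" using that(2) by (induction n) auto
      then show ?case using continuous_on_compose2[OF that(1) Suc] by (simp add: o_def)
    qed simp
    obtain n where "(y, t) = ((f ^^ n) x, s - S n x) \<or> (x, s) = ((f ^^ n) y, t - S n y)"
      using y(3) orb_iff_shift[OF \<open>x \<in> l\<close> yl] by blast
    then show ?thesis
    proof
      assume eq: "(y, t) = ((f ^^ n) x, s - S n x)"
      show ?thesis
      proof (rule comp[of "\<lambda>p. ((f ^^ n) (fst p), snd p - S n (fst p))"])
        show "continuous_on (l \<times> UNIV) (\<lambda>p. ((f ^^ n) (fst p), snd p - S n (fst p)))"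
          by (intro continuous_intros continuous_on_compose2[OF cont_pow[OF cont_f]]
              continuous_on_compose2[OF continuous_on_S]) auto
      qed (use eq W E_shift in auto)
    next
      assume eq: "(x, s) = ((f ^^ n) y, t - S n y)"
      show ?thesis
      proof (rule comp[of "\<lambda>p. ((g ^^ n) (fst p), snd p + S n ((g ^^ n) (fst p)))"])
        show "continuous_on (l \<times> UNIV) (\<lambda>p. ((g ^^ n) (fst p), snd p + S n ((g ^^ n) (fst p))))"
          by (intro continuous_intros continuous_on_compose2[OF cont_pow[OF cont_g]]
              continuous_on_compose2[OF continuous_on_S]) auto
        show "E ((g ^^ n) (fst p), snd p + S n ((g ^^ n) (fst p))) = E p" if "p \<in> l \<times> UNIV" for p
          using E_shift[of n "(g ^^ n) (fst p)" "snd p + S n ((g ^^ n) (fst p))"] that by auto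
      qed (use eq W yl in auto)
    qed
  qed
  then show ?thesis
    unfolding continuous_on_eq_continuous_within E_def[symmetric] by auto
qed

lemma continuous_map_cls_UNIV: "continuous_map (top_of_set (l \<times> UNIV)) X cls"
  unfolding mtopology_eq[symmetric] M.continuous_map_to_metric
proof (intro ballI allI impI)
  fix p :: "'a \<times> real" and \<epsilon> :: real assume p: "p \<in> topspace (top_of_set (l \<times> UNIV))" "0 < \<epsilon>"
  have in_X: "cls q \<in> D // R" if "q \<in> l \<times> UNIV" for q
    using that cls_in_quotient by auto
  have "openin (top_of_set (l \<times> UNIV)) ((l \<times> UNIV) \<inter> (\<lambda>q. emb_cls (cls q)) -` ball (emb_cls (cls p)) \<epsilon>)"
    by (intro continuous_openin_preimage_gen continuous_on_emb_cls) auto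
  then show "\<exists>U. openin (top_of_set (l \<times> UNIV)) U \<and> p \<in> U \<and> (\<forall>q\<in>U. cls q \<in> M.mball (cls p) \<epsilon>)"
    using p in_X
    by (intro exI[of _ "(l \<times> UNIV) \<inter> (\<lambda>q. emb_cls (cls q)) -` ball (emb_cls (cls p)) \<epsilon>"]) (auto simp: d_def)
qed

text \<open>The product of a quotient map with an identity need not be a quotient map. But
  \<open>cls\<close> maps a compact space to a Hausdorff one and so is proper; then its product with
  the identity is proper, hence closed, hence a quotient map. It remains to check continuity in the
  coordinates (t, p).\<close>

lemma continuous_map_flow: "continuous_map (prod_topology euclideanreal X) X (\<lambda>(t, C). flow t C)"
proof (rule continuous_compose_quotient_map)
  have "proper_map (top_of_set D) X cls"
  proof (rule continuous_imp_proper_map[OF _ _ continuous_map_cls])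
    show "compact_space (top_of_set D)" using compact_D by (simp add: compact_space_subtopology)
    show "kc_space X" using M.Hausdorff_space_mtopology mtopology_eq Hausdorff_imp_kc_space by metis
  qed
  then have "proper_map (prod_topology euclideanreal (top_of_set D)) (prod_topology euclideanreal X) (\<lambda>(t, p). (t, cls p))"
    unfolding proper_map_prod[where f = "\<lambda>t. t"] using proper_map_id[unfolded id_def] by blast
  then have "closed_map (prod_topology euclideanreal (top_of_set D)) (prod_topology euclideanreal X) (\<lambda>(t, p). (t, cls p))"
    by (rule proper_imp_closed_map)
  moreover have "continuous_map (prod_topology euclideanreal (top_of_set D)) (prod_topology euclideanreal X) (\<lambda>(t, p). (t, cls p))"
    unfolding case_prod_beta
    by (intro continuous_map_pairedI continuous_map_fst continuous_map_compose[OF continuous_map_snd continuous_map_cls, unfolded o_def])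
  ultimately show "quotient_map (prod_topology euclideanreal (top_of_set D)) (prod_topology euclideanreal X) (\<lambda>(t, p). (t, cls p))"
  proof (intro continuous_closed_imp_quotient_map)
    have "(\<lambda>(t, p). (t, cls p)) ` (UNIV \<times> D) = (UNIV :: real set) \<times> cls ` D" by auto
    then show "(\<lambda>(t, p). (t, cls p)) ` topspace (prod_topology euclideanreal (top_of_set D)) =
        topspace (prod_topology euclideanreal X)"
      by (simp add: cls_image_D)
  qed
  have "continuous_map (top_of_set (UNIV \<times> D)) (top_of_set (l \<times> UNIV)) (\<lambda>q. (fst (snd q), snd (snd q) + fst q))"
    by (auto simp: D_iff intro!: continuous_intros)
  from continuous_map_compose[OF this continuous_map_cls_UNIV]
  have "continuous_map (prod_topology euclideanreal (top_of_set D)) X (cls \<circ> (\<lambda>q. (fst (snd q), snd (snd q) + fst q)))"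
    by (simp add: prod_topology_subtopology)
  then show "continuous_map (prod_topology euclideanreal (top_of_set D)) X ((\<lambda>(t, C). flow t C) \<circ> (\<lambda>(t, p). (t, cls p)))"
    by (rule continuous_map_eq) (auto simp: flow_cls D_iff)
qed

lemma suspension_flow_flow: "suspension_flow l f T flow"
proof -
  have "flow 0 C = C" "flow (s + t) C = flow s (flow t C)" if "C \<in> D // R" for s t C
    using that by (auto elim!: quotient_cases simp: D_iff flow_cls algebra_simps)
  moreover have "flow s (R `` {(x, t)}) = R `` {(x, t + s)}" if "x \<in> l" "0 \<le> t" "0 \<le> s" "t + s \<le> T x" for x s t
    using that R_Image[of "(x, t)"] R_Image[of "(x, t + s)"] by (simp add: D_iff flow_cls)
  ultimately show ?thesis
    using continuous_map_flow
    by (simp add: suspension_flow_def continuous_flow_def R_def[symmetric])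
qed

end

text \<open>Two orbits that stay close on the suspension meet the base at times that agree up to a
  constant; this is the trace of closeness in time that is visible on the base.\<close>

definition bounded_drift :: "('a \<Rightarrow> 'a) \<Rightarrow> ('a \<Rightarrow> real) \<Rightarrow> 'a \<Rightarrow> 'a \<Rightarrow> bool" where
  "bounded_drift f T x y \<longleftrightarrow> (\<exists>K. \<forall>n. \<bar>\<Sum>i<n. T ((f ^^ i) x) - T ((f ^^ i) y)\<bar> \<le> K)"

section \<open>Kinematic expansivity from a condition on drift\<close>

context embedded_suspension
begin

text \<open>The circle coordinate of a point near (z, 0) forces its phase near 0 or near 1. So the
  point is just above the base of its own fibre or just below that of the next one, and the third
  coordinate compares \<open>h\<close> there with \<open>h z\<close>, up to a weight near
  1/2.\<close>

lemma near_section: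
  assumes "0 < \<rho>" "0 < \<eta>"
  shows "\<exists>\<delta>>0. \<forall>z\<in>l. \<forall>w\<in>l. \<forall>s. d (cls (w, s)) (cls (z, 0)) < \<delta> \<longrightarrow>
    (\<exists>y\<in>l. \<exists>r. \<bar>r\<bar> < \<rho> \<and> cls (w, s) = cls (y, r) \<and> \<bar>h y - h z\<bar> < \<eta>)"
proof (cases "l = {}")
  case True
  then show ?thesis by (intro exI[of _ 1]) auto
next
  case False
  then obtain b where b: "\<And>x. x \<in> l \<Longrightarrow> T x \<le> b" using T_bounds by metis
  have "0 < b" using False b T_pos by (meson ex_in_conv less_le_trans)
  have "bounded (h ` l)"
    by (intro compact_imp_bounded compact_continuous_image cont_h compact_l)
  then obtain H where H: "0 < H" "\<And>x. x \<in> l \<Longrightarrow> \<bar>h x\<bar> \<le> H"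
    unfolding bounded_pos by auto
  \<comment> \<open>Bounds the distance of the phase from 0 or 1. It is at most 1/4, so that one of
    the two terms of the third coordinate vanishes; small against \<rho> / b, so that the time is
    below \<rho>; and small against \<eta> / H, to control the error of the weight.\<close>
  define \<kappa> where "\<kappa> = Min {1/4, \<rho> / (2 * b), \<eta> / (8 * H)}"
  have \<kappa>: "0 < \<kappa>" "\<kappa> \<le> 1/4" "\<kappa> \<le> \<rho> / (2 * b)" "\<kappa> \<le> \<eta> / (8 * H)"
    using assms \<open>0 < b\<close> H(1) by (auto simp: \<kappa>_def)
  have \<kappa>b: "\<kappa> * b < \<rho>" and \<kappa>H: "\<kappa> * H \<le> \<eta> / 8"
    using \<kappa> \<open>0 < b\<close> H(1) assms(1) by (auto simp: field_simps)
  define c where "c = 1 - cos (2 * pi * \<kappa>)"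
  have cos_less: "cos (2 * pi * \<kappa>) < 1"
    using cos_monotone_0_pi[of 0 "2 * pi * \<kappa>"] \<kappa> by (simp add: field_simps)
  then have "0 < c" by (simp add: c_def)
  define \<delta> where "\<delta> = min c (\<eta> / 4)"
  have "0 < \<delta>" using \<open>0 < c\<close> assms by (simp add: \<delta>_def)
  have "\<exists>y\<in>l. \<exists>r. \<bar>r\<bar> < \<rho> \<and> cls (w, s) = cls (y, r) \<and> \<bar>h y - h z\<bar> < \<eta>"
    if "z \<in> l" "w \<in> l" and less: "d (cls (w, s)) (cls (z, 0)) < \<delta>" for z w s
  proof -
    obtain v t where v: "(v, t) \<in> D" "t < T v" "cls (w, s) = cls (v, t)"
      using cls_rep[OF \<open>w \<in> l\<close>] by metis
    have vl: "v \<in> l" "0 < T v" using v T_pos by (auto simp: D_iff)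
    define u where "u = \<theta> (v, t)"
    have u: "0 \<le> u" "u < 1" "t = u * T v"
      using \<theta>_bounds[OF v(1)] v(2) vl by (auto simp: u_def \<theta>_def)
    have z0: "(z, 0) \<in> D" using \<open>z \<in> l\<close> T_pos by (simp add: D_iff less_imp_le)
    have e: "dist (emb (v, t)) (emb (z, 0)) < \<delta>"
      using less v z0 by (simp add: d_def emb_cls)
    have "dist (cis (2 * pi * u)) 1 < \<delta>"
      using e dist_fst_le[of "emb (v, t)" "emb (z, 0)"] by (simp add: emb_def u_def \<theta>_def)
    moreover have "1 - cos (2 * pi * u) \<le> dist (cis (2 * pi * u)) 1"
      using abs_Re_le_cmod[of "cis (2 * pi * u) - 1"] by (simp add: dist_norm)
    ultimately have cos: "cos (2 * pi * \<kappa>) < cos (2 * pi * u)"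
      by (simp add: \<delta>_def c_def)
    have third: "\<bar>max 0 (1/2 - u) * h v + max 0 (u - 1/2) * h (f v) - h z / 2\<bar> < \<eta> / 4"
      using e dist_snd_le[of "emb (v, t)" "emb (z, 0)"]
        dist_snd_le[of "snd (emb (v, t))" "snd (emb (z, 0))"]
      by (simp add: emb_def u_def \<theta>_def dist_real_def \<delta>_def)
    have near: "\<bar>h y - h z\<bar> < \<eta>" if "y \<in> l" "\<bar>(1/2 - k) * h y - h z / 2\<bar> < \<eta> / 4" "0 \<le> k" "k < \<kappa>" for y k
    proof -
      have "\<bar>k * h y\<bar> \<le> \<kappa> * H"
        using that H(2)[of y] by (auto simp: abs_mult intro!: mult_mono)
      moreover have "(1/2 - k) * h y - h z / 2 = (h y - h z) / 2 - k * h y"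
        by (simp add: algebra_simps diff_divide_distrib)
      then have "\<bar>(h y - h z) / 2 - k * h y\<bar> < \<eta> / 4" using that(2) by simp
      moreover have "\<bar>q\<bar> < e" if "\<bar>p\<bar> \<le> c" "\<bar>q / 2 - p\<bar> < e / 4" "c \<le> e / 8" "0 < e" for p q c e :: real
        using that by linarith
      ultimately show ?thesis using \<kappa>H \<open>0 < \<eta>\<close> by blast
    qed
    have kT: "k * T v < \<rho>" if "0 \<le> k" "k < \<kappa>" for k
      using mult_mono[of k \<kappa> "T v" b] that b[OF vl(1)] vl \<kappa>b \<kappa>(1) by simp
    \<comment> \<open>The two middle ranges contradict the bound on the cosine.\<close>
    consider "u < \<kappa>" | "\<kappa> \<le> u" "u \<le> 1/2" | "1/2 \<le> u" "1 - u \<ge> \<kappa>" | "1 - u < \<kappa>"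
      by linarith
    then show ?thesis
    proof cases
      case 1
      then have "\<bar>h v - h z\<bar> < \<eta>"
        using near[of v u] third u vl \<kappa>(2) by (simp add: max_def)
      moreover have "\<bar>t\<bar> < \<rho>" using kT[of u] 1 u vl by simp
      ultimately show ?thesis using vl v(3) by blast
    next
      case 2
      then have "cos (2 * pi * u) \<le> cos (2 * pi * \<kappa>)"
        using \<kappa>(1) by (intro cos_monotone_0_pi_le) auto
      then show ?thesis using cos by simp
    next
      case 3
      then have "cos (2 * pi * (1 - u)) \<le> cos (2 * pi * \<kappa>)"
        using \<kappa>(1) by (intro cos_monotone_0_pi_le) auto
      moreover have "cos (2 * pi * (1 - u)) = cos (2 * pi * u)"
        using cos_2pi_minus[of "2 * pi * u"] by (simp add: algebra_simps)
      ultimately show ?thesis using cos by simp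
    next
      case 4
      then have "\<bar>h (f v) - h z\<bar> < \<eta>"
        using near[of "f v" "1 - u"] third u vl \<kappa>(2) by (simp add: max_def)
      moreover have "\<bar>t - T v\<bar> < \<rho>"
        using kT[of "1 - u"] 4 u vl by (simp add: algebra_simps abs_if)
      moreover have "cls (w, s) = cls (f v, t - T v)"
        using v(3) cls_fpow[of 1 v "t - T v"] by (simp add: S_def)
      ultimately show ?thesis using vl f_in by blast
    qed
  qed
  then show ?thesis using \<open>0 < \<delta>\<close> by blast
qed

text \<open>Holds because \<open>h\<close> is a homeomorphism onto a compact image, where the
  transported function is uniformly continuous.\<close>

lemma uniformly_continuous_along_h:
  assumes "continuous_on l k" "0 < \<rho>"
  shows "\<exists>\<eta>>0. \<forall>u\<in>l. \<forall>v\<in>l. \<bar>h u - h v\<bar> < \<eta> \<longrightarrow> \<bar>k u - k v :: real\<bar> < \<rho>"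
proof -
  obtain h' where h': "homeomorphism l (h ` l) h h'"
    using homeomorphism_compact[OF compact_l cont_h refl inj_h] by blast
  then have h'h: "h' (h x) = x" if "x \<in> l" for x using that by (auto simp: homeomorphism_def)
  have "continuous_on (h ` l) (\<lambda>y. k (h' y))"
    using h' by (intro continuous_on_compose2[OF assms(1)]) (auto simp: homeomorphism_def)
  then have "uniformly_continuous_on (h ` l) (\<lambda>y. k (h' y))"
    by (intro compact_uniformly_continuous compact_continuous_image cont_h compact_l)
  then obtain \<eta> where "0 < \<eta>" "\<And>y y'. y \<in> h ` l \<Longrightarrow> y' \<in> h ` l \<Longrightarrow> dist y' y < \<eta> \<Longrightarrow> dist (k (h' y')) (k (h' y)) < \<rho>"
    using assms(2) unfolding uniformly_continuous_on_def by metis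
  then show ?thesis
    using h'h by (metis dist_real_def imageI)
qed

text \<open>Two flow orbits that stay close are compared each time the first one meets the base: the
  second is then at a base point y with a small time offset r. In the next fibre the offset is r + T
  x - T y, which is again small. So all offsets are bounded, and their changes are the differences
  of Birkhoff sums.\<close>

theorem admits_kinematic_expansive_suspensionI:
  assumes "0 < \<eta>0" and separates: "\<And>x y. x \<in> l \<Longrightarrow> y \<in> l \<Longrightarrow>
      (\<And>n. \<bar>h ((f ^^ n) x) - h ((f ^^ n) y)\<bar> < \<eta>0) \<Longrightarrow>
      (\<And>n. \<bar>h ((g ^^ n) x) - h ((g ^^ n) y)\<bar> < \<eta>0) \<Longrightarrow>
      bounded_drift f T x y \<Longrightarrow> bounded_drift g T x y \<Longrightarrow> x = y"
  shows "admits_kinematic_expansive_suspension l f"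
proof -
  have ke: "\<exists>\<delta>>0. \<forall>C\<in>D // R. \<forall>C'\<in>D // R.
      (\<forall>t. d (flow t C) (flow t C') < \<delta>) \<longrightarrow> (\<exists>s. \<bar>s\<bar> < \<epsilon> \<and> C' = flow s C)" if "0 < \<epsilon>" for \<epsilon>
  proof (cases "l = {}")
    case True
    then have "D // R = {}" using D_iff by (auto elim: quotient_cases)
    then show ?thesis by (metis empty_iff that)
  next
    case False
    then obtain a where a: "0 < a" "\<And>x. x \<in> l \<Longrightarrow> a \<le> T x" using T_bounds by metis
    \<comment> \<open>An offset below 2 * \<rho> obtained by continuation and one below \<rho> given
      by \<open>near_section\<close> differ by less than every return time, so they
      coincide.\<close>
    define \<rho> where "\<rho> = min \<epsilon> (a / 4)"
    have \<rho>: "0 < \<rho>" "\<rho> \<le> \<epsilon>" "4 * \<rho> \<le> a" using a that by (auto simp: \<rho>_def)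
    have Tg: "continuous_on l (\<lambda>x. T (g x))"
      by (rule continuous_on_compose2[OF cont_T cont_g]) auto
    obtain \<eta>1 where \<eta>1: "0 < \<eta>1" "\<And>u v. u \<in> l \<Longrightarrow> v \<in> l \<Longrightarrow> \<bar>h u - h v\<bar> < \<eta>1 \<Longrightarrow> \<bar>T u - T v\<bar> < \<rho>"
      using uniformly_continuous_along_h[OF cont_T \<rho>(1)] by blast
    obtain \<eta>2 where \<eta>2: "0 < \<eta>2" "\<And>u v. u \<in> l \<Longrightarrow> v \<in> l \<Longrightarrow> \<bar>h u - h v\<bar> < \<eta>2 \<Longrightarrow> \<bar>T (g u) - T (g v)\<bar> < \<rho>"
      using uniformly_continuous_along_h[OF Tg \<rho>(1)] by blast
    define \<eta> where "\<eta> = min \<eta>0 (min \<eta>1 \<eta>2)"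
    have \<eta>: "0 < \<eta>" "\<eta> \<le> \<eta>0" "\<eta> \<le> \<eta>1" "\<eta> \<le> \<eta>2" using \<eta>1(1) \<eta>2(1) assms(1) by (auto simp: \<eta>_def)
    obtain \<delta> where \<delta>: "0 < \<delta>" "\<And>z w s. z \<in> l \<Longrightarrow> w \<in> l \<Longrightarrow> d (cls (w, s)) (cls (z, 0)) < \<delta> \<Longrightarrow>
        (\<exists>y\<in>l. \<exists>r. \<bar>r\<bar> < \<rho> \<and> cls (w, s) = cls (y, r) \<and> \<bar>h y - h z\<bar> < \<eta>)"
      using near_section[OF \<rho>(1) \<eta>(1)] by blast
    \<comment> \<open>When the first orbit is at (x, 0), the second one is at (y, r).\<close>
    define close where "close = (\<lambda>x y r. x \<in> l \<and> y \<in> l \<and> \<bar>r\<bar> < \<rho> \<and> \<bar>h x - h y\<bar> < \<eta> \<and>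
        (\<forall>t. d (cls (y, r + t)) (cls (x, t)) < \<delta>))"
    have closeI: "close x y r"
      if xy: "x \<in> l" "y \<in> l" "\<bar>r\<bar> < 2 * \<rho>" and d: "\<And>t. d (cls (y, r + t)) (cls (x, t)) < \<delta>" for x y r
    proof -
      obtain y' r' where y': "y' \<in> l" "\<bar>r'\<bar> < \<rho>" "cls (y, r) = cls (y', r')" "\<bar>h y' - h x\<bar> < \<eta>"
        using \<delta>(2)[OF xy(1,2), of r] d[of 0] by auto
      have "\<bar>r - r'\<bar> < T z" if "z \<in> l" for z
        using a(2)[OF that] \<rho> y'(2) \<open>\<bar>r\<bar> < 2 * \<rho>\<close> by linarith
      then have "y = y'" "r = r'"
        using cls_near_zero[OF y'(3) xy(2) y'(1)] by blast+
      then show ?thesis using xy d y' by (simp add: close_def abs_minus_commute)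
    qed
    have forward: "close (f x) (f y) (r + T x - T y)" if "close x y r" for x y r
    proof (rule closeI)
      show "\<bar>r + T x - T y\<bar> < 2 * \<rho>"
        using \<eta>1(2)[of x y] that \<eta> unfolding close_def by fastforce
      show "d (cls (f y, r + T x - T y + t)) (cls (f x, t)) < \<delta>" for t
      proof -
        have "cls (f y, r + T x - T y + t) = cls (y, r + (t + T x))" "cls (f x, t) = cls (x, t + T x)"
          using cls_fpow[of 1 y "r + T x - T y + t"] cls_fpow[of 1 x t] by (simp_all add: S_def algebra_simps)
        then show ?thesis using that by (simp add: close_def)
      qed
    qed (use that in \<open>auto simp: close_def\<close>)
    have backward: "close (g x) (g y) (r - T (g x) + T (g y))" if "close x y r" for x y r
    proof (rule closeI)
      show "\<bar>r - T (g x) + T (g y)\<bar> < 2 * \<rho>"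
        using \<eta>2(2)[of x y] that \<eta> unfolding close_def by fastforce
      show "d (cls (g y, r - T (g x) + T (g y) + t)) (cls (g x, t)) < \<delta>" for t
      proof -
        have "cls (g y, r - T (g x) + T (g y) + t) = cls (y, r + (t - T (g x)))" "cls (g x, t) = cls (x, t - T (g x))"
          using cls_fpow[of 1 "g y" "r + (t - T (g x))"] cls_fpow[of 1 "g x" "t - T (g x)"] that
          by (simp_all add: S_def close_def algebra_simps)
        then show ?thesis using that by (simp add: close_def)
      qed
    qed (use that in \<open>auto simp: close_def\<close>)
    have "\<exists>s. \<bar>s\<bar> < \<epsilon> \<and> C' = flow s C"
      if C: "C \<in> D // R" "C' \<in> D // R" and all: "\<And>t. d (flow t C) (flow t C') < \<delta>" for C C'
    proof -
      obtain x s where x: "(x, s) \<in> D" "C = cls (x, s)" using C(1) quotient_cases by metis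
      obtain w s' where w: "(w, s') \<in> D" "C' = cls (w, s')" using C(2) quotient_cases by metis
      have l: "x \<in> l" "w \<in> l" using x w by (auto simp: D_iff)
      have all': "d (cls (w, s' + t)) (cls (x, s + t)) < \<delta>" for t
        using all[of t] l x w by (simp add: flow_cls M.commute)
      obtain y r where y: "y \<in> l" "\<bar>r\<bar> < \<rho>" "cls (w, s' - s) = cls (y, r)"
        using \<delta>(2)[OF l, of "s' - s"] all'[of "- s"] by auto
      have C': "cls (w, s' + t) = cls (y, r + (s + t))" for t
        using cls_add[OF y(3) l(2), of "s + t"] by (simp add: algebra_simps)
      have "close x y r"
      proof (rule closeI)
        show "d (cls (y, r + t)) (cls (x, t)) < \<delta>" for t
          using all'[of "t - s"] C'[of "t - s"] by simp
      qed (use l y \<rho> in auto)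
      have F: "close ((f ^^ n) x) ((f ^^ n) y) (r + (\<Sum>i<n. T ((f ^^ i) x) - T ((f ^^ i) y)))" for n
      proof (induction n)
        case (Suc n)
        then show ?case using forward by (fastforce simp: algebra_simps)
      qed (use \<open>close x y r\<close> in simp)
      \<comment> \<open>Going back passes the fibre over \<open>g x\<close>, so the roof is
        evaluated from the first preimage on. \<open>bounded_drift\<close> starts at x itself, which
        costs one more term below.\<close>
      have G: "close ((g ^^ n) x) ((g ^^ n) y) (r - (\<Sum>i<n. T ((g ^^ Suc i) x) - T ((g ^^ Suc i) y)))" for n
      proof (induction n)
        case (Suc n)
        then show ?case using backward by (fastforce simp: algebra_simps)
      qed (use \<open>close x y r\<close> in simp)
      have "x = y"
      proof (rule separates)
        show "bounded_drift f T x y"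
          unfolding bounded_drift_def
        proof (intro exI allI)
          show "\<bar>\<Sum>i<n. T ((f ^^ i) x) - T ((f ^^ i) y)\<bar> \<le> 2 * \<rho>" for n
            using F[of n] y(2) unfolding close_def by linarith
        qed
        show "bounded_drift g T x y"
          unfolding bounded_drift_def
        proof (intro exI allI)
          fix n
          show "\<bar>\<Sum>i<n. T ((g ^^ i) x) - T ((g ^^ i) y)\<bar> \<le> \<bar>T x - T y\<bar> + 2 * \<rho>"
          proof (cases n)
            case 0
            then show ?thesis using \<rho> by simp
          next
            case (Suc m)
            have "\<bar>\<Sum>i<m. T ((g ^^ Suc i) x) - T ((g ^^ Suc i) y)\<bar> \<le> 2 * \<rho>"
              using G[of m] y(2) unfolding close_def by linarith
            then show ?thesis unfolding Suc sum.lessThan_Suc_shift by simp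
          qed
        qed
      qed (use F G l y \<eta> in \<open>auto simp: close_def intro: less_le_trans\<close>)
      then have "C' = flow r C"
        using C'[of 0] x w l by (simp add: flow_cls add.commute)
      then show ?thesis using y(2) \<rho>(2) by (intro exI[of _ r]) simp
    qed
    then show ?thesis using \<delta>(1) by blast
  qed
  have "kinematic_expansive (D // R) d flow"
    unfolding kinematic_expansive_def
    using M.Metric_space_axioms ke compact_space_X suspension_flow_flow
    by (simp add: mtopology_eq suspension_flow_def)
  then show ?thesis
    unfolding admits_kinematic_expansive_suspension_def
    using cont_T T_pos suspension_flow_flow M.Metric_space_axioms mtopology_eq by blast
qed

end

section \<open>Drift along the orbits of interval homeomorphisms\<close>

lemma bounded_drift_refl: "bounded_drift F V x x"
  by (auto simp: bounded_drift_def)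

lemma bounded_drift_sym: "bounded_drift F V x y \<Longrightarrow> bounded_drift F V y x"
proof -
  have "\<bar>\<Sum>i<n. V ((F ^^ i) y) - V ((F ^^ i) x)\<bar> = \<bar>\<Sum>i<n. V ((F ^^ i) x) - V ((F ^^ i) y)\<bar>" for n
    by (simp add: sum_subtractf abs_minus_commute)
  then show "bounded_drift F V x y \<Longrightarrow> bounded_drift F V y x"
    by (simp add: bounded_drift_def)
qed

lemma bounded_drift_trans:
  assumes "bounded_drift F V x y" "bounded_drift F V y z"
  shows "bounded_drift F V x z"
proof -
  obtain K K' where K: "\<And>n. \<bar>\<Sum>i<n. V ((F ^^ i) x) - V ((F ^^ i) y)\<bar> \<le> K"
      "\<And>n. \<bar>\<Sum>i<n. V ((F ^^ i) y) - V ((F ^^ i) z)\<bar> \<le> K'"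
    using assms unfolding bounded_drift_def by blast
  have "\<bar>\<Sum>i<n. V ((F ^^ i) x) - V ((F ^^ i) z)\<bar> \<le> K + K'" for n
  proof -
    have "(\<Sum>i<n. V ((F ^^ i) x) - V ((F ^^ i) z)) =
        (\<Sum>i<n. V ((F ^^ i) x) - V ((F ^^ i) y)) + (\<Sum>i<n. V ((F ^^ i) y) - V ((F ^^ i) z))"
      by (simp add: sum_subtractf)
    then show ?thesis using K[of n] by linarith
  qed
  then show ?thesis unfolding bounded_drift_def by blast
qed

text \<open>The difference of the Birkhoff sums of x and of F x telescopes to two values of
  \<open>V\<close>.\<close>

lemma bounded_drift_funpow:
  assumes "\<And>n. \<bar>V ((F ^^ n) x)\<bar> \<le> K"
  shows "bounded_drift F V x ((F ^^ k) x)"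
proof (induction k)
  case 0
  then show ?case by (simp add: bounded_drift_refl)
next
  case (Suc k)
  have "bounded_drift F V ((F ^^ k) x) ((F ^^ Suc k) x)"
    unfolding bounded_drift_def
  proof (intro exI allI)
    fix n
    have "(\<Sum>i<n. V ((F ^^ i) ((F ^^ k) x)) - V ((F ^^ i) ((F ^^ Suc k) x))) =
        (\<Sum>i<n. V ((F ^^ (i + k)) x) - V ((F ^^ (Suc i + k)) x))"
      by (simp add: funpow_add funpow_swap1)
    also have "\<dots> = V ((F ^^ k) x) - V ((F ^^ (n + k)) x)"
      using sum_lessThan_telescope'[of "\<lambda>i. V ((F ^^ (i + k)) x)" n] by simp
    finally show "\<bar>\<Sum>i<n. V ((F ^^ i) ((F ^^ k) x)) - V ((F ^^ i) ((F ^^ Suc k) x))\<bar> \<le> 2 * K"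
      using assms[of k] assms[of "n + k"] by linarith
  qed
  then show ?case by (rule bounded_drift_trans[OF Suc])
qed

text \<open>Otherwise the summands eventually have one sign and exceed half the distance of the
  limits, so the sums grow linearly.\<close>

lemma bounded_drift_imp_eq_limits:
  fixes V :: "'a::topological_space \<Rightarrow> real"
  assumes "bounded_drift F V x y"
    and "(\<lambda>n. V ((F ^^ n) x)) \<longlonglongrightarrow> p" "(\<lambda>n. V ((F ^^ n) y)) \<longlonglongrightarrow> q"
  shows "p = q"
proof (rule ccontr)
  assume "p \<noteq> q"
  define s where "s = sgn (p - q)"
  have s: "s * (p - q) = \<bar>p - q\<bar>" "\<bar>s\<bar> = 1" using \<open>p \<noteq> q\<close> by (auto simp: s_def sgn_if)
  define D where "D = (\<lambda>n. s * (V ((F ^^ n) x) - V ((F ^^ n) y)))"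
  have "D \<longlonglongrightarrow> s * (p - q)" unfolding D_def by (intro tendsto_intros assms)
  moreover have "0 < \<bar>p - q\<bar> / 2" "\<bar>p - q\<bar> / 2 < s * (p - q)" using \<open>p \<noteq> q\<close> s by auto
  ultimately have "\<forall>\<^sub>F n in sequentially. \<bar>p - q\<bar> / 2 < D n" by (metis order_tendstoD(1))
  then obtain N where N: "\<And>n. N \<le> n \<Longrightarrow> \<bar>p - q\<bar> / 2 < D n"
    by (auto simp: eventually_sequentially)
  obtain K where K: "\<And>n. \<bar>\<Sum>i<n. V ((F ^^ i) x) - V ((F ^^ i) y)\<bar> \<le> K"
    using assms(1) unfolding bounded_drift_def by blast
  have DK: "\<bar>\<Sum>i<n. D i\<bar> \<le> K" for n
    using K[of n] s(2) by (simp add: D_def sum_distrib_left[symmetric] abs_mult)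
  have grow: "real n * c + (\<Sum>i<N. D i) \<le> (\<Sum>i<N + n. D i)" if "c = \<bar>p - q\<bar> / 2" for n c
  proof (induction n)
    case (Suc n)
    have "c < D (N + n)" using N[of "N + n"] that by simp
    then show ?case using Suc by (simp add: distrib_right)
  qed simp
  obtain n where "2 * K < real n * (\<bar>p - q\<bar> / 2)"
    using reals_Archimedean3[OF \<open>0 < \<bar>p - q\<bar> / 2\<close>] by blast
  then show False using grow[OF refl, of n] DK[of N] DK[of "N + n"] by linarith
qed

lemma limit_of_orbit_fixed:
  fixes F :: "'a::t2_space \<Rightarrow> 'a"
  assumes "continuous_on S F" "\<And>n. (F ^^ n) x \<in> S" "L \<in> S" "(\<lambda>n. (F ^^ n) x) \<longlonglongrightarrow> L"
  shows "F L = L"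
proof -
  have "(\<lambda>n. F ((F ^^ n) x)) \<longlonglongrightarrow> F L"
    using assms by (intro continuous_on_tendsto_compose[OF assms(1)]) auto
  moreover have "(\<lambda>n. F ((F ^^ n) x)) \<longlonglongrightarrow> L"
    using LIMSEQ_Suc[OF assms(4)] by simp
  ultimately show ?thesis by (rule LIMSEQ_unique)
qed

text \<open>Division by sqrt n kills both the bound and the logarithm and leaves A = 0; then B = 0,
  as ln is unbounded. Thus two coefficients can be read off a single sequence of sums.\<close>

lemma sqrt_ln_combination_bounded:
  fixes A B K :: real
  assumes "\<And>n. \<bar>sqrt (real n) * A + ln (real n + 1) * B\<bar> \<le> K"
  shows "A = 0" "B = 0"
proof -
  have "(\<lambda>n. A + ln (real n + 1) / sqrt (real n) * B) \<longlonglongrightarrow> A + 0 * B"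
    by (intro tendsto_intros) real_asymp
  moreover have "(\<lambda>n. A + ln (real n + 1) / sqrt (real n) * B) \<longlonglongrightarrow> 0"
  proof (rule tendsto_rabs_zero_cancel, rule tendsto_sandwich[where f = "\<lambda>_. 0"])
    show "(\<lambda>n. K / sqrt (real n)) \<longlonglongrightarrow> 0" by real_asymp
    show "\<forall>\<^sub>F n in sequentially. \<bar>A + ln (real n + 1) / sqrt (real n) * B\<bar> \<le> K / sqrt (real n)"
      using eventually_gt_at_top[of 0]
    proof eventually_elim
      case (elim n)
      have "A + ln (real n + 1) / sqrt (real n) * B = (sqrt (real n) * A + ln (real n + 1) * B) / sqrt (real n)"
        using elim by (simp add: field_simps)
      then show ?case using assms[of n] elim by (simp add: divide_right_mono)
    qed
  qed auto
  ultimately show "A = 0" using LIMSEQ_unique by fastforce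
  then have "\<bar>ln (real n + 1) * B\<bar> \<le> K" for n using assms[of n] by simp
  moreover have "filterlim (\<lambda>n. ln (real n + 1)) at_top sequentially" by real_asymp
  then have "\<forall>\<^sub>F n in sequentially. (K + 1) / \<bar>B\<bar> \<le> ln (real n + 1)"
    by (simp add: filterlim_at_top)
  then obtain n where n: "(K + 1) / \<bar>B\<bar> \<le> ln (real n + 1)" by (auto simp: eventually_sequentially)
  ultimately show "B = 0"
  proof (rule_tac ccontr)
    assume "B \<noteq> 0"
    then have "K + 1 \<le> ln (real n + 1) * \<bar>B\<bar>" using n by (simp add: field_simps)
    then show False using \<open>\<bar>ln (real n + 1) * B\<bar> \<le> K\<close> by (simp add: abs_mult)
  qed
qed

section \<open>Increasing homeomorphisms of a compact interval\<close>

locale interval_homeo =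
  fixes a b :: real and F G :: "real \<Rightarrow> real"
  assumes a_le_b: "a \<le> b"
    and homeo: "homeomorphism {a..b} {a..b} F G"
    and mono_F: "strict_mono_on {a..b} F"
begin

lemma F_in: "x \<in> {a..b} \<Longrightarrow> F x \<in> {a..b}" and G_in: "x \<in> {a..b} \<Longrightarrow> G x \<in> {a..b}"
  and GF: "x \<in> {a..b} \<Longrightarrow> G (F x) = x" and FG: "x \<in> {a..b} \<Longrightarrow> F (G x) = x"
  and cont_F: "continuous_on {a..b} F" and cont_G: "continuous_on {a..b} G"
  using homeo unfolding homeomorphism_def by blast+

lemma F_less: "x \<in> {a..b} \<Longrightarrow> y \<in> {a..b} \<Longrightarrow> F x < F y \<longleftrightarrow> x < y"
  using mono_F by (meson strict_mono_on_less)

lemma G_less: "x \<in> {a..b} \<Longrightarrow> y \<in> {a..b} \<Longrightarrow> G x < G y \<longleftrightarrow> x < y"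
  using F_less[OF G_in G_in] FG by metis

lemma F_a: "F a = a" and F_b: "F b = b"
proof -
  have "a \<le> G a" "G b \<le> b" "a \<le> F a" "F b \<le> b" using F_in[of a] F_in[of b] G_in[of a] G_in[of b] a_le_b by auto
  moreover have "F a \<le> a" using F_less[of "G a" a] G_in[of a] FG[of a] \<open>a \<le> G a\<close> a_le_b by fastforce
  moreover have "b \<le> F b" using F_less[of b "G b"] G_in[of b] FG[of b] \<open>G b \<le> b\<close> a_le_b by fastforce
  ultimately show "F a = a" "F b = b" by auto
qed

lemma G_a: "G a = a" and G_b: "G b = b"
  using GF[of a] GF[of b] F_a F_b a_le_b by auto

lemma F_inner: "x \<in> {a<..<b} \<Longrightarrow> F x \<in> {a<..<b}"
  using F_less[of a x] F_less[of x b] F_a F_b a_le_b by auto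

lemma G_inner: "x \<in> {a<..<b} \<Longrightarrow> G x \<in> {a<..<b}"
  using G_less[of a x] G_less[of x b] G_a G_b a_le_b by auto

lemma Fpow_in: "x \<in> {a..b} \<Longrightarrow> (F ^^ n) x \<in> {a..b}"
  by (induction n) (auto simp del: atLeastAtMost_iff simp: F_in)

lemma Gpow_in: "x \<in> {a..b} \<Longrightarrow> (G ^^ n) x \<in> {a..b}"
  by (induction n) (auto simp del: atLeastAtMost_iff simp: G_in)

lemma Fpow_inner: "x \<in> {a<..<b} \<Longrightarrow> (F ^^ n) x \<in> {a<..<b}"
  by (induction n) (auto simp del: greaterThanLessThan_iff simp: F_inner)

lemma Gpow_inner: "x \<in> {a<..<b} \<Longrightarrow> (G ^^ n) x \<in> {a<..<b}"
  by (induction n) (auto simp del: greaterThanLessThan_iff simp: G_inner)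

lemma GF_pow: "x \<in> {a..b} \<Longrightarrow> (G ^^ n) ((F ^^ n) x) = x"
  by (induction n arbitrary: x) (auto simp del: atLeastAtMost_iff simp: funpow_swap1 GF F_in[unfolded funpow_swap1])

lemma FG_pow: "x \<in> {a..b} \<Longrightarrow> (F ^^ n) ((G ^^ n) x) = x"
  by (induction n arbitrary: x) (auto simp del: atLeastAtMost_iff simp: funpow_swap1 FG G_in[unfolded funpow_swap1])

lemma Fpow_le: "x \<in> {a..b} \<Longrightarrow> y \<in> {a..b} \<Longrightarrow> x \<le> y \<Longrightarrow> (F ^^ n) x \<le> (F ^^ n) y"
proof (induction n)
  case (Suc n)
  then show ?case
    using F_less[of "(F ^^ n) y" "(F ^^ n) x"] Fpow_in[of x n] Fpow_in[of y n] by fastforce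
qed simp

text \<open>With the inverse as a parameter, passing to it is a mere exchange; gaps in which
  \<open>F\<close> moves points to the left are treated as gaps of \<open>G\<close>.\<close>

lemma swap: "interval_homeo a b G F"
  using a_le_b homeo G_less by (unfold_locales) (auto simp: homeomorphism_symD strict_mono_on_def)

end

section \<open>A bump on an interval whose inner points all move to the right\<close>

locale drifting_interval = interval_homeo +
  assumes ab: "a < b" and moves: "\<And>x. a < x \<Longrightarrow> x < b \<Longrightarrow> x < F x"
begin

lemma G_moves: "x \<in> {a<..<b} \<Longrightarrow> G x < x"
  using moves[of "G x"] G_inner[of x] FG[of x] by auto

lemma Fpow_tendsto: "x \<in> {a<..<b} \<Longrightarrow> (\<lambda>n. (F ^^ n) x) \<longlonglongrightarrow> b"
proof -
  assume x: "x \<in> {a<..<b}"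
  have inc: "incseq (\<lambda>n. (F ^^ n) x)"
    using Fpow_inner[OF x] moves by (intro incseq_SucI) (auto intro: less_imp_le)
  obtain L where L: "(\<lambda>n. (F ^^ n) x) \<longlonglongrightarrow> L" "\<And>n. (F ^^ n) x \<le> L"
    using incseq_convergent[OF inc, of b] Fpow_inner[OF x] by (auto intro: less_imp_le)
  have "a < L" using L(2)[of 0] x by simp
  moreover have "L \<le> b" using L(1) Fpow_inner[OF x] by (intro LIMSEQ_le_const2[OF L(1)]) (auto intro: less_imp_le)
  moreover from calculation have "F L = L"
    using Fpow_in[of x] x L(1) by (intro limit_of_orbit_fixed[OF cont_F, of x L]) auto
  ultimately show ?thesis using L(1) moves[of L] by fastforce
qed

lemma Gpow_tendsto: "x \<in> {a<..<b} \<Longrightarrow> (\<lambda>n. (G ^^ n) x) \<longlonglongrightarrow> a"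
proof -
  assume x: "x \<in> {a<..<b}"
  have dec: "decseq (\<lambda>n. (G ^^ n) x)"
    using Gpow_inner[OF x] G_moves by (intro decseq_SucI) (auto intro: less_imp_le)
  obtain L where L: "(\<lambda>n. (G ^^ n) x) \<longlonglongrightarrow> L" "\<And>n. L \<le> (G ^^ n) x"
    using decseq_convergent[OF dec, of a] Gpow_inner[OF x] by (auto intro: less_imp_le)
  have "L < b" using L(2)[of 0] x by simp
  moreover have "a \<le> L" using L(1) Gpow_inner[OF x] by (intro LIMSEQ_le_const[OF L(1)]) (auto intro: less_imp_le)
  moreover from calculation have "G L = L"
    using Gpow_in[of x] x L(1) by (intro limit_of_orbit_fixed[OF cont_G, of x L]) auto
  ultimately show ?thesis using L(1) G_moves[of L] by fastforce
qed

definition c where "c = (a + b) / 2"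

lemma c_inner: "c \<in> {a<..<b}"
  using ab by (simp add: c_def)

lemma c_less: "c < F c"
  using moves c_inner by auto

text \<open>The orbit of x tends to both ends and so passes \<open>c\<close>. Its first point, in
  the direction of \<open>F\<close>, that is not below \<open>c\<close> has a predecessor below
  \<open>c\<close>, hence lies below F c.\<close>

lemma fundamental_domain:
  assumes "x \<in> {a<..<b}"
  shows "\<exists>z n. z \<in> {c..<F c} \<and> (z = (F ^^ n) x \<or> z = (G ^^ n) x)"
proof (cases "c \<le> x")
  case True
  have "\<forall>\<^sub>F n in sequentially. (G ^^ n) x < c"
    using order_tendstoD(2)[OF Gpow_tendsto[OF assms]] c_inner by auto
  then have ex: "\<exists>n. (G ^^ n) x < c" by (auto simp: eventually_sequentially)
  define m where "m = (LEAST n. (G ^^ n) x < c)"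
  have m: "(G ^^ m) x < c" unfolding m_def by (rule LeastI_ex[OF ex])
  then obtain k where k: "m = Suc k" using True by (cases m) auto
  have "\<not> (G ^^ k) x < c" using not_less_Least[of k "\<lambda>n. (G ^^ n) x < c"] k by (simp add: m_def)
  moreover have "(G ^^ k) x < F c"
    using m F_less[of "(G ^^ m) x" c] Gpow_inner[OF assms, of m] Gpow_inner[OF assms, of k] c_inner FG[of "(G ^^ k) x"] k
    by auto
  ultimately have "(G ^^ k) x \<in> {c..<F c}" by simp
  then show ?thesis by blast
next
  case False
  have "\<forall>\<^sub>F n in sequentially. c < (F ^^ n) x"
    using order_tendstoD(1)[OF Fpow_tendsto[OF assms]] c_inner by auto
  then have ex: "\<exists>n. c \<le> (F ^^ n) x" by (auto simp: eventually_sequentially intro: less_imp_le)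
  define m where "m = (LEAST n. c \<le> (F ^^ n) x)"
  have m: "c \<le> (F ^^ m) x" unfolding m_def by (rule LeastI_ex[OF ex])
  then obtain k where k: "m = Suc k" using False by (cases m) auto
  have "(F ^^ k) x < c" using not_less_Least[of k "\<lambda>n. c \<le> (F ^^ n) x"] k by (simp add: m_def)
  then have "(F ^^ m) x < F c"
    using F_less[of "(F ^^ k) x" c] Fpow_inner[OF assms, of k] c_inner k by auto
  then have "(F ^^ m) x \<in> {c..<F c}" using m by simp
  then show ?thesis by blast
qed

text \<open>The zeros at both ends of the fundamental domain let the copies on its iterates join
  continuously.\<close>

definition \<psi>1 :: "real \<Rightarrow> real" where "\<psi>1 z = max 0 ((z - c) * (F c - z))"

text \<open>The quotient by \<open>\<psi>1\<close> is z - c, so the pair determines z wherever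
  \<open>\<psi>1\<close> is not 0, and in [c, F c) it is 0 only at \<open>c\<close>.\<close>

definition \<psi>2 :: "real \<Rightarrow> real" where "\<psi>2 z = \<psi>1 z * (z - c)"

text \<open>The coefficients are the increments of sqrt n and ln (n + 1). They tend to 0, which
  makes the bump continuous at \<open>b\<close>, but their sums diverge, which makes it visible to
  the drift.\<close>

definition \<Psi> :: "nat \<Rightarrow> real \<Rightarrow> real" where
  "\<Psi> i z = (sqrt (real i + 1) - sqrt (real i)) * \<psi>1 z + (ln (real i + 2) - ln (real i + 1)) * \<psi>2 z"

text \<open>Extends the bump to the whole line by its value 0 at the ends, so that the bumps of
  several gaps can be added.\<close>

definition clamp :: "real \<Rightarrow> real" where "clamp x = max a (min b x)"

text \<open>The i-th summand lives on the image of the fundamental domain under the i-th power of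
  \<open>F\<close>.\<close>

definition bump_sum :: "nat \<Rightarrow> real \<Rightarrow> real" where "bump_sum n x = (\<Sum>i<n. \<Psi> i ((G ^^ i) (clamp x)))"

lemma clamp_in: "clamp x \<in> {a..b}"
  using ab by (auto simp: clamp_def)

lemma \<psi>1_eq_0_iff: "\<psi>1 z = 0 \<longleftrightarrow> z \<notin> {c<..<F c}"
proof (cases "z \<in> {c<..<F c}")
  case True
  then have "0 < (z - c) * (F c - z)" by simp
  then show ?thesis using True by (simp add: \<psi>1_def max_def)
next
  case False
  then have "(z - c) * (F c - z) \<le> 0" using c_less by (auto simp: mult_le_0_iff)
  then show ?thesis using False by (simp add: \<psi>1_def max_def)
qed

lemma \<Psi>_nonzeroD: "\<Psi> i z \<noteq> 0 \<Longrightarrow> z \<in> {c<..<F c}"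
  using \<psi>1_eq_0_iff[of z] by (auto simp: \<Psi>_def \<psi>2_def)

lemma \<psi>2_nonneg: "0 \<le> \<psi>2 z"
  using \<psi>1_eq_0_iff[of z] by (cases "z \<in> {c<..<F c}") (auto simp: \<psi>2_def \<psi>1_def)

lemma \<Psi>_nonneg: "0 \<le> \<Psi> i z"
  unfolding \<Psi>_def using \<psi>2_nonneg by (intro add_nonneg_nonneg mult_nonneg_nonneg) (auto simp: \<psi>1_def)

text \<open>\<open>G\<close> maps a point below F c below \<open>c\<close>, and from there only
  further down.\<close>

lemma disjoint_iterates:
  assumes "w \<in> {a..b}" "(G ^^ i) w \<in> {c..<F c}" "(G ^^ j) w \<in> {c..<F c}"
  shows "i = j"
proof -
  have *: False if "(G ^^ i) w < F c" "c \<le> (G ^^ j) w" "i < j" for i j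
  proof -
    define y where "y = (G ^^ i) w"
    have y: "y \<in> {a..b}" using Gpow_in assms(1) by (simp add: y_def)
    have Gc: "G (F c) = c" using GF c_inner by auto
    have lt: "(G ^^ Suc k) y < c" for k
    proof (induction k)
      case 0
      have "G y < G (F c)" using that(1) y F_inner[OF c_inner] G_less[of y "F c"] by (auto simp: y_def)
      then show ?case using Gc by simp
    next
      case (Suc k)
      have "(G ^^ Suc (Suc k)) y < G c"
        using Suc G_less[of "(G ^^ Suc k) y" c] Gpow_in[OF y, of "Suc k"] c_inner by auto
      then show ?case using G_moves[OF c_inner] by linarith
    qed
    have "j = Suc (j - i - 1) + i" using that(3) by simp
    then have "(G ^^ j) w = (G ^^ Suc (j - i - 1)) y" by (metis comp_apply funpow_add y_def)
    then show False using lt that(2) by (metis not_less)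
  qed
  show ?thesis
    using *[of i j] *[of j i] assms by (metis atLeastLessThan_iff linorder_neqE_nat)
qed

lemma continuous_on_\<psi>1: "continuous_on UNIV \<psi>1"
  unfolding \<psi>1_def by (intro continuous_intros)

lemma continuous_on_bump_sum: "continuous_on UNIV (bump_sum n)"
proof -
  have G: "continuous_on {a..b} (G ^^ i)" for i
  proof (induction i)
    case (Suc i)
    then show ?case using continuous_on_compose2[OF cont_G Suc] Gpow_in by (simp add: image_subset_iff o_def)
  qed simp
  have "continuous_on UNIV clamp" unfolding clamp_def by (intro continuous_intros)
  then have Gc: "continuous_on UNIV (\<lambda>x. (G ^^ i) (clamp x))" for i
    using clamp_in by (intro continuous_on_compose2[OF G]) auto
  have "continuous_on UNIV (\<Psi> i)" for i
    unfolding \<Psi>_def \<psi>2_def by (intro continuous_intros continuous_on_\<psi>1)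
  then show ?thesis
    unfolding bump_sum_def by (intro continuous_on_sum continuous_on_compose2[OF _ Gc]) auto
qed

lemma bump_sum_nonneg: "0 \<le> bump_sum n x"
  unfolding bump_sum_def by (intro sum_nonneg \<Psi>_nonneg)

lemma \<Psi>_small:
  assumes "0 < e"
  shows "\<exists>N. \<forall>i\<ge>N. \<forall>z. \<Psi> i z < e"
proof -
  have "bounded (\<psi>1 ` {c..F c})" "bounded (\<psi>2 ` {c..F c})"
    unfolding \<psi>2_def
    by (intro compact_imp_bounded compact_continuous_image continuous_intros compact_Icc
        continuous_on_subset[OF continuous_on_\<psi>1]; simp)+
  then obtain M1 M2 where M: "0 < M1" "\<And>z. z \<in> {c..F c} \<Longrightarrow> \<bar>\<psi>1 z\<bar> \<le> M1" "0 < M2" "\<And>z. z \<in> {c..F c} \<Longrightarrow> \<bar>\<psi>2 z\<bar> \<le> M2"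
    unfolding bounded_pos by (auto simp del: atLeastAtMost_iff)
  have "(\<lambda>i. (sqrt (real i + 1) - sqrt (real i)) * M1 + (ln (real i + 2) - ln (real i + 1)) * M2) \<longlonglongrightarrow> 0 * M1 + 0 * M2"
    by (intro tendsto_intros; real_asymp)
  then have "\<forall>\<^sub>F i in sequentially. (sqrt (real i + 1) - sqrt (real i)) * M1 + (ln (real i + 2) - ln (real i + 1)) * M2 < e"
    using assms by (intro order_tendstoD(2)) auto
  then obtain N where N: "\<And>i. N \<le> i \<Longrightarrow> (sqrt (real i + 1) - sqrt (real i)) * M1 + (ln (real i + 2) - ln (real i + 1)) * M2 < e"
    by (auto simp: eventually_sequentially)
  have "\<Psi> i z < e" if "N \<le> i" for i z
  proof (cases "z \<in> {c..F c}")
    case True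
    have "\<Psi> i z \<le> (sqrt (real i + 1) - sqrt (real i)) * M1 + (ln (real i + 2) - ln (real i + 1)) * M2"
      unfolding \<Psi>_def using M(2)[OF True] M(4)[OF True] by (intro add_mono mult_left_mono) auto
    then show ?thesis using N[OF that] by linarith
  next
    case False
    then have "\<Psi> i z = 0" using \<Psi>_nonzeroD[of i z] by fastforce
    then show ?thesis using assms by simp
  qed
  then show ?thesis by blast
qed

lemma sum_\<Psi>_single:
  assumes "w \<in> {a..b}" "(G ^^ i) w \<in> {c..<F c}" "i \<in> A" "finite A"
  shows "(\<Sum>j\<in>A. \<Psi> j ((G ^^ j) w)) = \<Psi> i ((G ^^ i) w)"
proof -
  have "\<Psi> j ((G ^^ j) w) = 0" if "j \<noteq> i" for j
  proof (rule ccontr)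
    assume "\<Psi> j ((G ^^ j) w) \<noteq> 0"
    then have "(G ^^ j) w \<in> {c..<F c}" using \<Psi>_nonzeroD by fastforce
    then show False using disjoint_iterates[OF assms(1,2)] that by blast
  qed
  then have "(\<Sum>j\<in>A. \<Psi> j ((G ^^ j) w)) = (\<Sum>j\<in>{i}. \<Psi> j ((G ^^ j) w))"
    using assms by (intro sum.mono_neutral_right) auto
  then show ?thesis by simp
qed

text \<open>At each point at most one summand is nonzero, so a tail of the sum is no larger than a
  single value of some \<Psi> i, and these are small uniformly in the point.\<close>

lemma uniformly_Cauchy_bump_sum: "uniformly_Cauchy_on UNIV bump_sum"
proof (rule uniformly_Cauchy_onI')
  fix e :: real assume "0 < e"
  then obtain N where N: "\<And>i z. N \<le> i \<Longrightarrow> \<Psi> i z < e" using \<Psi>_small by blast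
  have "dist (bump_sum m x) (bump_sum n x) < e" if "N \<le> m" "m < n" for m n x
  proof -
    define w where "w = clamp x"
    have w: "w \<in> {a..b}" using clamp_in by (simp add: w_def)
    have "bump_sum n x = bump_sum m x + (\<Sum>i\<in>{m..<n}. \<Psi> i ((G ^^ i) w))"
      unfolding bump_sum_def w_def using that by (simp add: sum.atLeastLessThan_concat lessThan_atLeast0)
    moreover have "\<bar>\<Sum>i\<in>{m..<n}. \<Psi> i ((G ^^ i) w)\<bar> < e"
    proof (cases "\<exists>i\<in>{m..<n}. (G ^^ i) w \<in> {c..<F c}")
      case True
      then obtain i where i: "i \<in> {m..<n}" "(G ^^ i) w \<in> {c..<F c}" by blast
      then show ?thesis using sum_\<Psi>_single[OF w i(2,1)] N[of i] that \<Psi>_nonneg[of i] by auto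
    next
      case False
      then have "(\<Sum>i\<in>{m..<n}. \<Psi> i ((G ^^ i) w)) = 0" using \<Psi>_nonzeroD by (intro sum.neutral) fastforce
      then show ?thesis using \<open>0 < e\<close> by simp
    qed
    ultimately show ?thesis by (simp add: dist_real_def)
  qed
  then show "\<exists>M. \<forall>x\<in>UNIV. \<forall>m\<ge>M. \<forall>n>m. dist (bump_sum m x) (bump_sum n x) < e" by blast
qed

lemma exists_bump:
  obtains B where "continuous_on UNIV B" "\<And>x. 0 \<le> B x" "\<And>x. x \<notin> {a<..<b} \<Longrightarrow> B x = 0"
    "\<And>i z. z \<in> {c..<F c} \<Longrightarrow> B ((F ^^ i) z) = \<Psi> i z"
proof -
  obtain B where B: "uniform_limit UNIV bump_sum B sequentially"
    using uniformly_Cauchy_bump_sum Cauchy_uniformly_convergent uniformly_convergent_on_def by blast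
  have lim: "(\<lambda>n. bump_sum n x) \<longlonglongrightarrow> B x" for x
    using tendsto_uniform_limitI[OF B] by simp
  have "continuous_on UNIV B"
    by (rule uniform_limit_theorem[OF _ B]) (auto simp: continuous_on_bump_sum)
  moreover have "0 \<le> B x" for x
    by (rule LIMSEQ_le_const[OF lim]) (auto simp: bump_sum_nonneg)
  moreover have "B x = 0" if "x \<notin> {a<..<b}" for x
  proof -
    have "clamp x = a \<or> clamp x = b" using that ab by (auto simp: clamp_def)
    then have "(G ^^ i) (clamp x) = clamp x" for i
      by (induction i) (auto simp: G_a G_b)
    moreover have "\<Psi> i (clamp x) = 0" for i
      using \<open>clamp x = a \<or> clamp x = b\<close> \<Psi>_nonzeroD[of i "clamp x"] c_inner F_inner[OF c_inner] by fastforce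
    ultimately have "bump_sum n x = 0" for n by (simp add: bump_sum_def)
    then show ?thesis using LIMSEQ_unique[OF lim[of x], of 0] by simp
  qed
  moreover have "B ((F ^^ i) z) = \<Psi> i z" if z: "z \<in> {c..<F c}" for i z
  proof -
    have z': "z \<in> {a<..<b}" using z c_inner F_inner[OF c_inner] by auto
    then have zab: "z \<in> {a..b}" by auto
    define w where "w = (F ^^ i) z"
    have w: "w \<in> {a..b}" "clamp w = w" "(G ^^ i) w = z"
      using Fpow_in[OF zab, of i] GF_pow[OF zab] by (auto simp: w_def clamp_def)
    have "bump_sum n w = \<Psi> i z" if "i < n" for n
      using sum_\<Psi>_single[OF w(1), of i "{..<n}"] z that by (simp add: bump_sum_def w)
    then have "(\<lambda>n. bump_sum n w) \<longlonglongrightarrow> \<Psi> i z"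
      by (intro tendsto_eventually) (auto simp: eventually_sequentially intro!: exI[of _ "Suc i"])
    then show ?thesis using LIMSEQ_unique[OF lim[of w]] by (simp add: w_def)
  qed
  ultimately show thesis by (rule that)
qed

lemma sum_\<Psi>: "(\<Sum>i<n. \<Psi> i z) = sqrt (real n) * \<psi>1 z + ln (real n + 1) * \<psi>2 z"
  by (induction n) (auto simp: \<Psi>_def algebra_simps)

lemma same_orbit_inner:
  assumes "z = (F ^^ m) y \<or> y = (F ^^ m) z" "y' = (F ^^ n) y \<or> y = (F ^^ n) y'"
  shows "\<exists>p q. (F ^^ p) z = (F ^^ q) y'"
  using assms
proof (elim disjE)
  assume "z = (F ^^ m) y" "y' = (F ^^ n) y"
  then have "(F ^^ n) z = (F ^^ m) y'"
    by (metis add.commute comp_apply funpow_add)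
  then show ?thesis by blast
next
  assume "z = (F ^^ m) y" "y = (F ^^ n) y'"
  then have "(F ^^ 0) z = (F ^^ (m + n)) y'" by (simp add: funpow_add)
  then show ?thesis by blast
next
  assume "y = (F ^^ m) z" "y' = (F ^^ n) y"
  then have "(F ^^ (n + m)) z = (F ^^ 0) y'" by (simp add: funpow_add)
  then show ?thesis by blast
next
  assume "y = (F ^^ m) z" "y = (F ^^ n) y'"
  then show ?thesis by metis
qed

lemma domain_inner: "z \<in> {c..F c} \<Longrightarrow> z \<in> {a<..<b}"
  using c_inner F_inner[OF c_inner] by auto

lemma Fpow_ge: "y \<in> {a<..<b} \<Longrightarrow> y \<le> (F ^^ n) y"
proof (induction n)
  case (Suc n)
  then show ?case using moves[of "(F ^^ n) y"] Fpow_inner[of y n] by auto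
qed simp

text \<open>A point of the orbit of z other than z lies at or above F z, or at or below G z, so it
  is at least \<eta> away from z.\<close>

lemma orbit_gap:
  assumes "z \<in> {a<..<b}" "y \<in> {a<..<b}" "(F ^^ p) z = (F ^^ q) y"
    and "z - G z \<ge> \<eta>" "F z - z \<ge> \<eta>" "\<bar>z - y\<bar> < \<eta>"
  shows "z = y"
proof (cases "p \<le> q")
  case True
  define k where "k = q - p"
  have ab: "z \<in> {a..b}" "y \<in> {a..b}" using assms by auto
  have "(F ^^ p) z = (F ^^ p) ((F ^^ k) y)"
    using True assms(3) funpow_add[of p k F] by (simp add: k_def)
  then have z: "z = (F ^^ k) y" using GF_pow Fpow_in ab by metis
  show ?thesis
  proof (cases k)
    case (Suc j)
    have "y \<le> (F ^^ j) y" by (rule Fpow_ge[OF assms(2)])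
    moreover have "z = F ((F ^^ j) y)" using z Suc by simp
    then have "G z = (F ^^ j) y" using GF[OF Fpow_in[OF ab(2)]] by simp
    ultimately show ?thesis using assms by linarith
  qed (use z in simp)
next
  case False
  define k where "k = p - q - 1"
  have ab: "z \<in> {a..b}" "y \<in> {a..b}" using assms by auto
  have p: "p = q + Suc k" using False by (simp add: k_def)
  have "(F ^^ q) ((F ^^ Suc k) z) = (F ^^ q) y"
    using assms(3) unfolding p funpow_add by simp
  then have y: "y = (F ^^ Suc k) z" using GF_pow Fpow_in ab by metis
  have "z \<le> (F ^^ k) z" by (rule Fpow_ge[OF assms(1)])
  then have "F z \<le> y"
    using Fpow_le[of z "(F ^^ k) z" 1] Fpow_in[OF ab(1), of k] ab y by simp
  then show ?thesis using assms by linarith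
qed

text \<open>As z \<le> w \<le> F z, the orbits interleave, and comparison with a telescoping sum
  shows that the sums of the identity differ by at most b - a. The rest of the drift combines sqrt n
  and ln (n + 1), with the differences of \<psi>1 and \<psi>2 as coefficients, which must
  vanish.\<close>

lemma domain_determined_by_drift:
  assumes B: "\<And>i z. z \<in> {c..<F c} \<Longrightarrow> B ((F ^^ i) z) = \<Psi> i z"
    and z: "z \<in> {c..<F c}" and w: "w \<in> {c..<F c}" and "z \<le> w"
    and drift: "bounded_drift F (\<lambda>x. B x - x) z w"
  shows "z = w"
proof -
  have ab: "z \<in> {a..b}" "w \<in> {a..b}" using domain_inner[of z] domain_inner[of w] z w by auto
  obtain K where K: "\<And>n. \<bar>\<Sum>i<n. (B ((F ^^ i) z) - (F ^^ i) z) - (B ((F ^^ i) w) - (F ^^ i) w)\<bar> \<le> K"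
    using drift unfolding bounded_drift_def by blast
  have wF: "w \<le> F z"
    using w z Fpow_le[of c z 1] c_inner ab by auto
  have lo: "0 \<le> (\<Sum>i<n. (F ^^ i) w - (F ^^ i) z)" for n
    using Fpow_le[OF ab \<open>z \<le> w\<close>] by (intro sum_nonneg) simp
  have hi: "(\<Sum>i<n. (F ^^ i) w - (F ^^ i) z) \<le> b - a" for n
  proof -
    have "(F ^^ i) w \<le> (F ^^ Suc i) z" for i
      using Fpow_le[OF ab(2) F_in[OF ab(1)] wF, of i] by (simp add: funpow_swap1)
    then have "(\<Sum>i<n. (F ^^ i) w - (F ^^ i) z) \<le> (\<Sum>i<n. (F ^^ Suc i) z - (F ^^ i) z)"
      by (intro sum_mono) simp
    also have "\<dots> = (F ^^ n) z - z"
      using sum_lessThan_telescope[of "\<lambda>i. (F ^^ i) z" n] by simp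
    also have "\<dots> \<le> b - a"
      using Fpow_in[OF ab(1), of n] ab(1) by auto
    finally show ?thesis .
  qed
  have "\<bar>sqrt (real n) * (\<psi>1 z - \<psi>1 w) + ln (real n + 1) * (\<psi>2 z - \<psi>2 w)\<bar> \<le> K + (b - a)" for n
  proof -
    have "sqrt (real n) * (\<psi>1 z - \<psi>1 w) + ln (real n + 1) * (\<psi>2 z - \<psi>2 w) =
        (\<Sum>i<n. \<Psi> i z) - (\<Sum>i<n. \<Psi> i w)"
      by (simp add: sum_\<Psi> algebra_simps)
    also have "\<dots> = (\<Sum>i<n. (B ((F ^^ i) z) - (F ^^ i) z) - (B ((F ^^ i) w) - (F ^^ i) w)) -
        (\<Sum>i<n. (F ^^ i) w - (F ^^ i) z)"
      by (simp only: B[OF z] B[OF w] sum_subtractf)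
    finally show ?thesis using K[of n] lo[of n] hi[of n] by linarith
  qed
  from sqrt_ln_combination_bounded[OF this]
  have eq: "\<psi>1 z = \<psi>1 w" "\<psi>2 z = \<psi>2 w" by auto
  show ?thesis
  proof (cases "\<psi>1 z = 0")
    case True
    then have "z = c" "w = c" using eq z w \<psi>1_eq_0_iff[of z] \<psi>1_eq_0_iff[of w] by auto
    then show ?thesis by simp
  next
    case False
    then show ?thesis using eq by (simp add: \<psi>2_def)
  qed
qed

text \<open>Both points are moved along their orbits into the fundamental domain at the cost of a
  bounded drift; there they coincide, so x and y lie on one orbit. Closeness at the moment when x is
  in the domain then gives equality.\<close>

lemma exists_separating_bump:
  obtains B \<eta> where "continuous_on UNIV B" "\<And>x. 0 \<le> B x" "\<And>x. x \<notin> {a<..<b} \<Longrightarrow> B x = 0" "0 < \<eta>"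
    "\<And>x y. x \<in> {a<..<b} \<Longrightarrow> y \<in> {a<..<b} \<Longrightarrow> (\<And>n. \<bar>(F ^^ n) x - (F ^^ n) y\<bar> < \<eta>) \<Longrightarrow>
      (\<And>n. \<bar>(G ^^ n) x - (G ^^ n) y\<bar> < \<eta>) \<Longrightarrow> bounded_drift F (\<lambda>x. B x - x) x y \<Longrightarrow> x = y"
proof -
  obtain B where B: "continuous_on UNIV B" "\<And>x. 0 \<le> B x" "\<And>x. x \<notin> {a<..<b} \<Longrightarrow> B x = 0"
    "\<And>i z. z \<in> {c..<F c} \<Longrightarrow> B ((F ^^ i) z) = \<Psi> i z"
    using exists_bump by metis
  define V where "V = (\<lambda>x. B x - x)"
  have "bounded (V ` {a..b})"
    unfolding V_def
    by (intro compact_imp_bounded compact_continuous_image continuous_intros continuous_on_subset[OF B(1)]) auto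
  then obtain K where "\<And>x. x \<in> {a..b} \<Longrightarrow> \<bar>V x\<bar> \<le> K"
    by (auto simp: bounded_iff simp del: atLeastAtMost_iff)
  then have drift_pow: "bounded_drift F V x ((F ^^ n) x)" if "x \<in> {a..b}" for x n
    using Fpow_in[OF that] by (intro bounded_drift_funpow[of _ _ _ K]) auto
  have rep: "\<exists>z n. z \<in> {c..<F c} \<and> bounded_drift F V x z \<and> (z = (F ^^ n) x \<or> z = (G ^^ n) x)"
    if x: "x \<in> {a<..<b}" for x
  proof -
    obtain z n where z: "z \<in> {c..<F c}" "z = (F ^^ n) x \<or> z = (G ^^ n) x"
      using fundamental_domain[OF x] by blast
    have ab: "x \<in> {a..b}" "z \<in> {a..b}" using x domain_inner[of z] z(1) by auto
    have "bounded_drift F V x z"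
    proof (cases "z = (F ^^ n) x")
      case False
      then have "x = (F ^^ n) z" using z(2) FG_pow[OF ab(1)] by simp
      then show ?thesis using drift_pow[OF ab(2), of n] bounded_drift_sym by simp
    qed (use drift_pow ab in simp)
    then show ?thesis using z by blast
  qed
  \<comment> \<open>The least displacement by \<open>F\<close> and \<open>G\<close> over the closed
    fundamental domain becomes \<eta>; it is attained, hence positive.\<close>
  have "\<exists>w\<in>{c..F c}. \<forall>z\<in>{c..F c}. min (F w - w) (w - G w) \<le> min (F z - z) (z - G z)"
    using c_less domain_inner
    by (intro continuous_attains_inf continuous_intros continuous_on_subset[OF cont_F]
        continuous_on_subset[OF cont_G]) force+
  then obtain w0 where w0: "w0 \<in> {c..F c}"
      "\<And>z. z \<in> {c..F c} \<Longrightarrow> min (F w0 - w0) (w0 - G w0) \<le> min (F z - z) (z - G z)"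
    by blast
  define \<eta> where "\<eta> = min (F w0 - w0) (w0 - G w0)"
  have "0 < \<eta>"
    using domain_inner[OF w0(1)] moves G_moves by (auto simp: \<eta>_def)
  have "x = y" if x: "x \<in> {a<..<b}" and y: "y \<in> {a<..<b}"
    and cF: "\<And>n. \<bar>(F ^^ n) x - (F ^^ n) y\<bar> < \<eta>" and cG: "\<And>n. \<bar>(G ^^ n) x - (G ^^ n) y\<bar> < \<eta>"
    and drift: "bounded_drift F V x y" for x y
  proof -
    obtain z n where z: "z \<in> {c..<F c}" "bounded_drift F V x z" "z = (F ^^ n) x \<or> z = (G ^^ n) x"
      using rep[OF x] by blast
    obtain w m where w: "w \<in> {c..<F c}" "bounded_drift F V y w" "w = (F ^^ m) y \<or> w = (G ^^ m) y"
      using rep[OF y] by blast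
    have zw: "bounded_drift F V z w"
      using z(2) w(2) drift bounded_drift_sym bounded_drift_trans by metis
    have "z = w"
    proof (cases "z \<le> w")
      case True
      show ?thesis
        by (rule domain_determined_by_drift[OF B(4) z(1) w(1) True zw[unfolded V_def]])
    next
      case False
      then have "w = z"
        using domain_determined_by_drift[OF B(4) w(1) z(1) _ bounded_drift_sym[OF zw, unfolded V_def]] by simp
      then show ?thesis by simp
    qed
    have ab: "x \<in> {a..b}" "y \<in> {a..b}" using x y by auto
    have zy: "z = (F ^^ m) y \<or> y = (F ^^ m) z"
      using w(3) \<open>z = w\<close> FG_pow[OF ab(2)] by metis
    have zin: "z \<in> {a<..<b}" using domain_inner z(1) by auto
    have \<eta>z: "z - G z \<ge> \<eta>" "F z - z \<ge> \<eta>" using w0(2)[of z] z(1) by (auto simp: \<eta>_def)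
    from z(3) show ?thesis
    proof
      assume zx: "z = (F ^^ n) x"
      obtain p q where "(F ^^ p) z = (F ^^ q) ((F ^^ n) y)"
        using same_orbit_inner[OF zy] by blast
      then have "z = (F ^^ n) y"
        using orbit_gap[OF zin Fpow_inner[OF y] _ \<eta>z] cF[of n] zx by blast
      then show ?thesis using zx GF_pow ab by metis
    next
      assume zx: "z = (G ^^ n) x"
      have "(G ^^ n) y = (F ^^ n) y \<or> y = (F ^^ n) ((G ^^ n) y)" using FG_pow[OF ab(2)] by simp
      then obtain p q where "(F ^^ p) z = (F ^^ q) ((G ^^ n) y)"
        using same_orbit_inner[OF zy] by blast
      then have "z = (G ^^ n) y"
        using orbit_gap[OF zin Gpow_inner[OF y] _ \<eta>z] cG[of n] zx by blast
      then show ?thesis using zx FG_pow ab by metis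
    qed
  qed
  then show thesis using that[OF B(1-3) \<open>0 < \<eta>\<close>] by (simp add: V_def)
qed

end

section \<open>Fixed points, gaps and a separating roof for an increasing map\<close>

context interval_homeo
begin

definition P where "P = {x \<in> {a..b}. F x = x}"

definition gaps where "gaps = {(p, q). p \<in> P \<and> q \<in> P \<and> p < q \<and> {p<..<q} \<inter> P = {}}"

lemma a_in_P: "a \<in> P" and b_in_P: "b \<in> P"
  using F_a F_b a_le_b by (auto simp: P_def)

lemma compact_P: "compact P"
proof -
  have "closedin (top_of_set {a..b}) ({a..b} \<inter> (\<lambda>x. F x - x) -` {0})"
    by (intro continuous_closedin_preimage continuous_intros cont_F)
  moreover have "{a..b} \<inter> (\<lambda>x. F x - x) -` {0} = P" by (auto simp: P_def)
  ultimately show ?thesis using closedin_compact compact_Icc by metis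
qed

lemma in_gap:
  assumes "x \<in> {a..b}" "F x \<noteq> x"
  obtains p q where "(p, q) \<in> gaps" "x \<in> {p<..<q}"
proof -
  have x: "x \<notin> P" using assms by (simp add: P_def)
  obtain p where p: "p \<in> P \<inter> {a..x}" "\<And>t. t \<in> P \<inter> {a..x} \<Longrightarrow> t \<le> p"
    using compact_attains_sup[of "P \<inter> {a..x}"] compact_Int[OF compact_P compact_Icc] a_in_P assms
    by (metis IntI atLeastAtMost_iff empty_iff order_refl)
  obtain q where q: "q \<in> P \<inter> {x..b}" "\<And>t. t \<in> P \<inter> {x..b} \<Longrightarrow> q \<le> t"
    using compact_attains_inf[of "P \<inter> {x..b}"] compact_Int[OF compact_P compact_Icc] b_in_P assms
    by (metis IntI atLeastAtMost_iff empty_iff order_refl)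
  have "p \<noteq> x" "q \<noteq> x" using p q x by auto
  then have less: "p < x" "x < q" using p q by auto
  moreover have "{p<..<q} \<inter> P = {}"
  proof (rule ccontr)
    assume "{p<..<q} \<inter> P \<noteq> {}"
    then obtain t where t: "t \<in> P" "p < t" "t < q" by auto
    then have "t \<in> {a..b}" by (simp add: P_def)
    then show False using p(2)[of t] q(2)[of t] t by (cases "t \<le> x") auto
  qed
  ultimately show thesis using that[of p q] p q by (auto simp: gaps_def)
qed

lemma gap_unique:
  assumes "(p, q) \<in> gaps" "(p', q') \<in> gaps" "x \<in> {p<..<q}" "x \<in> {p'<..<q'}"
  shows "(p, q) = (p', q')"
proof -
  have "p \<notin> {p'<..<q'}" "p' \<notin> {p<..<q}" "q \<notin> {p'<..<q'}" "q' \<notin> {p<..<q}"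
    using assms(1,2) by (auto simp: gaps_def)
  then show ?thesis using assms(3,4) by auto
qed

text \<open>The left end of a gap is the supremum of its component of \<open>P\<close> and the right
  end the infimum of its own, so a gap is determined by a pair of components.\<close>

lemma finite_gaps:
  assumes "finite (components P)"
  shows "finite gaps"
proof -
  have "gaps \<subseteq> Sup ` components P \<times> Inf ` components P"
  proof clarify
    fix p q assume pq: "(p, q) \<in> gaps"
    then have "p \<in> P" "q \<in> P" "p < q" and gap: "{p<..<q} \<inter> P = {}" by (auto simp: gaps_def)
    have sub: "connected_component_set P t \<subseteq> P" for t by (rule connected_component_subset)
    have Icc: "{s..t} \<subseteq> P" if "s \<in> connected_component_set P r" "t \<in> connected_component_set P r" for r s t
      using connected_contains_Icc[OF connected_connected_component that] sub by blast
    have "t \<le> p" if "t \<in> connected_component_set P p" for t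
    proof (rule ccontr)
      assume "\<not> t \<le> p"
      moreover have "{p..t} \<subseteq> P" using Icc[of p p t] that \<open>p \<in> P\<close> by (simp add: connected_component_refl)
      moreover obtain r where "p < r" "r < min t q" using dense[of p "min t q"] \<open>p < q\<close> \<open>\<not> t \<le> p\<close> by auto
      ultimately show False using gap by force
    qed
    then have "Sup (connected_component_set P p) = p"
      using \<open>p \<in> P\<close> by (intro cSup_eq_maximum) (auto simp: connected_component_refl)
    moreover have "q \<le> t" if "t \<in> connected_component_set P q" for t
    proof (rule ccontr)
      assume "\<not> q \<le> t"
      moreover have "{t..q} \<subseteq> P" using Icc[of t q q] that \<open>q \<in> P\<close> by (simp add: connected_component_refl)
      moreover obtain r where "max t p < r" "r < q" using dense[of "max t p" q] \<open>p < q\<close> \<open>\<not> q \<le> t\<close> by auto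
      ultimately show False using gap by force
    qed
    then have "Inf (connected_component_set P q) = q"
      using \<open>q \<in> P\<close> by (intro cInf_eq_minimum) (auto simp: connected_component_refl)
    ultimately show "p \<in> Sup ` components P \<and> q \<in> Inf ` components P"
      using \<open>p \<in> P\<close> \<open>q \<in> P\<close> by (metis componentsI imageI)
  qed
  then show ?thesis using assms finite_subset by blast
qed

text \<open>F x - x has no zero in a gap, hence one sign; if it is negative, the inverse moves
  points to the right.\<close>

lemma gap_drifting:
  assumes pq: "(p, q) \<in> gaps"
  shows "drifting_interval p q F G \<or> drifting_interval p q G F"
proof -
  have "p \<in> P" "q \<in> P" "p < q" and gap: "{p<..<q} \<inter> P = {}" using pq by (auto simp: gaps_def)
  then have in_ab: "p \<in> {a..b}" "q \<in> {a..b}" "F p = p" "F q = q" by (auto simp: P_def)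
  then have Gpq: "G p = p" "G q = q" using GF by metis+
  have sub: "{p..q} \<subseteq> {a..b}" using in_ab by auto
  have Fin: "F x \<in> {p..q}" if "x \<in> {p..q}" for x
    using that Fpow_le[of p x 1] Fpow_le[of x q 1] in_ab sub by auto
  have Gin: "G x \<in> {p..q}" if "x \<in> {p..q}" for x
  proof -
    have "x \<in> {a..b}" using that sub by blast
    then show ?thesis using that G_less[of x p] G_less[of q x] Gpq in_ab by auto
  qed
  have "interval_homeo p q F G"
  proof
    show "p \<le> q" using \<open>p < q\<close> by simp
    show "homeomorphism {p..q} {p..q} F G"
      using Fin Gin GF FG sub
      by (intro homeomorphismI continuous_on_subset[OF cont_F] continuous_on_subset[OF cont_G]) auto
    show "strict_mono_on {p..q} F"
      using mono_F sub by (auto simp: strict_mono_on_def)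
  qed
  then interpret pq: interval_homeo p q F G .
  have nz: "F x \<noteq> x" if "x \<in> {p<..<q}" for x
  proof
    assume "F x = x"
    moreover have "x \<in> {a..b}" using that in_ab by auto
    ultimately show False using gap that by (auto simp: P_def)
  qed
  have same: False if x: "x \<in> {p<..<q}" "x < F x" and y: "y \<in> {p<..<q}" "F y < y" for x y
  proof -
    have "connected ((\<lambda>x. F x - x) ` {p<..<q})"
      using sub by (intro connected_continuous_image continuous_intros continuous_on_subset[OF cont_F] connected_Ioo) auto
    then have "0 \<in> (\<lambda>x. F x - x) ` {p<..<q}"
      using connectedD_interval[of _ "F y - y" "F x - x" 0] x y by auto
    then show False using nz by auto
  qed
  show ?thesis
  proof (cases "\<exists>x\<in>{p<..<q}. x < F x")
    case True
    then have "x < F x" if "x \<in> {p<..<q}" for x using same nz[OF that] that by force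
    then have "drifting_interval p q F G"
      using \<open>p < q\<close> pq.interval_homeo_axioms by (auto simp: drifting_interval_def drifting_interval_axioms_def)
    then show ?thesis ..
  next
    case False
    have "x < G x" if x: "x \<in> {p<..<q}" for x
    proof -
      have "G x \<in> {p<..<q}" using pq.G_inner x by blast
      then show ?thesis using False nz[of "G x"] pq.FG[of x] x by force
    qed
    then have "drifting_interval p q G F"
      using \<open>p < q\<close> pq.swap by (auto simp: drifting_interval_def drifting_interval_axioms_def)
    then show ?thesis ..
  qed
qed

text \<open>The bump is built along \<open>F\<close> or along \<open>G\<close>, according to the
  direction of motion in the gap; mentioning the drift along both maps covers the two cases.\<close>

lemma gap_separating_bump:
  assumes pq: "(p, q) \<in> gaps"
  shows "\<exists>B \<eta>. continuous_on UNIV B \<and> (\<forall>x. 0 \<le> B x) \<and> (\<forall>x. x \<notin> {p<..<q} \<longrightarrow> B x = 0) \<and> 0 < \<eta> \<and>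
    (\<forall>x\<in>{p<..<q}. \<forall>y\<in>{p<..<q}. (\<forall>n. \<bar>(F ^^ n) x - (F ^^ n) y\<bar> < \<eta>) \<longrightarrow>
      (\<forall>n. \<bar>(G ^^ n) x - (G ^^ n) y\<bar> < \<eta>) \<longrightarrow> bounded_drift F (\<lambda>x. B x - x) x y \<longrightarrow>
      bounded_drift G (\<lambda>x. B x - x) x y \<longrightarrow> x = y)"
  using gap_drifting[OF pq]
proof
  assume "drifting_interval p q F G"
  then interpret pq: drifting_interval p q F G .
  show ?thesis
  proof (rule pq.exists_separating_bump)
    fix B \<eta>
    assume A: "continuous_on UNIV B" "\<And>x. 0 \<le> B x" "\<And>x. x \<notin> {p<..<q} \<Longrightarrow> B x = 0" "0 < \<eta>"
      and B: "\<And>x y. x \<in> {p<..<q} \<Longrightarrow> y \<in> {p<..<q} \<Longrightarrow> (\<And>n. \<bar>(F ^^ n) x - (F ^^ n) y\<bar> < \<eta>) \<Longrightarrow>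
        (\<And>n. \<bar>(G ^^ n) x - (G ^^ n) y\<bar> < \<eta>) \<Longrightarrow> bounded_drift F (\<lambda>x. B x - x) x y \<Longrightarrow> x = y"
    have "x = y" if "x \<in> {p<..<q}" "y \<in> {p<..<q}" "\<forall>n. \<bar>(F ^^ n) x - (F ^^ n) y\<bar> < \<eta>"
      "\<forall>n. \<bar>(G ^^ n) x - (G ^^ n) y\<bar> < \<eta>" "bounded_drift F (\<lambda>x. B x - x) x y" for x y
      using B[OF that(1,2) _ _ that(5)] that(3,4) by blast
    then show ?thesis
      using A by (intro exI[of _ B] exI[of _ \<eta>]) blast
  qed
next
  assume "drifting_interval p q G F"
  then interpret pq: drifting_interval p q G F .
  show ?thesis
  proof (rule pq.exists_separating_bump)
    fix B \<eta>
    assume A: "continuous_on UNIV B" "\<And>x. 0 \<le> B x" "\<And>x. x \<notin> {p<..<q} \<Longrightarrow> B x = 0" "0 < \<eta>"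
      and B: "\<And>x y. x \<in> {p<..<q} \<Longrightarrow> y \<in> {p<..<q} \<Longrightarrow> (\<And>n. \<bar>(G ^^ n) x - (G ^^ n) y\<bar> < \<eta>) \<Longrightarrow>
        (\<And>n. \<bar>(F ^^ n) x - (F ^^ n) y\<bar> < \<eta>) \<Longrightarrow> bounded_drift G (\<lambda>x. B x - x) x y \<Longrightarrow> x = y"
    have "x = y" if "x \<in> {p<..<q}" "y \<in> {p<..<q}" "\<forall>n. \<bar>(G ^^ n) x - (G ^^ n) y\<bar> < \<eta>"
      "\<forall>n. \<bar>(F ^^ n) x - (F ^^ n) y\<bar> < \<eta>" "bounded_drift G (\<lambda>x. B x - x) x y" for x y
      using B[OF that(1,2) _ _ that(5)] that(3,4) by blast
    then show ?thesis
      using A by (intro exI[of _ B] exI[of _ \<eta>]) blast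
  qed
qed

text \<open>The order of \<alpha> and \<omega> is the direction of motion, and min and max name the
  gap in either case. The limits coincide only for fixed points.\<close>

lemma orbit_limits:
  assumes "x \<in> {a..b}"
  obtains \<alpha> \<omega> where "(\<lambda>n. (F ^^ n) x) \<longlonglongrightarrow> \<omega>" "(\<lambda>n. (G ^^ n) x) \<longlonglongrightarrow> \<alpha>" "\<alpha> \<in> P" "\<omega> \<in> P"
    "(\<alpha> = x \<and> \<omega> = x) \<or> (min \<alpha> \<omega>, max \<alpha> \<omega>) \<in> gaps \<and> x \<in> {min \<alpha> \<omega><..<max \<alpha> \<omega>} \<and>
      (\<forall>n. (F ^^ n) x \<in> {min \<alpha> \<omega><..<max \<alpha> \<omega>} \<and> (G ^^ n) x \<in> {min \<alpha> \<omega><..<max \<alpha> \<omega>})"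
proof (cases "F x = x")
  case True
  then have "G x = x" using GF assms by metis
  have "(F ^^ n) x = x" "(G ^^ n) x = x" for n
    using True \<open>G x = x\<close> by (induction n) auto
  then show thesis using that[of x x] True assms by (auto simp: P_def)
next
  case False
  then obtain p q where pq: "(p, q) \<in> gaps" "x \<in> {p<..<q}" using in_gap[OF assms] by metis
  then have PQ: "p \<in> P" "q \<in> P" "p < q" by (auto simp: gaps_def)
  from gap_drifting[OF pq(1)] show thesis
  proof
    assume "drifting_interval p q F G"
    then interpret pq: drifting_interval p q F G .
    show thesis
      using that[OF pq.Fpow_tendsto[OF pq(2)] pq.Gpow_tendsto[OF pq(2)] PQ(1,2)]
        pq pq.Fpow_inner[OF pq(2)] pq.Gpow_inner[OF pq(2)] PQ(3) by (auto simp: min_def max_def)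
  next
    assume "drifting_interval p q G F"
    then interpret pq: drifting_interval p q G F .
    show thesis
      using that[OF pq.Gpow_tendsto[OF pq(2)] pq.Fpow_tendsto[OF pq(2)] PQ(2,1)]
        pq pq.Fpow_inner[OF pq(2)] pq.Gpow_inner[OF pq(2)] PQ(3) by (auto simp: min_def max_def)
  qed
qed

text \<open>\<open>V\<close> is injective on the fixed points, so bounded drift along both maps
  forces equal limits. The points are then equal fixed points or lie in one gap, where the bump
  decides. The value 0 at \<open>b\<close> permits an extension of the roof by 0 beyond
  \<open>b\<close>.\<close>

theorem exists_separating_roof:
  assumes fin: "finite gaps"
  obtains V \<eta> where "continuous_on {a..b} V" "\<And>x. x \<in> {a..b} \<Longrightarrow> 0 \<le> V x" "V b = 0" "0 < \<eta>"
    "\<And>x y. x \<in> {a..b} \<Longrightarrow> y \<in> {a..b} \<Longrightarrow> (\<And>n. \<bar>(F ^^ n) x - (F ^^ n) y\<bar> < \<eta>) \<Longrightarrow>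
      (\<And>n. \<bar>(G ^^ n) x - (G ^^ n) y\<bar> < \<eta>) \<Longrightarrow> bounded_drift F V x y \<Longrightarrow> bounded_drift G V x y \<Longrightarrow> x = y"
proof -
  define sep where "sep = (\<lambda>g B \<eta>. continuous_on UNIV B \<and> (\<forall>x. 0 \<le> B x) \<and> (\<forall>x. x \<notin> {fst g<..<snd g} \<longrightarrow> B x = 0) \<and> 0 < \<eta> \<and>
    (\<forall>x\<in>{fst g<..<snd g}. \<forall>y\<in>{fst g<..<snd g}. (\<forall>n. \<bar>(F ^^ n) x - (F ^^ n) y\<bar> < \<eta>) \<longrightarrow>
      (\<forall>n. \<bar>(G ^^ n) x - (G ^^ n) y\<bar> < \<eta>) \<longrightarrow> bounded_drift F (\<lambda>x. B x - x) x y \<longrightarrow>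
      bounded_drift G (\<lambda>x. B x - x) x y \<longrightarrow> x = y))"
  have "\<forall>g\<in>gaps. \<exists>B \<eta>. sep g B \<eta>"
    using gap_separating_bump unfolding sep_def by auto
  then obtain B e where Be: "\<And>g. g \<in> gaps \<Longrightarrow> sep g (B g) (e g)" by metis
  define V where "V = (\<lambda>x. (b - x) + (\<Sum>g\<in>gaps. B g x))"
  define \<eta> where "\<eta> = Min (insert 1 (e ` gaps))"
  have \<eta>: "0 < \<eta>" "\<And>g. g \<in> gaps \<Longrightarrow> \<eta> \<le> e g"
    using fin Be by (auto simp: \<eta>_def sep_def)
  have V_gap: "V x = b - x + B g x" if "g \<in> gaps" "x \<in> {fst g<..<snd g}" for g x
  proof -
    have "B g' x = 0" if "g' \<in> gaps" "g' \<noteq> g" for g'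
      using Be[OF that(1)] gap_unique[of "fst g'" "snd g'" "fst g" "snd g" x] that \<open>g \<in> gaps\<close> \<open>x \<in> {fst g<..<snd g}\<close>
      by (auto simp: sep_def)
    then have "(\<Sum>g\<in>gaps. B g x) = (\<Sum>g\<in>{g}. B g x)"
      using fin that by (intro sum.mono_neutral_right) auto
    then show ?thesis by (simp add: V_def)
  qed
  have V_P: "V x = b - x" if "x \<in> P" for x
  proof -
    have "B g x = 0" if "g \<in> gaps" for g
    proof -
      have "x \<notin> {fst g<..<snd g}" using that \<open>x \<in> P\<close> by (auto simp: gaps_def)
      then show ?thesis using Be[OF that] unfolding sep_def by blast
    qed
    then show ?thesis by (simp add: V_def)
  qed
  have cont_V: "continuous_on UNIV V"
    unfolding V_def using Be by (intro continuous_intros) (auto simp: sep_def)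
  have limit: "p = q" if "bounded_drift k V x y" "(\<lambda>n. (k ^^ n) x) \<longlonglongrightarrow> p" "(\<lambda>n. (k ^^ n) y) \<longlonglongrightarrow> q" "p \<in> P" "q \<in> P" for k x y p q
  proof -
    have "(\<lambda>n. V ((k ^^ n) x)) \<longlonglongrightarrow> V p" "(\<lambda>n. V ((k ^^ n) y)) \<longlonglongrightarrow> V q"
      using that(2,3) cont_V by (auto intro!: continuous_on_tendsto_compose[OF cont_V])
    from bounded_drift_imp_eq_limits[OF that(1) this] show ?thesis using V_P that(4,5) by simp
  qed
  have "x = y"
    if x: "x \<in> {a..b}" and y: "y \<in> {a..b}" and cF: "\<And>n. \<bar>(F ^^ n) x - (F ^^ n) y\<bar> < \<eta>"
      and cG: "\<And>n. \<bar>(G ^^ n) x - (G ^^ n) y\<bar> < \<eta>"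
      and dF: "bounded_drift F V x y" and dG: "bounded_drift G V x y" for x y
  proof -
    obtain \<alpha> \<omega> where A: "(\<lambda>n. (F ^^ n) x) \<longlonglongrightarrow> \<omega>" "(\<lambda>n. (G ^^ n) x) \<longlonglongrightarrow> \<alpha>" "\<alpha> \<in> P" "\<omega> \<in> P"
      "(\<alpha> = x \<and> \<omega> = x) \<or> (min \<alpha> \<omega>, max \<alpha> \<omega>) \<in> gaps \<and> x \<in> {min \<alpha> \<omega><..<max \<alpha> \<omega>} \<and>
        (\<forall>n. (F ^^ n) x \<in> {min \<alpha> \<omega><..<max \<alpha> \<omega>} \<and> (G ^^ n) x \<in> {min \<alpha> \<omega><..<max \<alpha> \<omega>})"
      using orbit_limits[OF x] by blast
    obtain \<alpha>' \<omega>' where A': "(\<lambda>n. (F ^^ n) y) \<longlonglongrightarrow> \<omega>'" "(\<lambda>n. (G ^^ n) y) \<longlonglongrightarrow> \<alpha>'" "\<alpha>' \<in> P" "\<omega>' \<in> P"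
      "(\<alpha>' = y \<and> \<omega>' = y) \<or> (min \<alpha>' \<omega>', max \<alpha>' \<omega>') \<in> gaps \<and> y \<in> {min \<alpha>' \<omega>'<..<max \<alpha>' \<omega>'} \<and>
        (\<forall>n. (F ^^ n) y \<in> {min \<alpha>' \<omega>'<..<max \<alpha>' \<omega>'} \<and> (G ^^ n) y \<in> {min \<alpha>' \<omega>'<..<max \<alpha>' \<omega>'})"
      using orbit_limits[OF y] by blast
    have eq: "\<alpha>' = \<alpha>" "\<omega>' = \<omega>"
      using limit[OF dF A(1) A'(1) A(4) A'(4)] limit[OF dG A(2) A'(2) A(3) A'(3)] by auto
    show ?thesis
    proof (cases "\<alpha> = \<omega>")
      case True
      then show ?thesis using A(5) A'(5) eq by auto
    next
      case False
      define g where "g = (min \<alpha> \<omega>, max \<alpha> \<omega>)"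
      have g: "g \<in> gaps" "x \<in> {fst g<..<snd g}" "y \<in> {fst g<..<snd g}"
        "\<And>n. (F ^^ n) x \<in> {fst g<..<snd g}" "\<And>n. (G ^^ n) x \<in> {fst g<..<snd g}"
        "\<And>n. (F ^^ n) y \<in> {fst g<..<snd g}" "\<And>n. (G ^^ n) y \<in> {fst g<..<snd g}"
        using A(5) A'(5) eq False unfolding g_def fst_conv snd_conv by blast+
      \<comment> \<open>The constant b cancels in the differences, and the other bumps vanish along
        both orbits.\<close>
      have "bounded_drift F (\<lambda>x. B g x - x) x y" "bounded_drift G (\<lambda>x. B g x - x) x y"
        using dF dG unfolding bounded_drift_def
        by (simp_all add: V_gap[OF g(1) g(4)] V_gap[OF g(1) g(5)] V_gap[OF g(1) g(6)] V_gap[OF g(1) g(7)] algebra_simps)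
      moreover have "\<bar>(F ^^ n) x - (F ^^ n) y\<bar> < e g" "\<bar>(G ^^ n) x - (G ^^ n) y\<bar> < e g" for n
        using cF[of n] cG[of n] \<eta>(2)[OF g(1)] by linarith+
      ultimately show ?thesis using Be[OF g(1)] g(2,3) by (simp add: sep_def)
    qed
  qed
  moreover have "0 \<le> V x" if "x \<in> {a..b}" for x
    using that Be unfolding V_def sep_def by (intro add_nonneg_nonneg sum_nonneg) auto
  moreover have "V b = 0" using V_P b_in_P by simp
  ultimately show thesis
    using that[of V \<eta>] \<eta>(1) continuous_on_subset[OF cont_V] by blast
qed

end

section \<open>Interval homeomorphisms of either orientation\<close>

context interval_homeo
begin

text \<open>An increasing map keeps moving x in the direction of the first step, so the orbit cannot
  come back.\<close>

lemma funpow_fixed_imp_fixed: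
  assumes x: "x \<in> {a..b}" and "(F ^^ n) x = x" "1 \<le> n"
  shows "F x = x"
proof (rule ccontr)
  assume "F x \<noteq> x"
  obtain m where n: "n = Suc m" using assms by (cases n) auto
  consider "x < F x" | "F x < x" using \<open>F x \<noteq> x\<close> by linarith
  then show False
  proof cases
    case 1
    have "x \<le> (F ^^ k) x" for k
    proof (induction k)
      case (Suc k)
      have "F x \<le> F ((F ^^ k) x)" using Fpow_le[OF x Fpow_in[OF x] Suc, of 1] by simp
      then show ?case using 1 by simp
    qed simp
    from Fpow_le[OF x Fpow_in[OF x] this, of 1 m] show False using 1 assms n by simp
  next
    case 2
    have "(F ^^ k) x \<le> x" for k
    proof (induction k)
      case (Suc k)
      have "F ((F ^^ k) x) \<le> F x" using Fpow_le[OF Fpow_in[OF x] x Suc, of 1] by simp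
      then show ?case using 2 by simp
    qed simp
    from Fpow_le[OF Fpow_in[OF x] x this, of 1 m] show False using 2 assms n by simp
  qed
qed

text \<open>Both limits of the orbit are fixed points within \<eta> of p, so they equal p; the ends
  of a gap are distinct, so x is in none.\<close>

lemma near_fixed_point_imp_eq:
  assumes x: "x \<in> {a..b}" and "\<eta> < r" and iso: "\<And>t. t \<in> P \<Longrightarrow> \<bar>t - p\<bar> < r \<Longrightarrow> t = p"
    and "\<And>n. \<bar>(F ^^ n) x - p\<bar> \<le> \<eta>" "\<And>n. \<bar>(G ^^ n) x - p\<bar> \<le> \<eta>"
  shows "x = p"
proof -
  obtain \<alpha> \<omega> where A: "(\<lambda>n. (F ^^ n) x) \<longlonglongrightarrow> \<omega>" "(\<lambda>n. (G ^^ n) x) \<longlonglongrightarrow> \<alpha>" "\<alpha> \<in> P" "\<omega> \<in> P"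
      "(\<alpha> = x \<and> \<omega> = x) \<or> (min \<alpha> \<omega>, max \<alpha> \<omega>) \<in> gaps \<and> x \<in> {min \<alpha> \<omega><..<max \<alpha> \<omega>} \<and>
        (\<forall>n. (F ^^ n) x \<in> {min \<alpha> \<omega><..<max \<alpha> \<omega>} \<and> (G ^^ n) x \<in> {min \<alpha> \<omega><..<max \<alpha> \<omega>})"
    using orbit_limits[OF x] by blast
  have "\<bar>\<omega> - p\<bar> \<le> \<eta>" "\<bar>\<alpha> - p\<bar> \<le> \<eta>"
    using assms(4,5) A(1,2)
    by (auto intro!: LIMSEQ_le_const2[OF tendsto_rabs[OF tendsto_diff[OF _ tendsto_const]]])
  then have "\<omega> = p" "\<alpha> = p" using iso A(3,4) \<open>\<eta> < r\<close> by auto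
  then show ?thesis using A(5) by auto
qed

end

lemma bounded_drift_image:
  assumes "bounded_drift F V x y"
  shows "bounded_drift F V (F x) (F y)"
proof -
  obtain K where K: "\<And>n. \<bar>\<Sum>i<n. V ((F ^^ i) x) - V ((F ^^ i) y)\<bar> \<le> K"
    using assms unfolding bounded_drift_def by blast
  have "\<bar>\<Sum>i<n. V ((F ^^ i) (F x)) - V ((F ^^ i) (F y))\<bar> \<le> K + \<bar>V x - V y\<bar>" for n
    using K[of "Suc n"] unfolding sum.lessThan_Suc_shift funpow_Suc_right o_def by simp
  then show ?thesis unfolding bounded_drift_def by blast
qed

lemma bounded_drift_preimage:
  assumes "bounded_drift F V (F x) (F y)"
  shows "bounded_drift F V x y"
proof -
  obtain K where K: "\<And>n. \<bar>\<Sum>i<n. V ((F ^^ i) (F x)) - V ((F ^^ i) (F y))\<bar> \<le> K"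
    using assms unfolding bounded_drift_def by blast
  have "\<bar>\<Sum>i<n. V ((F ^^ i) x) - V ((F ^^ i) y)\<bar> \<le> K + \<bar>V x - V y\<bar>" for n
  proof (cases n)
    case 0
    then show ?thesis using K[of 0] by simp
  next
    case (Suc m)
    then show ?thesis using K[of m] unfolding Suc sum.lessThan_Suc_shift funpow_Suc_right o_def by simp
  qed
  then show ?thesis unfolding bounded_drift_def by blast
qed

text \<open>Choosing a point in each component gives an infinite set with a limit point p. Two
  chosen points near p lie in different components, so the interval between them is not contained in
  \<open>S\<close>: infinitely many components produce arbitrarily small gaps.\<close>

lemma infinite_components_accumulate:
  fixes S :: "real set"
  assumes "compact S" "infinite (components S)"
  shows "\<exists>p\<in>S. \<forall>\<eta>>0. \<exists>s\<in>S. \<exists>t\<in>S. \<exists>x. s < x \<and> x < t \<and> x \<notin> S \<and> \<bar>s - p\<bar> < \<eta> \<and> \<bar>t - p\<bar> < \<eta>"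
proof -
  have "\<forall>C\<in>components S. \<exists>x. x \<in> C" using in_components_nonempty by blast
  then obtain k where k: "\<And>C. C \<in> components S \<Longrightarrow> k C \<in> C" by metis
  have inj: "inj_on k (components S)"
  proof (rule inj_onI)
    fix C C' assume "C \<in> components S" "C' \<in> components S" "k C = k C'"
    then show "C = C'" using k[of C] k[of C'] components_nonoverlap[of C S C'] by auto
  qed
  define A where "A = k ` components S"
  have "infinite A" using inj assms(2) by (simp add: A_def finite_image_iff)
  moreover have "A \<subseteq> S" using k in_components_subset by (fastforce simp: A_def)
  ultimately obtain p where p: "p \<in> S" "p islimpt A"
    using assms(1) unfolding compact_eq_Bolzano_Weierstrass by blast
  have "\<exists>s\<in>S. \<exists>t\<in>S. \<exists>x. s < x \<and> x < t \<and> x \<notin> S \<and> \<bar>s - p\<bar> < \<eta> \<and> \<bar>t - p\<bar> < \<eta>" if "0 < \<eta>" for \<eta>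
  proof -
    have inf: "infinite (A \<inter> ball p \<eta>)" using p(2) that by (simp add: islimpt_eq_infinite_ball)
    then obtain s where s: "s \<in> A \<inter> ball p \<eta>" using infinite_imp_nonempty by blast
    have "infinite (A \<inter> ball p \<eta> - {s})" using inf by simp
    then obtain t where t: "t \<in> A \<inter> ball p \<eta> - {s}" using infinite_imp_nonempty by blast
    have *: "\<exists>s\<in>S. \<exists>t\<in>S. \<exists>x. s < x \<and> x < t \<and> x \<notin> S \<and> \<bar>s - p\<bar> < \<eta> \<and> \<bar>t - p\<bar> < \<eta>"
      if st: "s \<in> A" "t \<in> A" "s < t" "s \<in> ball p \<eta>" "t \<in> ball p \<eta>" for s t
    proof -
      obtain C C' where C: "C \<in> components S" "s = k C" "C' \<in> components S" "t = k C'"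
        using st by (auto simp: A_def)
      have "\<not> {s..t} \<subseteq> S"
      proof
        assume "{s..t} \<subseteq> S"
        then have "{s..t} \<subseteq> C"
          using C k[OF C(1)] st(3) by (intro components_maximal[OF C(1)]) auto
        then have "t \<in> C" using st(3) by auto
        then have "C \<inter> C' \<noteq> {}" using k[OF C(3)] C(4) by blast
        then show False using C st(3) components_nonoverlap by blast
      qed
      then obtain x where x: "x \<in> {s..t}" "x \<notin> S" by blast
      moreover have "s \<in> S" "t \<in> S" using st \<open>A \<subseteq> S\<close> by auto
      moreover from calculation have "s < x" "x < t" by (auto simp: less_le)
      ultimately show ?thesis
        using st by (intro bexI[of _ s] bexI[of _ t] exI[of _ x]) (auto simp: dist_real_def abs_minus_commute)
    qed
    have "s \<noteq> t" using t by auto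
    then show ?thesis using *[of s t] *[of t s] s t by (cases "s < t") auto
  qed
  then show ?thesis using p(1) by blast
qed

text \<open>Both maps preserve connectedness, so a component of \<open>T\<close> is the image of the
  component of \<open>S\<close> around the corresponding point.\<close>

lemma finite_components_homeomorphism:
  assumes "homeomorphism S T h k"
  shows "finite (components S) \<Longrightarrow> finite (components T)"
proof -
  have hk: "h ` S = T" "k ` T = S" "continuous_on S h" "continuous_on T k" "\<And>y. y \<in> T \<Longrightarrow> h (k y) = y"
    using assms by (auto simp: homeomorphism_def)
  have "components T \<subseteq> (`) h ` components S"
  proof
    fix C assume "C \<in> components T"
    then obtain y where y: "y \<in> T" "C = connected_component_set T y" by (auto simp: components_def)
    have ky: "k y \<in> S" using hk y by auto
    define E where "E = connected_component_set S (k y)"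
    have CT: "C \<subseteq> T" and ES: "E \<subseteq> S" by (simp_all add: y E_def connected_component_subset)
    have "h ` E \<subseteq> C"
      unfolding y(2)
    proof (rule connected_component_maximal)
      show "connected (h ` E)"
        using hk ES by (intro connected_continuous_image continuous_on_subset[OF hk(3)]) (auto simp: E_def)
      show "h ` E \<subseteq> T" using hk(1) ES by auto
      show "y \<in> h ` E" using hk(5)[OF y(1)] ky by (auto simp: E_def image_iff intro!: bexI[of _ "k y"] connected_component_refl)
    qed
    moreover have "k ` C \<subseteq> E"
      unfolding E_def
    proof (rule connected_component_maximal)
      show "connected (k ` C)"
        using hk CT by (intro connected_continuous_image continuous_on_subset[OF hk(4)]) (auto simp: y)
      show "k ` C \<subseteq> S" using hk(2) CT by auto
      show "k y \<in> k ` C" using y by (auto intro!: imageI connected_component_refl)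
    qed
    then have "h ` k ` C \<subseteq> h ` E" by blast
    moreover have "h ` k ` C = C" using hk(5) CT by (force simp: image_image)
    ultimately have "C = h ` E" by blast
    then show "C \<in> (`) h ` components S" using ky by (auto simp: E_def components_def)
  qed
  then show "finite (components S) \<Longrightarrow> finite (components T)"
    using finite_surj by blast
qed

lemma sum_even_odd:
  fixes k :: "nat \<Rightarrow> 'a::comm_monoid_add"
  shows "(\<Sum>i<2 * n. k i) = (\<Sum>i<n. k (2 * i) + k (2 * i + 1))"
  by (induction n) (auto simp: algebra_simps)

lemma funpow_2_funpow: "((f ^^ 2) ^^ n) x = (f ^^ (2 * n)) x" for f :: "'a \<Rightarrow> 'a"
  by (simp only: funpow_mult)

text \<open>A continuous injection of an interval is strictly increasing or strictly decreasing; its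
  square is increasing in both cases.\<close>

lemma interval_homeo_square:
  fixes F G :: "real \<Rightarrow> real"
  assumes "a \<le> b" and FG: "homeomorphism {a..b} {a..b} F G"
  shows "interval_homeo a b (F ^^ 2) (G ^^ 2)"
proof
  have F: "continuous_on {a..b} F" "\<And>x. x \<in> {a..b} \<Longrightarrow> F x \<in> {a..b}" "\<And>x. x \<in> {a..b} \<Longrightarrow> G (F x) = x"
    using FG unfolding homeomorphism_def by blast+
  have "inj_on F {a..b}" using F(3) by (rule inj_on_inverseI)
  then have "strict_mono_on {a..b} F \<or> strict_antimono_on {a..b} F"
    using injective_eq_monotone_map[OF is_interval_cc F(1)] by blast
  then show "strict_mono_on {a..b} (F ^^ 2)"
    using F(2) unfolding monotone_on_def numeral_2_eq_2 by (auto simp del: atLeastAtMost_iff)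
  show "homeomorphism {a..b} {a..b} (F ^^ 2) (G ^^ 2)"
    using homeomorphism_compose[OF FG FG] by (simp add: numeral_2_eq_2)
qed fact

text \<open>If \<open>F\<close> reverses the orientation, the roof is constant on one side of its fixed point \<open>p\<close>, and on
  the other side it is the one constructed for the increasing map \<open>F ^^ 2\<close>. Two points on different
  sides of \<open>p\<close> that stay close to each other stay close to \<open>p\<close>, which is isolated in the set of
  periodic points.\<close>

lemma exists_separating_roof_unit_interval:
  fixes F G :: "real \<Rightarrow> real"
  defines "Q \<equiv> {x \<in> {0..1}. (F ^^ 2) x = x}"
  assumes FG: "homeomorphism {0..1} {0..1} F G"
    and fin: "finite (components Q)"
    and iso: "\<forall>p\<in>{0..1}. F p = p \<longrightarrow> (\<exists>r>0. \<forall>x\<in>Q. \<bar>x - p\<bar> < r \<longrightarrow> F x = x)"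
  shows "\<exists>V \<eta>. continuous_on {0..1} V \<and> (\<forall>x\<in>{0..1}. 0 \<le> V x) \<and> 0 < \<eta> \<and>
    (\<forall>x\<in>{0..1}. \<forall>y\<in>{0..1}. (\<forall>n. \<bar>(F ^^ n) x - (F ^^ n) y\<bar> < \<eta>) \<longrightarrow>
      (\<forall>n. \<bar>(G ^^ n) x - (G ^^ n) y\<bar> < \<eta>) \<longrightarrow> bounded_drift F V x y \<longrightarrow>
      bounded_drift G V x y \<longrightarrow> x = y)"
proof -
  have hom: "F x \<in> {0..1}" "G x \<in> {0..1}" "G (F x) = x" "F (G x) = x" if "x \<in> {0..1}" for x
    using FG that unfolding homeomorphism_def by blast+
  have cont: "continuous_on {0..1} F" "continuous_on {0..1} G"
    using FG by (auto simp: homeomorphism_def)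
  have "inj_on F {0..1}" using hom(3) by (rule inj_on_inverseI)
  then have "strict_mono_on {0..1} F \<or> strict_antimono_on {0..1} F"
    using injective_eq_monotone_map[OF is_interval_cc cont(1)] by blast
  then show ?thesis
  proof
    assume "strict_mono_on {0..1} F"
    then interpret interval_homeo 0 1 F G using FG by unfold_locales auto
    have "Q = P"
      unfolding Q_def P_def using funpow_fixed_imp_fixed[of _ 2] by (auto simp: numeral_2_eq_2)
    then have "finite gaps" using fin finite_gaps by simp
    then obtain V \<eta> where V: "continuous_on {0..1} V" "\<And>x. x \<in> {0..1} \<Longrightarrow> 0 \<le> V x" "V 1 = 0" "0 < \<eta>"
      "\<And>x y. x \<in> {0..1} \<Longrightarrow> y \<in> {0..1} \<Longrightarrow> (\<And>n. \<bar>(F ^^ n) x - (F ^^ n) y\<bar> < \<eta>) \<Longrightarrow>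
        (\<And>n. \<bar>(G ^^ n) x - (G ^^ n) y\<bar> < \<eta>) \<Longrightarrow> bounded_drift F V x y \<Longrightarrow> bounded_drift G V x y \<Longrightarrow> x = y"
      using exists_separating_roof by blast
    then show ?thesis by (intro exI[of _ V] exI[of _ \<eta>]) blast
  next
    assume anti: "strict_antimono_on {0..1} F"
    have F_less: "F x < F y \<longleftrightarrow> y < x" if "x \<in> {0..1}" "y \<in> {0..1}" for x y
      using anti that by (metis (no_types, lifting) linorder_neqE_linordered_idom monotone_onD not_less_iff_gr_or_eq)
    define F2 where "F2 = F ^^ 2"
    define G2 where "G2 = G ^^ 2"
    have F2: "F2 x = F (F x)" and G2: "G2 x = G (G x)" for x
      by (simp_all add: F2_def G2_def numeral_2_eq_2)
    have F2pow: "(F2 ^^ n) x = (F ^^ (2 * n)) x" and G2pow: "(G2 ^^ n) x = (G ^^ (2 * n)) x" for n x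
      by (simp_all add: F2_def G2_def funpow_2_funpow)
    interpret U: interval_homeo 0 1 F2 G2
      unfolding F2_def G2_def using interval_homeo_square[OF _ FG] by simp
    have QU: "Q = U.P" unfolding Q_def U.P_def by (simp add: F2_def)
    \<comment> \<open>The fixed point divides the interval into two halves that \<open>F\<close>
      exchanges.\<close>
    obtain p where p: "p \<in> {0..1}" "F p = p"
    proof -
      have "\<exists>x. 0 \<le> x \<and> x \<le> 1 \<and> F x - x = 0"
        using hom(1)[of 0] hom(1)[of 1] cont(1)
        by (intro IVT2') (auto intro!: continuous_intros)
      then show thesis using that by auto
    qed
    have Gp: "G p = p" using hom(3)[OF p(1)] p(2) by simp
    have G_less: "G x < G y \<longleftrightarrow> y < x" if "x \<in> {0..1}" "y \<in> {0..1}" for x y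
      using F_less[OF hom(2) hom(2), OF that(2,1)] hom(4) that by metis
    have F_side: "F x \<le> p \<longleftrightarrow> p \<le> x" "p \<le> F x \<longleftrightarrow> x \<le> p" if "x \<in> {0..1}" for x
      using F_less[OF that p(1)] F_less[OF p(1) that] p(2) by auto
    have G_side: "G x \<le> p \<longleftrightarrow> p \<le> x" "p \<le> G x \<longleftrightarrow> x \<le> p" if "x \<in> {0..1}" for x
      using G_less[OF that p(1)] G_less[OF p(1) that] Gp by auto
    have F2_side: "F2 x \<le> p \<longleftrightarrow> x \<le> p" "G2 x \<le> p \<longleftrightarrow> x \<le> p" if "x \<in> {0..1}" for x
      using F_side G_side hom that by (simp_all add: F2 G2 del: atLeastAtMost_iff)
    have sub: "{0..p} \<subseteq> {0..1}" using p(1) by auto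
    interpret L: interval_homeo 0 p F2 G2
    proof
      show "0 \<le> p" using p by simp
      show "homeomorphism {0..p} {0..p} F2 G2"
        using sub F2_side U.F_in U.G_in U.FG U.GF
        by (intro homeomorphismI continuous_on_subset[OF U.cont_F] continuous_on_subset[OF U.cont_G]) auto
      show "strict_mono_on {0..p} F2" using U.mono_F sub by (auto simp: monotone_on_def)
    qed
    have LP: "L.P = U.P \<inter> {0..p}" using sub by (auto simp: L.P_def U.P_def)
    have "L.gaps \<subseteq> U.gaps"
      unfolding L.gaps_def U.gaps_def LP by auto
    then have "finite L.gaps" using U.finite_gaps fin QU finite_subset by metis
    then obtain V \<eta> where V: "continuous_on {0..p} V" "\<And>x. x \<in> {0..p} \<Longrightarrow> 0 \<le> V x" "V p = 0" "0 < \<eta>"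
      "\<And>x y. x \<in> {0..p} \<Longrightarrow> y \<in> {0..p} \<Longrightarrow> (\<And>n. \<bar>(F2 ^^ n) x - (F2 ^^ n) y\<bar> < \<eta>) \<Longrightarrow>
        (\<And>n. \<bar>(G2 ^^ n) x - (G2 ^^ n) y\<bar> < \<eta>) \<Longrightarrow> bounded_drift F2 V x y \<Longrightarrow> bounded_drift G2 V x y \<Longrightarrow> x = y"
      using L.exists_separating_roof by blast
    have unique: "x = p" if "x \<in> {0..1}" "F x = x" for x
      using F_less[OF that(1) p(1)] F_less[OF p(1) that(1)] that p by auto
    obtain r where r: "0 < r" "\<And>x. x \<in> Q \<Longrightarrow> \<bar>x - p\<bar> < r \<Longrightarrow> F x = x" using iso p by blast
    have iso_p: "x = p" if "x \<in> U.P" "\<bar>x - p\<bar> < r" for x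
      using r(2)[of x] unique[of x] that QU by (auto simp: U.P_def)
    \<comment> \<open>As V p = 0, this is continuous and vanishes to the right of
      \<open>p\<close>.\<close>
    define W where "W = (\<lambda>x. V (min x p))"
    \<comment> \<open>Below r, so that close points on different sides of \<open>p\<close> keep
      within the neighbourhood in which \<open>p\<close> is the only fixed point of
      \<open>F2\<close>.\<close>
    define \<eta>' where "\<eta>' = min \<eta> (r / 2)"
    have \<eta>': "0 < \<eta>'" "\<eta>' \<le> \<eta>" "\<eta>' < r" using V(4) r(1) by (auto simp: \<eta>'_def)
    have cont_W: "continuous_on {0..1} W"
      unfolding W_def using p(1) by (intro continuous_on_compose2[OF V(1)] continuous_intros) auto
    have W_nonneg: "0 \<le> W x" if "x \<in> {0..1}" for x
      unfolding W_def using that p(1) by (intro V(2)) auto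
    have pow_in: "(F ^^ n) x \<in> {0..1}" "(G ^^ n) x \<in> {0..1}" if "x \<in> {0..1}" for x n
      using that by (induction n) (auto simp del: atLeastAtMost_iff simp: hom)
    \<comment> \<open>Odd iterates lie to the right of \<open>p\<close> and contribute nothing, so 2
      * n terms for k reduce to n terms for its square.\<close>
    have drift2: "bounded_drift (k ^^ 2) V x y"
      if k: "bounded_drift k W x y" and x: "\<And>n. (k ^^ (2 * n)) x \<le> p" "\<And>n. p \<le> (k ^^ (2 * n + 1)) x"
        and y: "\<And>n. (k ^^ (2 * n)) y \<le> p" "\<And>n. p \<le> (k ^^ (2 * n + 1)) y" for k x y
    proof -
      obtain K where K: "\<And>n. \<bar>\<Sum>i<n. W ((k ^^ i) x) - W ((k ^^ i) y)\<bar> \<le> K"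
        using k unfolding bounded_drift_def by blast
      have "(\<Sum>i<n. V (((k ^^ 2) ^^ i) x) - V (((k ^^ 2) ^^ i) y)) =
          (\<Sum>i<2 * n. W ((k ^^ i) x) - W ((k ^^ i) y))" for n
        unfolding sum_even_odd funpow_2_funpow
      proof (intro sum.cong refl)
        fix i
        have "W ((k ^^ (2 * i)) x) = V ((k ^^ (2 * i)) x)" "W ((k ^^ (2 * i)) y) = V ((k ^^ (2 * i)) y)"
          "W ((k ^^ (2 * i + 1)) x) = 0" "W ((k ^^ (2 * i + 1)) y) = 0"
          unfolding W_def using x y V(3) by (simp_all only: min_absorb1 min_absorb2)
        then show "V ((k ^^ (2 * i)) x) - V ((k ^^ (2 * i)) y) =
          W ((k ^^ (2 * i)) x) - W ((k ^^ (2 * i)) y) + (W ((k ^^ (2 * i + 1)) x) - W ((k ^^ (2 * i + 1)) y))"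
          by simp
      qed
      then show ?thesis unfolding bounded_drift_def using K by metis
    qed
    have left: "x = y"
      if x: "x \<in> {0..p}" and y: "y \<in> {0..p}" and cF: "\<And>n. \<bar>(F ^^ n) x - (F ^^ n) y\<bar> < \<eta>'"
        and cG: "\<And>n. \<bar>(G ^^ n) x - (G ^^ n) y\<bar> < \<eta>'"
        and dF: "bounded_drift F W x y" and dG: "bounded_drift G W x y" for x y
    proof (rule V(5)[OF x y])
      have even: "(F ^^ (2 * n)) z \<le> p" "(G ^^ (2 * n)) z \<le> p" if "z \<in> {0..p}" for n z
        using L.Fpow_in[OF that, of n] L.Gpow_in[OF that, of n] F2pow G2pow by auto
      have odd: "p \<le> (F ^^ (2 * n + 1)) z" "p \<le> (G ^^ (2 * n + 1)) z" if "z \<in> {0..p}" for n z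
        using even[OF that, of n] F_side(2)[OF pow_in(1)] G_side(2)[OF pow_in(2)] that sub by (simp_all add: subset_iff)
      show "bounded_drift F2 V x y"
        unfolding F2_def by (rule drift2[OF dF even(1)[OF x] odd(1)[OF x] even(1)[OF y] odd(1)[OF y]])
      show "bounded_drift G2 V x y"
        unfolding G2_def by (rule drift2[OF dG even(2)[OF x] odd(2)[OF x] even(2)[OF y] odd(2)[OF y]])
    qed (use cF cG \<eta>'(2) in \<open>auto simp: F2pow G2pow intro: less_le_trans\<close>)
    \<comment> \<open>The even iterates of x and of y stay on their own sides of \<open>p\<close>,
      so each is at least as close to \<open>p\<close> as to the other.\<close>
    have across: "x = y"
      if x: "x \<in> {0..1}" and y: "y \<in> {0..1}" and "x \<le> p" "p \<le> y" and cF: "\<And>n. \<bar>(F ^^ n) x - (F ^^ n) y\<bar> < \<eta>'"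
        and cG: "\<And>n. \<bar>(G ^^ n) x - (G ^^ n) y\<bar> < \<eta>'" for x y
    proof -
      have F2s: "(F2 ^^ n) x \<le> p" "p \<le> (F2 ^^ n) y" "(G2 ^^ n) x \<le> p" "p \<le> (G2 ^^ n) y" for n
      proof -
        have "(F2 ^^ n) p = p" "(G2 ^^ n) p = p"
          by (induction n) (auto simp: F2 G2 p(2) Gp)
        then show "(F2 ^^ n) x \<le> p" "p \<le> (F2 ^^ n) y" "(G2 ^^ n) x \<le> p" "p \<le> (G2 ^^ n) y"
          using U.Fpow_le[OF x p(1) \<open>x \<le> p\<close>, of n] U.Fpow_le[OF p(1) y \<open>p \<le> y\<close>, of n]
            interval_homeo.Fpow_le[OF U.swap x p(1) \<open>x \<le> p\<close>, of n]
            interval_homeo.Fpow_le[OF U.swap p(1) y \<open>p \<le> y\<close>, of n] by simp_all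
      qed
      have near: "\<bar>(F2 ^^ n) x - p\<bar> \<le> \<eta>'" "\<bar>(F2 ^^ n) y - p\<bar> \<le> \<eta>'"
          "\<bar>(G2 ^^ n) x - p\<bar> \<le> \<eta>'" "\<bar>(G2 ^^ n) y - p\<bar> \<le> \<eta>'" for n
        using F2s[of n] cF[of "2 * n"] cG[of "2 * n"] unfolding F2pow G2pow by linarith+
      have "x = p" by (rule U.near_fixed_point_imp_eq[OF x \<eta>'(3) iso_p near(1,3)])
      moreover have "y = p" by (rule U.near_fixed_point_imp_eq[OF y \<eta>'(3) iso_p near(2,4)])
      ultimately show ?thesis by simp
    qed
    have "x = y"
      if x: "x \<in> {0..1}" and y: "y \<in> {0..1}" and cF: "\<And>n. \<bar>(F ^^ n) x - (F ^^ n) y\<bar> < \<eta>'"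
        and cG: "\<And>n. \<bar>(G ^^ n) x - (G ^^ n) y\<bar> < \<eta>'"
        and dF: "bounded_drift F W x y" and dG: "bounded_drift G W x y" for x y
    proof -
      consider "x \<le> p" "y \<le> p" | "x \<le> p" "p \<le> y" | "y \<le> p" "p \<le> x" | "p \<le> x" "p \<le> y" by linarith
      then show ?thesis
      proof cases
        case 1
        then show ?thesis using left[OF _ _ cF cG dF dG] x y by auto
      next
        case 2
        then show ?thesis using across[OF x y _ _ cF cG] by blast
      next
        case 3
        then show ?thesis using across[of y x] x y cF cG by (metis abs_minus_commute)
      next
        case 4
        \<comment> \<open>One application of \<open>F\<close> brings both points to the left half
          and changes the drift by a bounded amount only.\<close>
        have "F x = F y"
        proof (rule left)
          show "F x \<in> {0..p}" "F y \<in> {0..p}" using 4 x y F_side hom(1) by auto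
          show "\<bar>(F ^^ n) (F x) - (F ^^ n) (F y)\<bar> < \<eta>'" for n
            using cF[of "Suc n"] unfolding funpow_Suc_right o_def .
          show "\<bar>(G ^^ n) (F x) - (G ^^ n) (F y)\<bar> < \<eta>'" for n
          proof (cases n)
            case 0
            then show ?thesis using cF[of 1] by simp
          next
            case (Suc m)
            then show ?thesis using cG[of m] hom(3) x y by (simp add: funpow_swap1)
          qed
          show "bounded_drift F W (F x) (F y)" by (rule bounded_drift_image[OF dF])
          show "bounded_drift G W (F x) (F y)"
            by (rule bounded_drift_preimage) (use dG hom(3) x y in \<open>simp del: atLeastAtMost_iff\<close>)
        qed
        then show ?thesis using hom(3) x y by metis
      qed
    qed
    then show ?thesis
      using cont_W W_nonneg \<eta>'(1) by (intro exI[of _ W] exI[of _ \<eta>']) blast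
  qed
qed

section \<open>Least periods and the equivalence\<close>

lemma least_period_eq:
  assumes "f (f x) = x"
  shows "least_period f x = (if f x = x then 1 else 2)"
proof (cases "f x = x")
  case True
  then show ?thesis
    unfolding least_period_def by (auto intro!: Least_equality)
next
  case False
  have "2 \<le> n" if "1 \<le> n" "(f ^^ n) x = x" for n
    using that False by (cases n; cases "n - 1") auto
  then show ?thesis
    using False assms unfolding least_period_def by (auto intro!: Least_equality simp: numeral_2_eq_2)
qed

lemma continuous_on_discrete_codomain_iff:
  fixes k :: "'a::metric_space \<Rightarrow> 'b::discrete_topology"
  shows "continuous_on S k \<longleftrightarrow> (\<forall>x\<in>S. \<exists>r>0. \<forall>y\<in>S. dist y x < r \<longrightarrow> k y = k x)"
  unfolding continuous_on_def tendsto_discrete eventually_at by metis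

theorem proposition4p7:
  fixes I :: "'a::metric_space set" and f :: "'a \<Rightarrow> 'a"
  assumes "I homeomorphic {0..1::real}"
    and "\<exists>g. homeomorphism I I f g"
  shows "admits_kinematic_expansive_suspension I f \<longleftrightarrow>
    finite (components (periodic_points I f)) \<and>
    continuous_on (periodic_points I f) (least_period f)"
proof -
  obtain h k where hk: "homeomorphism I {0..1::real} h k"
    using assms(1) by (auto simp: homeomorphic_def)
  obtain g where fg: "homeomorphism I I f g" using assms(2) by blast
  have h: "continuous_on I h" "continuous_on {0..1} k" "\<And>x. x \<in> I \<Longrightarrow> k (h x) = x"
    "\<And>t. t \<in> {0..1} \<Longrightarrow> h (k t) = t" "\<And>x. x \<in> I \<Longrightarrow> h x \<in> {0..1}" "\<And>t. t \<in> {0..1} \<Longrightarrow> k t \<in> I"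
    using hk unfolding homeomorphism_def by blast+
  have f: "continuous_on I f" "\<And>x. x \<in> I \<Longrightarrow> f x \<in> I" "\<And>x. x \<in> I \<Longrightarrow> g x \<in> I"
    "\<And>x. x \<in> I \<Longrightarrow> g (f x) = x" "\<And>x. x \<in> I \<Longrightarrow> f (g x) = x"
    using fg unfolding homeomorphism_def by blast+
  have compact_I: "compact I"
    using homeomorphic_compactness[OF assms(1)] by simp
  \<comment> \<open>\<open>F\<close> and \<open>G\<close> are \<open>f\<close> and \<open>g\<close>
    in the coordinate \<open>h\<close>, where the order of the reals is available.\<close>
  define F where "F = h \<circ> (f \<circ> k)"
  define G where "G = h \<circ> (g \<circ> k)"
  have FG: "homeomorphism {0..1} {0..1} F G"
    unfolding F_def G_def
    using homeomorphism_compose[OF homeomorphism_compose[OF homeomorphism_symD[OF hk] fg] hk]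
    by (simp add: o_assoc)
  have pow_in: "(f ^^ n) x \<in> I" "(g ^^ n) x \<in> I" if "x \<in> I" for n x
    using that f by (induction n) auto
  have "h (f y) = F (h y)" "h (g y) = G (h y)" if "y \<in> I" for y
    using h(3)[OF that] by (simp_all add: F_def G_def)
  then have hF: "h ((f ^^ n) x) = (F ^^ n) (h x)" and hG: "h ((g ^^ n) x) = (G ^^ n) (h x)" if "x \<in> I" for n x
    using pow_in[OF that] by (induction n) simp_all
  have h_eq: "h x = h y \<longleftrightarrow> x = y" if "x \<in> I" "y \<in> I" for x y
    using h(3) that by metis
  interpret F2: interval_homeo 0 1 "F ^^ 2" "G ^^ 2"
    using interval_homeo_square[OF _ FG] by simp
  define Q where "Q = {t \<in> {0..1}. (F ^^ 2) t = t}"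
  have periodic: "periodic_points I f = {x \<in> I. f (f x) = x}"
  proof (intro equalityI subsetI)
    fix x assume "x \<in> periodic_points I f"
    then obtain n where x: "x \<in> I" "1 \<le> n" "(f ^^ n) x = x" by (auto simp: periodic_points_def)
    have "((F ^^ 2) ^^ n) (h x) = h ((f ^^ (n * 2)) x)"
      using hF[OF x(1)] by (simp add: funpow_mult mult.commute)
    also have "(f ^^ (n * 2)) x = x"
      using x(3) by (simp add: numeral_2_eq_2 funpow_add)
    finally have "(F ^^ 2) (h x) = h x"
      using F2.funpow_fixed_imp_fixed[OF h(5)[OF x(1)] _ x(2)] by simp
    then have "h ((f ^^ 2) x) = h x" using hF[OF x(1)] by simp
    then show "x \<in> {x \<in> I. f (f x) = x}"
      using h_eq[OF pow_in(1)[OF x(1)] x(1), of 2] x(1) by (simp add: numeral_2_eq_2)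
  next
    fix x assume "x \<in> {x \<in> I. f (f x) = x}"
    then show "x \<in> periodic_points I f"
      by (auto simp: periodic_points_def numeral_2_eq_2 intro!: exI[of _ "2::nat"])
  qed
  have Q_iff: "h x \<in> Q \<longleftrightarrow> x \<in> periodic_points I f" if "x \<in> I" for x
    using hF[OF that, of 2] h(5)[OF that] h_eq[OF pow_in(1)[OF that] that, of 2] that
    unfolding Q_def periodic by (simp add: numeral_2_eq_2)
  have PQ: "homeomorphism (periodic_points I f) Q h k"
  proof (rule homeomorphism_of_subsets[OF hk])
    show "periodic_points I f \<subseteq> I" by (auto simp: periodic)
    show "Q \<subseteq> {0..1}" by (auto simp: Q_def)
    show "h ` periodic_points I f = Q"
    proof (intro equalityI subsetI)
      fix t assume "t \<in> Q"
      then have "t \<in> {0..1}" by (simp add: Q_def)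
      then show "t \<in> h ` periodic_points I f"
        using Q_iff[OF h(6)] h(4) \<open>t \<in> Q\<close> by (metis imageI)
    qed (use Q_iff in \<open>auto simp: periodic\<close>)
  qed
  have components_iff: "finite (components (periodic_points I f)) \<longleftrightarrow> finite (components Q)"
    using finite_components_homeomorphism[OF PQ] finite_components_homeomorphism[OF homeomorphism_symD[OF PQ]]
    by blast
  have lp: "least_period f x = (if f x = x then 1 else 2)" if "x \<in> periodic_points I f" for x
    using that least_period_eq[of f x] by (simp add: periodic)
  show ?thesis
  proof
    assume "admits_kinematic_expansive_suspension I f"
    then obtain T \<phi> M d where T: "continuous_on I T" "\<forall>x\<in>I. 0 < T x" and flow: "suspension_flow I f T \<phi>"
      and M: "Metric_space M d" "Metric_space.mtopology M d = suspension_topology I f T"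
      and ke: "kinematic_expansive M d \<phi>"
      unfolding admits_kinematic_expansive_suspension_def by blast
    interpret suspension I f g T
      using compact_I fg T by unfold_locales auto
    note trapped = kinematic_expansive_imp_trapped_periodic[OF flow M ke]
    have "finite (components Q)"
    proof (rule ccontr)
      assume inf: "infinite (components Q)"
      have "compact Q"
        using F2.compact_P by (simp add: F2.P_def Q_def)
      from infinite_components_accumulate[OF this inf]
      obtain p where p: "p \<in> Q" and acc: "\<And>\<eta>. 0 < \<eta> \<Longrightarrow>
          \<exists>s\<in>Q. \<exists>t\<in>Q. \<exists>x. s < x \<and> x < t \<and> x \<notin> Q \<and> \<bar>s - p\<bar> < \<eta> \<and> \<bar>t - p\<bar> < \<eta>"
        by blast
      have p01: "p \<in> {0..1}" using p by (simp add: Q_def)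
      have kp: "k p \<in> I" "(f ^^ 2) (k p) = k p"
        using Q_iff[OF h(6)[OF p01]] p h(4)[OF p01] by (auto simp: periodic numeral_2_eq_2)
      obtain \<eta>' where \<eta>': "0 < \<eta>'" "\<And>x. x \<in> I \<Longrightarrow>
          (\<And>n. dist ((f ^^ (2 * n)) x) (k p) < \<eta>' \<and> dist ((g ^^ (2 * n)) x) (k p) < \<eta>') \<Longrightarrow> (f ^^ 2) x = x"
        using trapped[OF kp] by auto
      obtain \<eta> where \<eta>: "0 < \<eta>" "\<And>t. t \<in> {0..1} \<Longrightarrow> \<bar>t - p\<bar> < \<eta> \<Longrightarrow> dist (k t) (k p) < \<eta>'"
        using h(2) p01 \<eta>'(1) unfolding continuous_on_iff dist_real_def by metis
      \<comment> \<open>s and t are fixed by the increasing square, so the orbit of x under it stays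
        between them and hence near p. Expansivity then makes x periodic, although it is not in
        \<open>Q\<close>.\<close>
      obtain s t x where st: "s \<in> Q" "t \<in> Q" "s < x" "x < t" "x \<notin> Q" "\<bar>s - p\<bar> < \<eta>" "\<bar>t - p\<bar> < \<eta>"
        using acc[OF \<eta>(1)] by blast
      have s01: "s \<in> {0..1}" and t01: "t \<in> {0..1}" using st by (auto simp: Q_def)
      then have x01: "x \<in> {0..1}" using st by auto
      have fixed: "((F ^^ 2) ^^ n) s = s" "((F ^^ 2) ^^ n) t = t" "((G ^^ 2) ^^ n) s = s" "((G ^^ 2) ^^ n) t = t" for n
      proof -
        have "(F ^^ 2) s = s" "(F ^^ 2) t = t" using st by (auto simp: Q_def)
        moreover from this have "(G ^^ 2) s = s" "(G ^^ 2) t = t"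
          using F2.GF[OF s01] F2.GF[OF t01] by simp_all
        ultimately show "((F ^^ 2) ^^ n) s = s" "((F ^^ 2) ^^ n) t = t" "((G ^^ 2) ^^ n) s = s" "((G ^^ 2) ^^ n) t = t"
          by (induction n) simp_all
      qed
      interpret G2: interval_homeo 0 1 "G ^^ 2" "F ^^ 2" by (rule F2.swap)
      have "s \<le> ((F ^^ 2) ^^ n) x" "((F ^^ 2) ^^ n) x \<le> t" "s \<le> ((G ^^ 2) ^^ n) x" "((G ^^ 2) ^^ n) x \<le> t" for n
        using F2.Fpow_le[OF s01 x01, of n] F2.Fpow_le[OF x01 t01, of n]
          G2.Fpow_le[OF s01 x01, of n] G2.Fpow_le[OF x01 t01, of n] st fixed[of n] by simp_all
      then have near: "\<bar>((F ^^ 2) ^^ n) x - p\<bar> < \<eta>" "\<bar>((G ^^ 2) ^^ n) x - p\<bar> < \<eta>" for n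
        using st(6,7) unfolding abs_less_iff
        by (smt (verit, best))+
      have "(f ^^ 2) (k x) = k x"
      proof (rule \<eta>'(2)[OF h(6)[OF x01]])
        fix n
        have "(f ^^ (2 * n)) (k x) = k (((F ^^ 2) ^^ n) x)"
          using hF[OF h(6)[OF x01], of "2 * n"] h(3)[OF pow_in(1)[OF h(6)[OF x01]]] h(4)[OF x01]
          unfolding funpow_2_funpow by metis
        moreover have "(g ^^ (2 * n)) (k x) = k (((G ^^ 2) ^^ n) x)"
          using hG[OF h(6)[OF x01], of "2 * n"] h(3)[OF pow_in(2)[OF h(6)[OF x01]]] h(4)[OF x01]
          unfolding funpow_2_funpow by metis
        ultimately show "dist ((f ^^ (2 * n)) (k x)) (k p) < \<eta>' \<and> dist ((g ^^ (2 * n)) (k x)) (k p) < \<eta>'"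
          using \<eta>(2)[OF F2.Fpow_in[OF x01] near(1)] \<eta>(2)[OF F2.Gpow_in[OF x01] near(2)] by simp
      qed
      then have "k x \<in> periodic_points I f" using h(6)[OF x01] by (simp add: periodic numeral_2_eq_2)
      then show False using Q_iff[OF h(6)[OF x01]] h(4)[OF x01] st(5) by simp
    qed
    moreover have "continuous_on (periodic_points I f) (least_period f)"
      unfolding continuous_on_discrete_codomain_iff
    proof
      fix p assume p: "p \<in> periodic_points I f"
      then have pI: "p \<in> I" by (simp add: periodic)
      have "\<exists>r>0. \<forall>x\<in>periodic_points I f. dist x p < r \<longrightarrow> (f x = x \<longleftrightarrow> f p = p)"
      proof (cases "f p = p")
        case True
        \<comment> \<open>With m = 1, a nearby point x with f (f x) = x is trapped: its orbit
          consists of x and f x, both close to p.\<close>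
        then obtain \<eta> where \<eta>: "0 < \<eta>" "\<And>x. x \<in> I \<Longrightarrow>
            (\<And>n. dist ((f ^^ n) x) p < \<eta> \<and> dist ((g ^^ n) x) p < \<eta>) \<Longrightarrow> f x = x"
          using trapped[OF pI, of 1] by auto
        obtain r where r: "0 < r" "\<And>x. x \<in> I \<Longrightarrow> dist x p < r \<Longrightarrow> dist (f x) (f p) < \<eta>"
          using f(1) pI \<eta>(1) unfolding continuous_on_iff by metis
        have "f x = x" if "x \<in> periodic_points I f" "dist x p < min r \<eta>" for x
        proof (rule \<eta>(2))
          have x: "x \<in> I" "f (f x) = x" using that by (auto simp: periodic)
          then have "g x = f x" using f(4)[OF f(2)[OF x(1)]] by simp
          have "(f ^^ n) x \<in> {x, f x} \<and> (g ^^ n) x \<in> {x, f x}" for n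
            by (induction n) (use x \<open>g x = f x\<close> f(4) in auto)
          then show "dist ((f ^^ n) x) p < \<eta> \<and> dist ((g ^^ n) x) p < \<eta>" for n
            using r(2)[OF x(1)] that(2) True by (metis insertE min_less_iff_conj singletonD)
          show "x \<in> I" by fact
        qed
        then show ?thesis using True r(1) \<eta>(1) by (intro exI[of _ "min r \<eta>"]) auto
      next
        case False
        \<comment> \<open>Being moved by \<open>f\<close> is an open condition; e is half the
          distance by which \<open>f\<close> moves p.\<close>
        define e where "e = dist p (f p) / 2"
        have "0 < e" using False by (simp add: e_def)
        obtain r where r: "0 < r" "\<And>x. x \<in> I \<Longrightarrow> dist x p < r \<Longrightarrow> dist (f x) (f p) < e"
          using f(1) pI \<open>0 < e\<close> unfolding continuous_on_iff by metis
        have "f x \<noteq> x" if "x \<in> periodic_points I f" "dist x p < min r e" for x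
        proof
          assume "f x = x"
          moreover have "x \<in> I" using that by (simp add: periodic)
          ultimately have "dist x (f p) < e" using r(2)[of x] that by simp
          then have "dist p (f p) < e + e"
            using dist_triangle2[of p "f p" x] that by (simp add: dist_commute)
          then show False by (simp add: e_def)
        qed
        then show ?thesis using False r(1) \<open>0 < e\<close> by (intro exI[of _ "min r e"]) auto
      qed
      then show "\<exists>r>0. \<forall>x\<in>periodic_points I f. dist x p < r \<longrightarrow> least_period f x = least_period f p"
        using lp[OF p] lp by metis
    qed
    ultimately show "finite (components (periodic_points I f)) \<and>
        continuous_on (periodic_points I f) (least_period f)"
      using components_iff by simp
  next
    assume R: "finite (components (periodic_points I f)) \<and>
        continuous_on (periodic_points I f) (least_period f)"
    \<comment> \<open>Least periods take values in a discrete space, so continuity makes them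
      constant near a fixed point, where the value is 1.\<close>
    have iso: "\<forall>p\<in>{0..1}. F p = p \<longrightarrow> (\<exists>r>0. \<forall>t\<in>Q. \<bar>t - p\<bar> < r \<longrightarrow> F t = t)"
    proof (intro ballI impI)
      fix p assume p: "p \<in> {0..1}" "F p = p"
      have Fk: "F t = t \<longleftrightarrow> f (k t) = k t" if "t \<in> {0..1}" for t
        using h_eq[OF f(2)[OF h(6)[OF that]] h(6)[OF that]] h(4)[OF that] by (simp add: F_def)
      have "p \<in> Q" using p by (simp add: Q_def numeral_2_eq_2)
      have kQ: "k t \<in> periodic_points I f" if "t \<in> Q" for t
        using PQ that by (auto simp: homeomorphism_def)
      have "continuous_on Q k" "k ` Q \<subseteq> periodic_points I f"
        using PQ kQ by (auto simp: homeomorphism_def)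
      from continuous_on_compose2[OF conjunct2[OF R] this]
      have "continuous_on Q (\<lambda>t. least_period f (k t))" .
      from bspec[OF continuous_on_discrete_codomain_iff[THEN iffD1, OF this] \<open>p \<in> Q\<close>]
      obtain r where r: "0 < r" "\<forall>t\<in>Q. \<bar>t - p\<bar> < r \<longrightarrow> least_period f (k t) = least_period f (k p)"
        unfolding dist_real_def by (elim exE conjE)
      have "F t = t" if t: "t \<in> Q" "\<bar>t - p\<bar> < r" for t
      proof -
        have "least_period f (k t) = least_period f (k p)"
          using r(2) t by blast
        also have "\<dots> = 1"
          using lp[OF kQ[OF \<open>p \<in> Q\<close>]] Fk[OF p(1)] p(2) by simp
        finally have "f (k t) = k t"
          using lp[OF kQ[OF t(1)]] by (cases "f (k t) = k t") simp_all
        moreover have "t \<in> {0..1}" using t(1) by (simp add: Q_def)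
        ultimately show ?thesis using Fk by blast
      qed
      then show "\<exists>r>0. \<forall>t\<in>Q. \<bar>t - p\<bar> < r \<longrightarrow> F t = t" using r(1) by blast
    qed
    have "finite (components Q)" using R components_iff by simp
    from exists_separating_roof_unit_interval[OF FG, folded Q_def, OF this iso]
    obtain V \<eta> where V: "continuous_on {0..1} V" "\<forall>x\<in>{0..1}. 0 \<le> V x" "0 < \<eta>"
      and sep: "\<forall>x\<in>{0..1}. \<forall>y\<in>{0..1}. (\<forall>n. \<bar>(F ^^ n) x - (F ^^ n) y\<bar> < \<eta>) \<longrightarrow>
        (\<forall>n. \<bar>(G ^^ n) x - (G ^^ n) y\<bar> < \<eta>) \<longrightarrow> bounded_drift F V x y \<longrightarrow>
        bounded_drift G V x y \<longrightarrow> x = y"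
      by (elim exE conjE)
    \<comment> \<open>The constant 1 makes the nonnegative roof positive and cancels in every
      drift.\<close>
    define T where "T = (\<lambda>x. 1 + V (h x))"
    interpret embedded_suspension I f g T h
    proof
      show "continuous_on I T"
        unfolding T_def using h by (intro continuous_intros continuous_on_compose2[OF V(1)]) auto
      show "0 < T x" if "x \<in> I" for x
        using V(2) h(5)[OF that] by (force simp: T_def intro: add_pos_nonneg)
      show "inj_on h I" using h_eq by (auto simp: inj_on_def)
    qed (use compact_I fg h in auto)
    show "admits_kinematic_expansive_suspension I f"
    proof (rule admits_kinematic_expansive_suspensionI[OF V(3)])
      fix x y assume xy: "x \<in> I" "y \<in> I"
        and close: "\<And>n. \<bar>h ((f ^^ n) x) - h ((f ^^ n) y)\<bar> < \<eta>" "\<And>n. \<bar>h ((g ^^ n) x) - h ((g ^^ n) y)\<bar> < \<eta>"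
        and drift: "bounded_drift f T x y" "bounded_drift g T x y"
      have "bounded_drift F V (h x) (h y)" "bounded_drift G V (h x) (h y)"
        using drift unfolding bounded_drift_def T_def by (simp_all add: hF hG xy)
      then have "h x = h y"
        using bspec[OF bspec[OF sep h(5)[OF xy(1)]] h(5)[OF xy(2)]] close by (simp add: hF hG xy)
      then show "x = y" using h_eq xy by blast
    qed
  qed
qed

end
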